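(* Let $\mathbb{F}$ be an infinite field with $\operatorname{char}\mathbb{F}\neq 2$ and let $n=3$. For every $d>0$ the set $$\sigma_2(Y_i),\ 1\le i\le d;\qquad \operatorname{tr}(Y_iY_j),\ 1\le i<j\le d;\qquad \operatorname{tr}(Y_iY_jY_k),\ 1\le i<j<k\le d$$ is a minimal homogeneous set of generators for the algebra $R_{-}^{O(3)}$.
   Context: Let $S_{-}$ be the space of $n\times n$ skew-symmetric matrices ($A^T=-A$) over $\mathbb{F}$ (here $n=3$) and $V_{-}=S_{-}\oplus\cdots\oplus S_{-}$ ($d$ summands). The orthogonal group $O(n)=\{g\in \mathbb{F}^{n\times n} : gg^T=E\}$ acts on $V_{-}$ by $g\cdot(A_1,\ldots,A_d)=(gA_1g^{-1},\ldots,gA_dg^{-1})$, hence on the coordinate ring $R_{-}=\mathbb{F}[V_{-}]=\mathbb{F}[x_{ij}(k)\mid 1\le i<j\le n,\ 1\le k\le d]$ (a polynomial ring) by $(g\cdot f)(h)=f(g^{-1}\cdot h)$. $R_{-}^{O(n)}$ is the algebra of invariants. $Y_k$ is the generic skew-symmetric $n\times n$ matrix over $R_{-}$ with $(i,j)$-entry $x_{ij}(k)$ if $i<j$, $-x_{ji}(k)$ if $i>j$, and $0$ if $i=j$. For an $n\times n$ matrix $X$, $\sigma_t(X)$ is defined by $\det(X+\lambda E)=\sum_{t=0}^n\lambda^{n-t}\sigma_t(X)$. $R_{-}^{O(n)}$ is $\mathbb{N}^d$-graded by multidegree $(t_1,\ldots,t_d)$, where $t_k$ is the total degree in the variables $x_{ij}(k)$.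 A minimal homogeneous set of generators is a minimal (by inclusion) set of $\mathbb{N}^d$-homogeneous elements generating $R_{-}^{O(n)}$ as an $\mathbb{F}$-algebra. *)

theory Defs
  imports
    "HOL-Analysis.Analysis"
    "HOL-Computational_Algebra.Polynomial"
    "HOL-Library.Poly_Mapping"
begin

text \<open>
  Matrices are \<open>'a^'n^'n\<close> with a finite linearly ordered index type \<open>'n\<close>; for \<open>n = 3\<close> this is
  the type \<open>3\<close>, whose elements \<open>0 < 1 < 2\<close> play the role of the indices \<open>1 < 2 < 3\<close>.
  The variable \<open>x\<^sub>i\<^sub>j(k)\<close> is the triple \<open>(i, j, k)\<close>. A polynomial is a finitely supported map from
  monomials (finitely supported exponent maps) to coefficients, multiplied by convolution.
  The polynomial type has a variable for every triple; \<open>R_minus d\<close> below cuts out the polynomials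
  in the variables with \<open>i < j\<close> and \<open>1 \<le> k \<le> d\<close>.
\<close>

type_synonym 'n var = "'n \<times> 'n \<times> nat"
type_synonym 'n monomial = "'n var \<Rightarrow>\<^sub>0 nat"
type_synonym ('n, 'a) polynomial = "'n monomial \<Rightarrow>\<^sub>0 'a"

definition Const :: "'a::zero \<Rightarrow> ('n, 'a) polynomial" where
  "Const c = Poly_Mapping.single 0 c"

definition Var :: "'n var \<Rightarrow> ('n, 'a::zero_neq_one) polynomial" where
  "Var v = Poly_Mapping.single (Poly_Mapping.single v 1) 1"

definition variables :: "nat \<Rightarrow> 'n::linorder var set" where
  "variables d = {(i, j, k). i < j \<and> 1 \<le> k \<and> k \<le> d}"

definition R_minus :: "nat \<Rightarrow> ('n::linorder, 'a::zero) polynomial set" where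
  "R_minus d = {f. \<forall>m \<in> Poly_Mapping.keys f. Poly_Mapping.keys m \<subseteq> variables d}"

definition S_minus :: "('a::field ^ 'n ^ 'n) set" where
  "S_minus = {A. transpose A = - A}"

definition V_minus :: "nat \<Rightarrow> (nat \<Rightarrow> 'a::field ^ 'n ^ 'n) set" where
  "V_minus d = (\<Pi>\<^sub>E k \<in> {1..d}. S_minus)"

definition orthogonal_group :: "('a::field ^ 'n ^ 'n) set" where
  "orthogonal_group = {g. g ** transpose g = mat 1}"

definition act_V :: "nat \<Rightarrow> 'a::field ^ 'n ^ 'n \<Rightarrow> (nat \<Rightarrow> 'a ^ 'n ^ 'n) \<Rightarrow> (nat \<Rightarrow> 'a ^ 'n ^ 'n)" where
  "act_V d g h = (\<lambda>k \<in> {1..d}. g ** h k ** matrix_inv g)"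

text \<open>The value of \<open>f\<close> at \<open>h\<close>, where \<open>x\<^sub>i\<^sub>j(k)\<close> is the \<open>(i, j)\<close> entry of the \<open>k\<close>-th matrix.\<close>

definition eval_at :: "('n::finite, 'a::field) polynomial \<Rightarrow> (nat \<Rightarrow> 'a ^ 'n ^ 'n) \<Rightarrow> 'a" where
  "eval_at f h = (\<Sum>m \<in> Poly_Mapping.keys f. Poly_Mapping.lookup f m *
     (\<Prod>(i, j, k) \<in> Poly_Mapping.keys m. (h k $ i $ j) ^ Poly_Mapping.lookup m (i, j, k)))"

definition act_fun :: "nat \<Rightarrow> 'a::field ^ 'n ^ 'n \<Rightarrow> ((nat \<Rightarrow> 'a ^ 'n ^ 'n) \<Rightarrow> 'a)
    \<Rightarrow> ((nat \<Rightarrow> 'a ^ 'n ^ 'n) \<Rightarrow> 'a)" where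
  "act_fun d g \<phi> = (\<lambda>h. \<phi> (act_V d (matrix_inv g) h))"

text \<open>
  \<open>g \<cdot> f = f\<close> is equality of functions on \<open>V_minus d\<close>. This is the equality in the coordinate
  ring for an infinite field, where a polynomial in \<open>R_minus d\<close> is determined by its values
  on \<open>V_minus d\<close> (in characteristic other than 2, skew-symmetric matrices have zero diagonal,
  so the \<open>x\<^sub>i\<^sub>j(k)\<close> with \<open>i < j\<close> are free coordinates).
\<close>

definition invariants :: "nat \<Rightarrow> ('n::{finite, linorder}, 'a::field) polynomial set" where
  "invariants d = {f \<in> R_minus d. \<forall>g \<in> orthogonal_group. \<forall>h \<in> V_minus d.
     act_fun d g (eval_at f) h = eval_at f h}"

definition generic_skew ::
    "nat \<Rightarrow> ('n, 'a::field) polynomial ^ ('n::{finite, linorder}) ^ ('n::{finite, linorder})" where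
  "generic_skew k = (\<chi> i j. if i < j then Var (i, j, k) else if j < i then - Var (j, i, k) else 0)"

text \<open>
  \<open>det (X + \<lambda> E) = \<Sum>t\<le>n. \<lambda>^(n - t) * \<sigma>\<^sub>t(X)\<close>, with \<open>\<lambda>\<close> the indeterminate of the univariate
  polynomial ring over the entries and \<open>mat \<lambda> = \<lambda> E\<close>. Only meaningful for \<open>t \<le> n\<close>.
\<close>

definition sigma :: "nat \<Rightarrow> 'r::comm_ring_1 ^ 'n ^ 'n \<Rightarrow> 'r" where
  "sigma t X = coeff (det ((\<chi> i j. [:X $ i $ j:]) + mat [:0, 1:])) (CARD('n) - t)"

definition multidegree :: "'n::{finite, linorder} monomial \<Rightarrow> nat \<Rightarrow> nat" where
  "multidegree m k = (\<Sum>(i, j) \<in> {(i, j). i < j}. Poly_Mapping.lookup m (i, j, k))"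

definition homogeneous :: "nat \<Rightarrow> ('n::{finite, linorder}, 'a::field) polynomial \<Rightarrow> bool" where
  "homogeneous d f \<longleftrightarrow> (\<exists>t. \<forall>m \<in> Poly_Mapping.keys f. \<forall>k \<in> {1..d}. multidegree m k = t k)"

inductive_set generated_algebra :: "('n, 'a::field) polynomial set \<Rightarrow> ('n, 'a) polynomial set"
  for S where
  const: "Const c \<in> generated_algebra S"
| gen: "f \<in> S \<Longrightarrow> f \<in> generated_algebra S"
| add: "f \<in> generated_algebra S \<Longrightarrow> g \<in> generated_algebra S \<Longrightarrow> f + g \<in> generated_algebra S"
| mult: "f \<in> generated_algebra S \<Longrightarrow> g \<in> generated_algebra S \<Longrightarrow> f * g \<in> generated_algebra S"

definition homogeneous_generators ::
    "nat \<Rightarrow> ('n::{finite, linorder}, 'a::field) polynomial set \<Rightarrow> ('n, 'a) polynomial set \<Rightarrow> bool" where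
  "homogeneous_generators d A S \<longleftrightarrow>
     S \<subseteq> A \<and> (\<forall>f \<in> S. homogeneous d f) \<and> generated_algebra S = A"

definition minimal_homogeneous_generators ::
    "nat \<Rightarrow> ('n::{finite, linorder}, 'a::field) polynomial set \<Rightarrow> ('n, 'a) polynomial set \<Rightarrow> bool" where
  "minimal_homogeneous_generators d A S \<longleftrightarrow>
     homogeneous_generators d A S \<and> (\<forall>T. T \<subset> S \<longrightarrow> \<not> homogeneous_generators d A T)"

end

theory Submission
  imports "HOL-Algebra.Algebraic_Closure_Type" Defs
begin

text \<open>
  Identify a skew-symmetric \<open>3 \<times> 3\<close> matrix with the vector of its entries above the diagonal. Then
  \<open>O(3)\<close> acts through rotations, and the generators are, up to scalars, the dot products and the
  triple products of the vectors. Reflections act as half turns, and no other elements of \<open>O(3)\<close>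
  are needed: invariance under all half turns over the infinite field \<open>F\<close> is a polynomial
  identity, hence it holds over the algebraic closure \<open>K\<close> as well.

  Over \<open>K\<close> every vector is a product of two linear forms \<open>a\<close>, \<open>b\<close> in two variables, and half turns
  come from \<open>SL(2, K)\<close>. So an invariant \<open>f\<close> becomes an \<open>SL(2)\<close>-invariant of the \<open>2 d\<close> vectors
  \<open>a\<^sub>k\<close>, \<open>b\<^sub>k\<close>, which is a combination of products of brackets \<open>[p, q]\<close>. This holds in every
  characteristic: identify two vectors \<open>v\<^sub>i\<close> and \<open>v\<^sub>j\<close>, lift the bracket expression that exists by
  induction, and divide the difference, which vanishes for \<open>v\<^sub>i = v\<^sub>j\<close>, by \<open>[v\<^sub>i, v\<^sub>j]\<close>.

  In these products \<open>a\<^sub>k\<close> and \<open>b\<^sub>k\<close> occur equally often. Contracting them in pairs leaves a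
  polynomial in dot products, triple products and the roots \<open>t\<^sub>k = [a\<^sub>k, b\<^sub>k]\<close>. Now \<open>t\<^sub>k\<^sup>2\<close> is a dot
  product, and exchanging \<open>a\<^sub>k\<close> and \<open>b\<^sub>k\<close> preserves \<open>f\<close> and changes the sign of \<open>t\<^sub>k\<close>, so the roots
  drop out because 2 is invertible. An \<open>F\<close>-linear retraction of \<open>K\<close> onto \<open>F\<close> makes the
  coefficients rational.

  The generators have pairwise distinct multidegrees and total degree 2 or 3, whereas products of
  two of them have degree at least 4; so none of them is superfluous.
\<close>

text \<open>Otherwise \<open>polynomial\<close> is a keyword and cannot be used as the name of a type.\<close>

no_notation Polynomials.polynomial (\<open>polynomial\<index>\<close>)

section \<open>Polynomial functions\<close>

text \<open>Functions instead of formal polynomials: substitution is then composition, and one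
  notion covers both polynomial functions (\<open>C\<close> the coordinates) and algebras generated
  by given invariants.\<close>

inductive_set falg :: "('p \<Rightarrow> 'k::field) set \<Rightarrow> ('p \<Rightarrow> 'k) set" for C where
  const: "(\<lambda>_. c) \<in> falg C"
| gen: "f \<in> C \<Longrightarrow> f \<in> falg C"
| add: "f \<in> falg C \<Longrightarrow> g \<in> falg C \<Longrightarrow> (\<lambda>x. f x + g x) \<in> falg C"
| mult: "f \<in> falg C \<Longrightarrow> g \<in> falg C \<Longrightarrow> (\<lambda>x. f x * g x) \<in> falg C"

lemma falg_uminus: "f \<in> falg C \<Longrightarrow> (\<lambda>x. - f x) \<in> falg C"
  using falg.mult[OF falg.const[of "-1"], of f C] by simp

lemma falg_diff: "f \<in> falg C \<Longrightarrow> g \<in> falg C \<Longrightarrow> (\<lambda>x. f x - g x) \<in> falg C"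
  using falg.add[of f C, OF _ falg_uminus] by simp

lemma falg_power: "f \<in> falg C \<Longrightarrow> (\<lambda>x. f x ^ n) \<in> falg C"
  by (induction n) (auto intro: falg.intros)

lemma falg_sum:
  assumes "\<And>i. i \<in> I \<Longrightarrow> f i \<in> falg C"
  shows "(\<lambda>x. \<Sum>i\<in>I. f i x) \<in> falg C"
  using assms by (induction I rule: infinite_finite_induct) (auto intro: falg.intros)

lemma falg_prod:
  assumes "\<And>i. i \<in> I \<Longrightarrow> f i \<in> falg C"
  shows "(\<lambda>x. \<Prod>i\<in>I. f i x) \<in> falg C"
  using assms by (induction I rule: infinite_finite_induct) (auto intro: falg.intros)

lemma falg_compose:
  assumes "f \<in> falg C" and "\<And>c. c \<in> C \<Longrightarrow> (\<lambda>x. c (T x)) \<in> falg D"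
  shows "(\<lambda>x. f (T x)) \<in> falg D"
  using assms by induction (auto intro: falg.intros)

abbreviation polyfun :: "(('v \<Rightarrow> 'k::field) \<Rightarrow> 'k) set" where
  "polyfun \<equiv> falg (range (\<lambda>v \<phi>. \<phi> v))"

lemma polyfun_coord [simp]: "(\<lambda>\<phi>. \<phi> v) \<in> polyfun"
  by (rule falg.gen) auto

lemmas polyfun_intros = falg.const falg.add falg.mult falg_uminus falg_diff falg_power polyfun_coord

lemma polyfun_subst:
  assumes "f \<in> polyfun" and "\<And>v. (\<lambda>x. T x v) \<in> falg D"
  shows "(\<lambda>x. f (T x)) \<in> falg D"
  using falg_compose[OF assms(1), of T D] assms(2) by blast

lemma polyfun_update:
  assumes "f \<in> polyfun" "a \<in> polyfun"
  shows "(\<lambda>\<phi>. f (\<phi>(w := a \<phi>))) \<in> polyfun"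
proof (rule polyfun_subst[OF assms(1)])
  show "(\<lambda>x. (x(w := a x)) v) \<in> polyfun" for v
    using assms(2) by (cases "v = w") auto
qed

text \<open>Restriction to the line through \<open>a\<close> and \<open>b\<close> reduces many
  variables to one, where a nonzero polynomial has finitely many roots.\<close>

lemma polyfun_line:
  assumes "f \<in> polyfun"
  shows "\<exists>p. \<forall>s. poly p s = f (\<lambda>v. a v + s * (b v - a v))"
  using assms
proof induction
  case (const c)
  show ?case by (rule exI[of _ "[:c:]"]) simp
next
  case (gen f)
  then obtain v where "f = (\<lambda>\<phi>. \<phi> v)" by blast
  then show ?case by (intro exI[of _ "[:a v, b v - a v:]"]) simp
next
  case (add f g)
  then obtain p q where "\<forall>s. poly p s = f (\<lambda>v. a v + s * (b v - a v))"
    "\<forall>s. poly q s = g (\<lambda>v. a v + s * (b v - a v))" by blast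
  then show ?case by (intro exI[of _ "p + q"]) simp
next
  case (mult f g)
  then obtain p q where "\<forall>s. poly p s = f (\<lambda>v. a v + s * (b v - a v))"
    "\<forall>s. poly q s = g (\<lambda>v. a v + s * (b v - a v))" by blast
  then show ?case by (intro exI[of _ "p * q"]) simp
qed

lemma poly_eq_0_infinite:
  fixes p :: "'k::field poly"
  assumes "infinite E" "\<And>s. s \<in> E \<Longrightarrow> poly p s = 0"
  shows "p = 0"
proof (rule ccontr)
  assume "p \<noteq> 0"
  then have "finite {s. poly p s = 0}" by (rule poly_roots_finite)
  moreover have "E \<subseteq> {s. poly p s = 0}" using assms(2) by blast
  ultimately show False using assms(1) finite_subset by blast
qed

lemma poly_eq_infinite:
  fixes p q :: "'k::field poly"
  assumes "infinite E" "\<And>s. s \<in> E \<Longrightarrow> poly p s = poly q s"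
  shows "p = q"
  using poly_eq_0_infinite[of E "p - q"] assms by simp

text \<open>Join \<open>\<phi>\<close> to the point \<open>a\<close> with
  \<open>f a \<noteq> 0\<close>. On this line both factors are univariate polynomials whose product
  has infinitely many roots, and the first one is nonzero.\<close>

lemma polyfun_no_zero_divisors:
  fixes f g :: "('v \<Rightarrow> 'k::field) \<Rightarrow> 'k"
  assumes inf: "infinite (UNIV :: 'k set)" and f: "f \<in> polyfun" and g: "g \<in> polyfun"
    and nz: "f a \<noteq> 0" and z: "\<And>\<phi>. f \<phi> * g \<phi> = 0"
  shows "g \<phi> = 0"
proof -
  obtain p where p: "\<forall>s. poly p s = f (\<lambda>v. a v + s * (\<phi> v - a v))"
    using polyfun_line[OF f] by blast
  obtain q where q: "\<forall>s. poly q s = g (\<lambda>v. a v + s * (\<phi> v - a v))"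
    using polyfun_line[OF g] by blast
  have "p * q = 0"
    by (rule poly_eq_0_infinite[OF inf]) (simp add: p q z)
  moreover have "poly p 0 \<noteq> 0" using p nz by simp
  ultimately have "q = 0" by auto
  then have "poly q 1 = 0" by simp
  then show ?thesis using q by simp
qed

lemma polyfun_cancel:
  fixes f g h :: "('v \<Rightarrow> 'k::field) \<Rightarrow> 'k"
  assumes "infinite (UNIV :: 'k set)" "f \<in> polyfun" "g \<in> polyfun" "h \<in> polyfun"
    and "f a \<noteq> 0" and "\<And>\<phi>. f \<phi> * g \<phi> = f \<phi> * h \<phi>"
  shows "g \<phi> = h \<phi>"
  using polyfun_no_zero_divisors[of f "\<lambda>\<phi>. g \<phi> - h \<phi>" a \<phi>] assms
  by (simp add: right_diff_distrib falg_diff)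

text \<open>The set of variables may be infinite; this makes arguments that change one variable at a
  time terminate.\<close>

lemma polyfun_finite_support:
  assumes "f \<in> polyfun"
  shows "\<exists>W. finite W \<and> (\<forall>\<phi> \<psi>. (\<forall>v\<in>W. \<phi> v = \<psi> v) \<longrightarrow> f \<phi> = f \<psi>)"
  using assms
proof induction
  case (gen f)
  then obtain v where "f = (\<lambda>\<phi>. \<phi> v)" by blast
  then show ?case by (intro exI[of _ "{v}"]) simp
next
  case (add f g)
  then obtain W U where "finite W" "\<forall>\<phi> \<psi>. (\<forall>v\<in>W. \<phi> v = \<psi> v) \<longrightarrow> f \<phi> = f \<psi>"
    "finite U" "\<forall>\<phi> \<psi>. (\<forall>v\<in>U. \<phi> v = \<psi> v) \<longrightarrow> g \<phi> = g \<psi>" by blast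
  then show ?case by (intro exI[of _ "W \<union> U"]) (metis UnCI finite_UnI)
next
  case (mult f g)
  then obtain W U where "finite W" "\<forall>\<phi> \<psi>. (\<forall>v\<in>W. \<phi> v = \<psi> v) \<longrightarrow> f \<phi> = f \<psi>"
    "finite U" "\<forall>\<phi> \<psi>. (\<forall>v\<in>U. \<phi> v = \<psi> v) \<longrightarrow> g \<phi> = g \<psi>" by blast
  then show ?case by (intro exI[of _ "W \<union> U"]) (metis UnCI finite_UnI)
qed auto

lemma polyfun_vanish_grid:
  fixes f :: "('v \<Rightarrow> 'k::field) \<Rightarrow> 'k"
  assumes f: "f \<in> polyfun" and E: "infinite E"
    and z: "\<And>\<phi>. (\<And>v. \<phi> v \<in> E) \<Longrightarrow> f \<phi> = 0"
  shows "f \<phi> = 0"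
proof -
  \<comment> \<open>\<open>W\<close> collects the variables already released from \<open>E\<close>;
    releasing one more is a univariate question with infinitely many roots.\<close>
  have *: "\<forall>\<phi>. (\<forall>v. v \<notin> W \<longrightarrow> \<phi> v \<in> E) \<longrightarrow> f \<phi> = 0" if "finite W" for W
    using that
  proof induction
    case empty
    then show ?case using z by blast
  next
    case (insert w W)
    show ?case
    proof (intro allI impI)
      fix \<phi> assume \<phi>: "\<forall>v. v \<notin> insert w W \<longrightarrow> \<phi> v \<in> E"
      obtain p where p: "\<forall>s. poly p s = f (\<lambda>v. (\<phi>(w := 0)) v + s * ((\<phi>(w := 1)) v - (\<phi>(w := 0)) v))"
        using polyfun_line[OF f, of "\<phi>(w := 0)" "\<phi>(w := 1)"] by blast
      have line: "(\<lambda>v. (\<phi>(w := 0)) v + s * ((\<phi>(w := 1)) v - (\<phi>(w := 0)) v)) = \<phi>(w := s)" for s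
        by auto
      have "poly p s = 0" if "s \<in> E" for s
        unfolding p[rule_format] line using insert.IH \<phi> that by auto
      then have "p = 0" by (rule poly_eq_0_infinite[OF E])
      then have "f (\<phi>(w := \<phi> w)) = 0" using p[rule_format, of "\<phi> w"] line by simp
      then show "f \<phi> = 0" by simp
    qed
  qed
  obtain W where W: "finite W" "\<forall>\<phi> \<psi>. (\<forall>v\<in>W. \<phi> v = \<psi> v) \<longrightarrow> f \<phi> = f \<psi>"
    using polyfun_finite_support[OF f] by blast
  obtain e where e: "e \<in> E" using E by fastforce
  have "f \<phi> = f (\<lambda>v. if v \<in> W then \<phi> v else e)" using W(2) by simp
  also have "\<dots> = 0" using *[OF W(1)] e by simp
  finally show ?thesis .
qed

text \<open>The quotient is built by induction on \<open>f\<close>: sums add the quotients, and a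
  product is expanded as \<open>(f + b * f') * (g + b * g')\<close>.\<close>

lemma polyfun_difference:
  assumes "f \<in> polyfun" "a \<in> polyfun" "b \<in> polyfun"
  shows "\<exists>g \<in> polyfun. \<forall>\<phi>. f (\<phi>(w := a \<phi> + b \<phi>)) = f (\<phi>(w := a \<phi>)) + b \<phi> * g \<phi>"
  using assms(1)
proof induction
  case (const c)
  show ?case by (rule bexI[of _ "\<lambda>_. 0"]) (auto intro: polyfun_intros)
next
  case (gen f)
  then obtain v where "f = (\<lambda>\<phi>. \<phi> v)" by blast
  then show ?case
    by (intro bexI[of _ "\<lambda>_. if v = w then 1 else 0"]) (auto intro: polyfun_intros)
next
  case (add f g)
  then obtain f' g' where "f' \<in> polyfun" "g' \<in> polyfun"
    "\<forall>\<phi>. f (\<phi>(w := a \<phi> + b \<phi>)) = f (\<phi>(w := a \<phi>)) + b \<phi> * f' \<phi>"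
    "\<forall>\<phi>. g (\<phi>(w := a \<phi> + b \<phi>)) = g (\<phi>(w := a \<phi>)) + b \<phi> * g' \<phi>" by blast
  then show ?case
    by (intro bexI[of _ "\<lambda>\<phi>. f' \<phi> + g' \<phi>"])
      (auto intro: polyfun_intros simp: algebra_simps simp del: fun_upd_apply)
next
  case (mult f g)
  then obtain f' g' where *: "f' \<in> polyfun" "g' \<in> polyfun"
    "\<forall>\<phi>. f (\<phi>(w := a \<phi> + b \<phi>)) = f (\<phi>(w := a \<phi>)) + b \<phi> * f' \<phi>"
    "\<forall>\<phi>. g (\<phi>(w := a \<phi> + b \<phi>)) = g (\<phi>(w := a \<phi>)) + b \<phi> * g' \<phi>" by blast
  show ?case
  proof (intro bexI[of _ "\<lambda>\<phi>. f (\<phi>(w := a \<phi>)) * g' \<phi> + f' \<phi> * g (\<phi>(w := a \<phi>)) + b \<phi> * f' \<phi> * g' \<phi>"] allI)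
    show "f (\<phi>(w := a \<phi> + b \<phi>)) * g (\<phi>(w := a \<phi> + b \<phi>)) = f (\<phi>(w := a \<phi>)) * g (\<phi>(w := a \<phi>))
      + b \<phi> * (f (\<phi>(w := a \<phi>)) * g' \<phi> + f' \<phi> * g (\<phi>(w := a \<phi>)) + b \<phi> * f' \<phi> * g' \<phi>)" for \<phi>
      unfolding *(3,4)[rule_format] by (simp add: algebra_simps)
    show "(\<lambda>\<phi>. f (\<phi>(w := a \<phi>)) * g' \<phi> + f' \<phi> * g (\<phi>(w := a \<phi>)) + b \<phi> * f' \<phi> * g' \<phi>) \<in> polyfun"
      using * mult.hyps assms(2,3) by (intro polyfun_intros polyfun_update)
  qed
qed

lemma polyfun_dvd_coord:
  assumes "f \<in> polyfun" "\<And>\<phi>. f (\<phi>(w := 0)) = 0"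
  shows "\<exists>g \<in> polyfun. \<forall>\<phi>. f \<phi> = \<phi> w * g \<phi>"
  using polyfun_difference[OF assms(1) falg.const[of 0] polyfun_coord[of w], of w] assms(2)
  by simp

section \<open>Scaling groups of variables and homogeneous components\<close>

definition scale_on :: "'v set \<Rightarrow> 'k::field \<Rightarrow> ('v \<Rightarrow> 'k) \<Rightarrow> ('v \<Rightarrow> 'k)" where
  "scale_on G s \<phi> = (\<lambda>v. if v \<in> G then s * \<phi> v else \<phi> v)"

text \<open>The value \<open>s = 0\<close> is included, so degree 0 means independence of the
  variables in \<open>G\<close>.\<close>

definition homog_on :: "'v set \<Rightarrow> nat \<Rightarrow> (('v \<Rightarrow> 'k::field) \<Rightarrow> 'k) \<Rightarrow> bool" where
  "homog_on G e f \<longleftrightarrow> (\<forall>s \<phi>. f (scale_on G s \<phi>) = s ^ e * f \<phi>)"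

lemma scale_on_1 [simp]: "scale_on G 1 \<phi> = \<phi>"
  by (auto simp: scale_on_def)

lemma scale_on_scale_on: "scale_on G s (scale_on G t \<phi>) = scale_on G (s * t) \<phi>"
  by (auto simp: scale_on_def)

lemma scale_on_commute: "scale_on G s (scale_on H t \<phi>) = scale_on H t (scale_on G s \<phi>)"
  by (auto simp: scale_on_def)

text \<open>The degree bound \<open>N\<close> is common to all \<open>\<phi>\<close>, so that
  \<open>f\<close> becomes a finite sum of homogeneous components with a fixed range of
  summation.\<close>

lemma polyfun_scale_expansion:
  fixes f :: "('v \<Rightarrow> 'k::field) \<Rightarrow> 'k"
  assumes "f \<in> polyfun"
  shows "\<exists>P N. (\<forall>e. (\<lambda>\<phi>. coeff (P \<phi>) e) \<in> polyfun) \<and> (\<forall>\<phi>. degree (P \<phi>) \<le> N)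
    \<and> (\<forall>\<phi> s. poly (P \<phi>) s = f (scale_on G s \<phi>))"
  using assms
proof induction
  case (const c)
  show ?case by (rule exI[of _ "\<lambda>_. [:c:]"], rule exI[of _ 0]) (auto intro: polyfun_intros)
next
  case (gen f)
  then obtain v where f: "f = (\<lambda>\<phi>. \<phi> v)" by blast
  show ?case
  proof (cases "v \<in> G")
    case True
    have "coeff [:0, c:] e = (if e = 1 then c else 0)" for c :: 'k and e
      by (cases e; cases "e - 1") auto
    then have "(\<lambda>\<phi>::'v \<Rightarrow> 'k. coeff [:0, \<phi> v:] e) \<in> polyfun" for e
      by (cases "e = 1") (auto intro: polyfun_intros)
    with True show ?thesis unfolding f
      by (intro exI[of _ "\<lambda>\<phi>. [:0, \<phi> v:]"] exI[of _ 1]) (auto simp: scale_on_def)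
  next
    case False
    have "(\<lambda>\<phi>::'v \<Rightarrow> 'k. coeff [:\<phi> v:] e) \<in> polyfun" for e
      by (cases e) (auto intro: polyfun_intros)
    with False show ?thesis unfolding f
      by (intro exI[of _ "\<lambda>\<phi>. [:\<phi> v:]"] exI[of _ 0]) (auto simp: scale_on_def)
  qed
next
  case (add f g)
  then obtain P N Q M where *: "\<forall>e. (\<lambda>\<phi>. coeff (P \<phi>) e) \<in> polyfun" "\<forall>\<phi>. degree (P \<phi>) \<le> N"
    "\<forall>\<phi> s. poly (P \<phi>) s = f (scale_on G s \<phi>)"
    "\<forall>e. (\<lambda>\<phi>. coeff (Q \<phi>) e) \<in> polyfun" "\<forall>\<phi>. degree (Q \<phi>) \<le> M"
    "\<forall>\<phi> s. poly (Q \<phi>) s = g (scale_on G s \<phi>)" by blast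
  have "degree (P \<phi> + Q \<phi>) \<le> N + M" for \<phi>
    using *(2,5) by (intro degree_add_le) (auto intro: trans_le_add1 trans_le_add2)
  with * show ?case
    by (intro exI[of _ "\<lambda>\<phi>. P \<phi> + Q \<phi>"] exI[of _ "N + M"]) (auto intro: polyfun_intros)
next
  case (mult f g)
  then obtain P N Q M where *: "\<forall>e. (\<lambda>\<phi>. coeff (P \<phi>) e) \<in> polyfun" "\<forall>\<phi>. degree (P \<phi>) \<le> N"
    "\<forall>\<phi> s. poly (P \<phi>) s = f (scale_on G s \<phi>)"
    "\<forall>e. (\<lambda>\<phi>. coeff (Q \<phi>) e) \<in> polyfun" "\<forall>\<phi>. degree (Q \<phi>) \<le> M"
    "\<forall>\<phi> s. poly (Q \<phi>) s = g (scale_on G s \<phi>)" by blast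
  have "degree (P \<phi> * Q \<phi>) \<le> N + M" for \<phi>
    using *(2,5) degree_mult_le[of "P \<phi>" "Q \<phi>"] by (meson add_mono order_trans)
  moreover have "(\<lambda>\<phi>. coeff (P \<phi> * Q \<phi>) e) \<in> polyfun" for e
    unfolding coeff_mult using * by (intro falg_sum polyfun_intros) auto
  ultimately show ?case using *
    by (intro exI[of _ "\<lambda>\<phi>. P \<phi> * Q \<phi>"] exI[of _ "N + M"]) auto
qed

text \<open>The components are the coefficients of \<open>s\<close> in \<open>f (scale_on G s \<phi>)\<close>; they inherit every
  linear identity of \<open>f\<close> that is compatible with scaling, by comparing coefficients.\<close>

lemma polyfun_homog_decomposition:
  fixes f :: "('v \<Rightarrow> 'k::field) \<Rightarrow> 'k"
  assumes inf: "infinite (UNIV :: 'k set)" and f: "f \<in> polyfun"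
  shows "\<exists>c N. (\<forall>e. c e \<in> polyfun) \<and> (\<forall>\<phi>. f \<phi> = (\<Sum>e\<le>N. c e \<phi>)) \<and> (\<forall>e. homog_on G e (c e)) \<and>
    (\<forall>T r. (\<forall>\<phi> s. T (scale_on G s \<phi>) = scale_on G s (T \<phi>)) \<longrightarrow> (\<forall>\<phi>. f (T \<phi>) = r * f \<phi>) \<longrightarrow>
      (\<forall>e \<phi>. c e (T \<phi>) = r * c e \<phi>))"
proof -
  obtain P N where P: "\<forall>e. (\<lambda>\<phi>. coeff (P \<phi>) e) \<in> polyfun" "\<forall>\<phi>. degree (P \<phi>) \<le> N"
    "\<forall>\<phi> s. poly (P \<phi>) s = f (scale_on G s \<phi>)"
    using polyfun_scale_expansion[OF f] by blast
  show ?thesis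
  proof (intro exI[of _ "\<lambda>e \<phi>. coeff (P \<phi>) e"] exI[of _ N] conjI allI impI)
    fix \<phi>
    have "f \<phi> = poly (P \<phi>) 1" using P(3) by simp
    also have "\<dots> = (\<Sum>e\<le>N. coeff (P \<phi>) e)"
      unfolding poly_altdef using P(2)
      by (auto intro!: sum.mono_neutral_left intro: le_degree)
    finally show "f \<phi> = (\<Sum>e\<le>N. coeff (P \<phi>) e)" .
  next
    fix e
    show "homog_on G e (\<lambda>\<phi>. coeff (P \<phi>) e)"
      unfolding homog_on_def
    proof (intro allI)
      fix s \<phi>
      \<comment> \<open>Scaling first by \<open>s\<close> and then by \<open>t\<close> is scaling by
        \<open>s * t\<close>, so the two polynomials in \<open>t\<close> agree everywhere.\<close>
      have "P (scale_on G s \<phi>) = pcompose (P \<phi>) [:0, s:]"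
        by (rule poly_eq_infinite[OF inf]) (simp add: P(3) poly_pcompose scale_on_scale_on mult.commute)
      then show "coeff (P (scale_on G s \<phi>)) e = s ^ e * coeff (P \<phi>) e"
        by (simp add: coeff_pcompose_linear)
    qed
  next
    fix T r e \<phi>
    assume T: "\<forall>\<phi> s. T (scale_on G s \<phi>) = scale_on G s (T \<phi>)" "\<forall>\<phi>. f (T \<phi>) = r * f \<phi>"
    have "P (T \<phi>) = smult r (P \<phi>)"
      by (rule poly_eq_infinite[OF inf]) (metis P(3) T poly_smult)
    then show "coeff (P (T \<phi>)) e = r * coeff (P \<phi>) e" by simp
  qed (use P in auto)
qed

section \<open>Invariants of vectors in the plane\<close>

text \<open>The index \<open>(l, False)\<close> is the first and \<open>(l, True)\<close> the second
  coordinate of the vector \<open>l\<close>; the bracket is the determinant of two vectors.\<close>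

definition bracket :: "'l \<Rightarrow> 'l \<Rightarrow> ('l \<times> bool \<Rightarrow> 'k::field) \<Rightarrow> 'k" where
  "bracket p q \<phi> = \<phi> (p, False) * \<phi> (q, True) - \<phi> (p, True) * \<phi> (q, False)"

text \<open>The matrix with rows \<open>(\<alpha>, \<beta>)\<close> and
  \<open>(\<gamma>, - \<alpha>)\<close> is applied to every vector at once; its determinant is
  \<open>- (\<alpha> * \<alpha>) - \<beta> * \<gamma>\<close>.\<close>

definition act2 :: "'k \<Rightarrow> 'k \<Rightarrow> 'k \<Rightarrow> ('l \<times> bool \<Rightarrow> 'k::field) \<Rightarrow> ('l \<times> bool \<Rightarrow> 'k)" where
  "act2 \<alpha> \<beta> \<gamma> \<phi> = (\<lambda>(l, b). if b then \<gamma> * \<phi> (l, False) - \<alpha> * \<phi> (l, True)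
     else \<alpha> * \<phi> (l, False) + \<beta> * \<phi> (l, True))"

text \<open>Only the traceless matrices in \<open>SL(2)\<close>, which act on binary quadratic forms as half turns.\<close>

definition half_turn_invariant :: "(('l \<times> bool \<Rightarrow> 'k::field) \<Rightarrow> 'k) \<Rightarrow> bool" where
  "half_turn_invariant h \<longleftrightarrow> (\<forall>\<alpha> \<beta> \<gamma> \<phi>. - (\<alpha> * \<alpha>) - \<beta> * \<gamma> = 1 \<longrightarrow> h (act2 \<alpha> \<beta> \<gamma> \<phi>) = h \<phi>)"

text \<open>The multiset lists the letters with repetition, so its \<open>count\<close> is the
  multidegree of the product; \<open>p \<noteq> q\<close> excludes the vanishing brackets.\<close>

inductive bracket_monomial :: "(('l \<times> bool \<Rightarrow> 'k::field) \<Rightarrow> 'k) \<Rightarrow> 'l multiset \<Rightarrow> bool" where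
  one: "bracket_monomial (\<lambda>_. 1) {#}"
| mult: "bracket_monomial B L \<Longrightarrow> p \<noteq> q \<Longrightarrow> bracket_monomial (\<lambda>\<phi>. bracket p q \<phi> * B \<phi>) (L + {#p, q#})"

inductive_set bracket_span :: "'l multiset \<Rightarrow> (('l \<times> bool \<Rightarrow> 'k::field) \<Rightarrow> 'k) set" for L where
  zero: "(\<lambda>_. 0) \<in> bracket_span L"
| step: "h \<in> bracket_span L \<Longrightarrow> bracket_monomial B L \<Longrightarrow> (\<lambda>\<phi>. c * B \<phi> + h \<phi>) \<in> bracket_span L"

abbreviation vec_homog :: "'l \<Rightarrow> nat \<Rightarrow> (('l \<times> bool \<Rightarrow> 'k::field) \<Rightarrow> 'k) \<Rightarrow> bool" where
  "vec_homog l \<equiv> homog_on ({l} \<times> UNIV)"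

definition merge_vec :: "'l \<Rightarrow> 'l \<Rightarrow> ('l \<times> bool \<Rightarrow> 'k) \<Rightarrow> ('l \<times> bool \<Rightarrow> 'k)" where
  "merge_vec i j \<phi> = (\<lambda>(l, b). if l = j then \<phi> (i, b) else \<phi> (l, b))"

lemma bracket_polyfun: "bracket p q \<in> polyfun"
  unfolding bracket_def[abs_def] by (intro polyfun_intros)

lemma bracket_act2:
  "- (\<alpha> * \<alpha>) - \<beta> * \<gamma> = 1 \<Longrightarrow> bracket p q (act2 \<alpha> \<beta> \<gamma> \<phi>) = bracket p q \<phi>"
proof -
  assume "- (\<alpha> * \<alpha>) - \<beta> * \<gamma> = 1"
  moreover have "bracket p q (act2 \<alpha> \<beta> \<gamma> \<phi>) = (- (\<alpha> * \<alpha>) - \<beta> * \<gamma>) * bracket p q \<phi>"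
    by (simp add: bracket_def act2_def algebra_simps)
  ultimately show ?thesis by simp
qed

lemma bracket_scale:
  "p \<noteq> q \<Longrightarrow> bracket p q (scale_on ({l} \<times> UNIV) s \<phi>) = s ^ count {#p, q#} l * bracket p q \<phi>"
  by (auto simp: bracket_def scale_on_def algebra_simps)

lemma bracket_monomial_properties:
  assumes "bracket_monomial B L"
  shows "B \<in> polyfun \<and> half_turn_invariant B \<and> (\<forall>l. vec_homog l (count L l) B)"
  using assms
proof induction
  case one
  then show ?case by (auto simp: half_turn_invariant_def homog_on_def intro: polyfun_intros)
next
  case (mult B L p q)
  have "vec_homog l (count (L + {#p, q#}) l) (\<lambda>\<phi>. bracket p q \<phi> * B \<phi>)" for l
    unfolding homog_on_def bracket_scale[OF mult(2)] count_union power_add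
    using mult by (simp add: homog_on_def)
  then show ?case
    using mult by (auto simp: half_turn_invariant_def bracket_act2 intro: falg.mult bracket_polyfun)
qed

lemma bracket_span_properties:
  assumes "h \<in> bracket_span L"
  shows "h \<in> polyfun \<and> half_turn_invariant h \<and> (\<forall>l. vec_homog l (count L l) h)"
  using assms
proof induction
  case zero
  then show ?case by (auto simp: half_turn_invariant_def homog_on_def intro: polyfun_intros)
next
  case (step h B c)
  note B = bracket_monomial_properties[OF step.hyps(2)]
  have "(\<lambda>\<phi>. c * B \<phi> + h \<phi>) \<in> polyfun"
    using step.IH B by (intro polyfun_intros) auto
  then show ?case
    using step.IH B by (auto simp: half_turn_invariant_def homog_on_def algebra_simps)
qed

lemma bracket_span_add:
  assumes "h \<in> bracket_span L" "h' \<in> bracket_span L"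
  shows "(\<lambda>\<phi>. h \<phi> + h' \<phi>) \<in> bracket_span L"
  using assms by induction (auto simp: add.assoc intro: bracket_span.intros)

lemma bracket_span_mult_bracket:
  assumes "h \<in> bracket_span L" "p \<noteq> q"
  shows "(\<lambda>\<phi>. bracket p q \<phi> * h \<phi>) \<in> bracket_span (L + {#p, q#})"
  using assms(1)
proof induction
  case zero
  then show ?case using bracket_span.zero by simp
next
  case (step h B c)
  from bracket_span.step[OF step.IH bracket_monomial.mult[OF step.hyps(2) assms(2)], of c]
  show ?case by (simp add: algebra_simps)
qed

text \<open>Polarization would produce binomial coefficients here, which may vanish in \<open>'k\<close>; replacing
  single occurrences of the letter \<open>i\<close> avoids them.\<close>

lemma bracket_monomial_split:
  assumes "bracket_monomial B L" "j \<notin># L" "k \<le> count L i" "i \<noteq> j"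
  shows "\<exists>B'. bracket_monomial B' (L - replicate_mset k i + replicate_mset k j) \<and>
    (\<forall>\<phi>. B' (merge_vec i j \<phi>) = B \<phi>)"
  using assms(1-3)
proof (induction arbitrary: k)
  case one
  then show ?case by (auto intro!: exI[of _ "\<lambda>_. 1"] bracket_monomial.one)
next
  case (mult B L p q)
  have j: "j \<notin># L" "p \<noteq> j" "q \<noteq> j" using mult.prems by auto
  have br: "bracket p q (merge_vec i j \<phi>) = bracket p q \<phi>" for \<phi> :: "'a \<times> bool \<Rightarrow> 'b"
    using j by (simp add: merge_vec_def bracket_def)
  show ?case
  proof (cases "k \<le> count L i")
    case True
    then obtain B' where B': "bracket_monomial B' (L - replicate_mset k i + replicate_mset k j)"
      "\<forall>\<phi>. B' (merge_vec i j \<phi>) = B \<phi>" using mult.IH[OF j(1)] by blast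
    have eq: "L + {#p, q#} - replicate_mset k i + replicate_mset k j
      = L - replicate_mset k i + replicate_mset k j + {#p, q#}"
      using True by (intro multiset_eqI) auto
    show ?thesis
      unfolding eq using bracket_monomial.mult[OF B'(1) mult.hyps(2)] B'(2) br
      by (intro exI[of _ "\<lambda>\<phi>. bracket p q \<phi> * B' \<phi>"] conjI allI) simp_all
  next
    case False
    \<comment> \<open>All \<open>r\<close> occurrences of \<open>i\<close> outside the new bracket
      are used up, so \<open>k = Suc r\<close>, and the bracket contains \<open>i\<close> exactly
      once; that occurrence is replaced as well.\<close>
    define r where "r = count L i"
    have k: "k = Suc r" and pq: "p = i \<or> q = i"
      using False mult.prems(2) mult.hyps(2) by (auto simp: r_def split: if_splits)
    obtain B' where B': "bracket_monomial B' (L - replicate_mset r i + replicate_mset r j)"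
      "\<forall>\<phi>. B' (merge_vec i j \<phi>) = B \<phi>" using mult.IH[OF j(1), of r] by (auto simp: r_def)
    define p' q' where "p' = (if p = i then j else p)" and "q' = (if q = i then j else q)"
    have pq': "p' \<noteq> q'" using pq j mult.hyps(2) by (auto simp: p'_def q'_def)
    have eq: "L + {#p, q#} - replicate_mset k i + replicate_mset k j
      = L - replicate_mset r i + replicate_mset r j + {#p', q'#}"
      using pq mult.hyps(2) j assms(4) k by (intro multiset_eqI) (auto simp: p'_def q'_def r_def)
    have br': "bracket p' q' (merge_vec i j \<phi>) = bracket p q \<phi>" for \<phi> :: "'a \<times> bool \<Rightarrow> 'b"
      using j assms(4) by (simp add: merge_vec_def bracket_def p'_def q'_def)
    show ?thesis
      unfolding eq using bracket_monomial.mult[OF B'(1) pq'] B'(2) br'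
      by (intro exI[of _ "\<lambda>\<phi>. bracket p' q' \<phi> * B' \<phi>"] conjI allI) simp_all
  qed
qed

lemma bracket_span_split:
  assumes "h \<in> bracket_span L" "j \<notin># L" "k \<le> count L i" "i \<noteq> j"
  shows "\<exists>h' \<in> bracket_span (L - replicate_mset k i + replicate_mset k j).
    \<forall>\<phi>. h' (merge_vec i j \<phi>) = h \<phi>"
  using assms(1)
proof induction
  case zero
  then show ?case by (intro bexI[OF _ bracket_span.zero]) simp
next
  case (step h B c)
  then obtain h' where h': "h' \<in> bracket_span (L - replicate_mset k i + replicate_mset k j)"
    "\<forall>\<phi>. h' (merge_vec i j \<phi>) = h \<phi>" by blast
  obtain B' where B': "bracket_monomial B' (L - replicate_mset k i + replicate_mset k j)"
      "\<forall>\<phi>. B' (merge_vec i j \<phi>) = B \<phi>"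
    using bracket_monomial_split[OF step.hyps(2) assms(2-4)] by blast
  show ?case
    using bracket_span.step[OF h'(1) B'(1), of c] h'(2) B'(2)
    by (intro bexI[of _ "\<lambda>\<phi>. c * B' \<phi> + h' \<phi>"]) auto
qed

text \<open>Nonzero \<open>s\<close> suffice because both sides are polynomials in \<open>s\<close>;
  this permits dividing by powers of \<open>s\<close>.\<close>

lemma polyfun_homog_onI:
  fixes f :: "('v \<Rightarrow> 'k::field) \<Rightarrow> 'k"
  assumes inf: "infinite (UNIV :: 'k set)" and f: "f \<in> polyfun"
    and s: "\<And>s \<phi>. s \<noteq> 0 \<Longrightarrow> f (scale_on G s \<phi>) = s ^ e * f \<phi>"
  shows "homog_on G e f"
proof -
  obtain P where P: "\<forall>\<phi> s. poly (P \<phi>) s = f (scale_on G s \<phi>)"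
    using polyfun_scale_expansion[OF f] by blast
  have "P \<phi> = monom (f \<phi>) e" for \<phi>
  proof (rule poly_eq_infinite)
    show "infinite (UNIV - {0 :: 'k})" using inf by simp
  qed (simp add: P s poly_monom)
  then show ?thesis
    unfolding homog_on_def P[rule_format, symmetric] by (simp add: poly_monom)
qed

text \<open>Write \<open>v_i = (x_i, y_i)\<close>. Then
  \<open>x_i * v_j = x_j * v_i + (0, [i, j])\<close>, so up to a multiple of the bracket
  \<open>x_i ^ e * f\<close> is the value of \<open>f\<close> with \<open>x_j * v_i\<close> in place
  of \<open>v_j\<close>, which is 0 by homogeneity and \<open>z\<close>. The factor
  \<open>x_i ^ e\<close> then cancels because the bracket is not divisible by
  \<open>x_i\<close>.\<close>

lemma bracket_dvd:
  fixes f :: "('l \<times> bool \<Rightarrow> 'k::field) \<Rightarrow> 'k"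
  assumes inf: "infinite (UNIV :: 'k set)" and f: "f \<in> polyfun" and ij: "i \<noteq> j"
    and hom: "vec_homog j e f" and z: "\<And>\<phi>. f (merge_vec i j \<phi>) = 0"
  shows "\<exists>g \<in> polyfun. \<forall>\<phi>. f \<phi> = bracket i j \<phi> * g \<phi>"
proof -
  \<comment> \<open>The first coordinate of \<open>x_i * v_j\<close> is inserted in advance, so that
    only the second one remains to be compared.\<close>
  define f' where "f' = (\<lambda>\<phi>. f (\<phi>((j, False) := \<phi> (i, False) * \<phi> (j, False))))"
  have f': "f' \<in> polyfun"
    unfolding f'_def by (intro polyfun_update f polyfun_intros)
  have a: "(\<lambda>\<phi>. \<phi> (i, True) * \<phi> (j, False)) \<in> polyfun" by (intro polyfun_intros)
  obtain G where G: "G \<in> polyfun"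
    "\<forall>\<phi>. f' (\<phi>((j, True) := \<phi> (i, True) * \<phi> (j, False) + bracket i j \<phi>))
       = f' (\<phi>((j, True) := \<phi> (i, True) * \<phi> (j, False))) + bracket i j \<phi> * G \<phi>"
    using polyfun_difference[OF f' a bracket_polyfun[of i j], of "(j, True)"] by blast
  have "\<phi> (i, False) ^ e * f \<phi> = bracket i j \<phi> * G \<phi>" for \<phi>
  proof -
    have "\<phi> (i, False) ^ e * f \<phi> = f (scale_on ({j} \<times> UNIV) (\<phi> (i, False)) \<phi>)"
      using hom by (simp add: homog_on_def)
    also have "scale_on ({j} \<times> UNIV) (\<phi> (i, False)) \<phi>
      = (\<phi>((j, True) := \<phi> (i, True) * \<phi> (j, False) + bracket i j \<phi>))
          ((j, False) := \<phi> (i, False) * \<phi> (j, False))"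
      (is "?l = ?r")
    proof (rule ext)
      fix v show "?l v = ?r v"
        by (cases v; cases "snd v"; cases "fst v = j") (auto simp: scale_on_def bracket_def)
    qed
    also have "f \<dots> = f' (\<phi>((j, True) := \<phi> (i, True) * \<phi> (j, False) + bracket i j \<phi>))"
      using ij by (simp add: f'_def)
    also have "\<dots> = f' (\<phi>((j, True) := \<phi> (i, True) * \<phi> (j, False))) + bracket i j \<phi> * G \<phi>"
      using G(2) by blast
    also have "f' (\<phi>((j, True) := \<phi> (i, True) * \<phi> (j, False)))
      = f (scale_on ({j} \<times> UNIV) (\<phi> (j, False)) (merge_vec i j \<phi>))"
      unfolding f'_def using ij
      by (intro arg_cong[of _ _ f]) (auto simp: scale_on_def merge_vec_def fun_eq_iff)
    also have "\<dots> = 0" using hom z by (simp add: homog_on_def)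
    finally show ?thesis by simp
  qed
  then have "\<exists>G \<in> polyfun. \<forall>\<phi>. \<phi> (i, False) ^ e * f \<phi> = bracket i j \<phi> * G \<phi>" using G(1) by blast
  then show ?thesis
  proof (induction e)
    case 0
    then show ?case by simp
  next
    case (Suc e)
    then obtain G where G: "G \<in> polyfun"
      "\<forall>\<phi>. \<phi> (i, False) ^ Suc e * f \<phi> = bracket i j \<phi> * G \<phi>" by blast
    \<comment> \<open>On \<open>x_i = 0\<close> the product of the bracket and \<open>G\<close>
      vanishes, and the bracket itself does not vanish identically there.\<close>
    have G0: "G (\<phi>((i, False) := 0)) = 0" for \<phi>
    proof (rule polyfun_no_zero_divisors[OF inf,
          where f = "\<lambda>\<phi>. bracket i j (\<phi>((i, False) := 0))" and g = "\<lambda>\<phi>. G (\<phi>((i, False) := 0))"])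
      show "(\<lambda>\<phi>. bracket i j (\<phi>((i, False) := 0))) \<in> polyfun"
        by (rule polyfun_update[OF bracket_polyfun falg.const])
      show "(\<lambda>\<phi>. G (\<phi>((i, False) := 0))) \<in> polyfun"
        by (rule polyfun_update[OF G(1) falg.const])
      show "bracket i j (\<phi>((i, False) := 0)) * G (\<phi>((i, False) := 0)) = 0" for \<phi>
        using G(2)[rule_format, of "\<phi>((i, False) := 0)"] by simp
      show "bracket i j ((\<lambda>_. 1)((i, False) := 0)) \<noteq> (0::'k)"
        using ij by (simp add: bracket_def)
    qed
    obtain H where H: "H \<in> polyfun" "\<forall>\<phi>. G \<phi> = \<phi> (i, False) * H \<phi>"
      using polyfun_dvd_coord[OF G(1) G0] by blast
    have "\<phi> (i, False) ^ e * f \<phi> = bracket i j \<phi> * H \<phi>" for \<phi>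
    proof (rule polyfun_cancel[OF inf, where f = "\<lambda>\<phi>. \<phi> (i, False)"
          and g = "\<lambda>\<phi>. \<phi> (i, False) ^ e * f \<phi>" and h = "\<lambda>\<phi>. bracket i j \<phi> * H \<phi>"])
      show "(\<lambda>\<phi>. \<phi> (i, False)) \<in> polyfun" "(\<lambda>\<phi>. \<phi> (i, False) ^ e * f \<phi>) \<in> polyfun"
        "(\<lambda>\<phi>. bracket i j \<phi> * H \<phi>) \<in> polyfun"
        by (intro polyfun_intros bracket_polyfun f H(1))+
      show "\<phi> (i, False) * (\<phi> (i, False) ^ e * f \<phi>) = \<phi> (i, False) * (bracket i j \<phi> * H \<phi>)" for \<phi>
        using G(2)[rule_format, of \<phi>] H(2)[rule_format, of \<phi>] by (simp add: algebra_simps)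
      show "(\<lambda>_. 1) (i, False) \<noteq> (0::'k)" by simp
    qed
    then show ?case using Suc.IH H(1) by blast
  qed
qed

text \<open>A vector of degree 0 can be scaled to 0 without changing the value, and only finitely
  many vectors matter.\<close>

lemma polyfun_forget_vectors:
  fixes h :: "('l \<times> bool \<Rightarrow> 'k::field) \<Rightarrow> 'k"
  assumes h: "h \<in> polyfun" and hom: "\<And>l. l \<notin> S \<Longrightarrow> vec_homog l 0 h"
  shows "h \<phi> = h (\<lambda>(l, b). if l \<in> S then \<phi> (l, b) else 0)"
proof -
  obtain W where W: "finite W" "\<forall>\<phi> \<psi>. (\<forall>v\<in>W. \<phi> v = \<psi> v) \<longrightarrow> h \<phi> = h \<psi>"
    using polyfun_finite_support[OF h] by blast
  have "h (\<lambda>(l, b). if l \<in> J then 0 else \<phi> (l, b)) = h \<phi>" if "finite J" "J \<inter> S = {}" for J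
    using that
  proof induction
    case empty
    then show ?case by simp
  next
    case (insert l J)
    have "(\<lambda>(l', b). if l' \<in> insert l J then 0 else \<phi> (l', b))
      = scale_on ({l} \<times> UNIV) 0 (\<lambda>(l, b). if l \<in> J then 0 else \<phi> (l, b))"
      by (auto simp: scale_on_def fun_eq_iff)
    then show ?case
      using insert hom[of l] by (simp add: homog_on_def)
  qed
  from this[of "fst ` W - S"] W(1)
  have "h \<phi> = h (\<lambda>(l, b). if l \<in> fst ` W - S then 0 else \<phi> (l, b))" by (simp add: Int_commute)
  also have "\<dots> = h (\<lambda>(l, b). if l \<in> S then \<phi> (l, b) else 0)"
    by (rule W(2)[rule_format]) (force simp: image_iff)
  finally show ?thesis .
qed

text \<open>Any two linearly independent vectors are exchanged, up to sign, by a traceless matrix of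
  determinant 1, so an invariant of one vector is constant away from the origin.\<close>

lemma half_turn_invariant_single:
  fixes h :: "('l \<times> bool \<Rightarrow> 'k::field) \<Rightarrow> 'k"
  assumes inf: "infinite (UNIV :: 'k set)" and h: "h \<in> polyfun" and inv: "half_turn_invariant h"
    and hom0: "\<And>l. l \<noteq> i \<Longrightarrow> vec_homog l 0 h" and hom: "vec_homog i e h" and e: "e > 0"
  shows "h \<phi> = 0"
proof -
  define pt :: "'k \<Rightarrow> 'k \<Rightarrow> 'l \<times> bool \<Rightarrow> 'k"
    where "pt x y = (\<lambda>(l, b). if l = i then (if b then y else x) else 0)" for x y
  have scale: "h (pt (t * x) (t * y)) = t ^ e * h (pt x y)" for t x y
  proof -
    have "pt (t * x) (t * y) = scale_on ({i} \<times> UNIV) t (pt x y)"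
      by (auto simp: pt_def scale_on_def fun_eq_iff)
    then show ?thesis using hom by (simp add: homog_on_def)
  qed
  have move: "h (pt x y) = h (pt x' y')" if D: "x * y' - y * x' \<noteq> 0" for x y x' y'
  proof -
    define D where "D = x * y' - y * x'"
    \<comment> \<open>The linear map with \<open>(x, y) \<mapsto> (x', y')\<close> and
      \<open>(x', y') \<mapsto> - (x, y)\<close>; in this basis its trace is visibly 0 and its
      determinant 1.\<close>
    define \<alpha> \<beta> \<gamma> where "\<alpha> = (x' * y' + x * y) / D" and "\<beta> = - (x * x + x' * x') / D"
      and "\<gamma> = (y * y + y' * y') / D"
    have D0: "D \<noteq> 0" using D by (simp add: D_def)
    have "- (\<alpha> * \<alpha>) - \<beta> * \<gamma> = 1"
    proof -
      have "- (\<alpha> * \<alpha>) - \<beta> * \<gamma> = ((x * x + x' * x') * (y * y + y' * y') - (x' * y' + x * y) * (x' * y' + x * y)) / (D * D)"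
        unfolding \<alpha>_def \<beta>_def \<gamma>_def using D0 by (simp add: field_simps)
      also have "(x * x + x' * x') * (y * y + y' * y') - (x' * y' + x * y) * (x' * y' + x * y) = D * D"
        unfolding D_def by (simp add: algebra_simps)
      finally show ?thesis using D0 by simp
    qed
    moreover have "act2 \<alpha> \<beta> \<gamma> (pt x y) = pt x' y'"
    proof -
      have "\<alpha> * x + \<beta> * y = ((x' * y' + x * y) * x - (x * x + x' * x') * y) / D"
        unfolding \<alpha>_def \<beta>_def using D0 by (simp add: field_simps)
      also have "(x' * y' + x * y) * x - (x * x + x' * x') * y = x' * D"
        unfolding D_def by (simp add: algebra_simps)
      finally have 1: "\<alpha> * x + \<beta> * y = x'" using D0 by simp
      have "\<gamma> * x - \<alpha> * y = ((y * y + y' * y') * x - (x' * y' + x * y) * y) / D"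
        unfolding \<alpha>_def \<gamma>_def using D0 by (simp add: field_simps)
      also have "(y * y + y' * y') * x - (x' * y' + x * y) * y = y' * D"
        unfolding D_def by (simp add: algebra_simps)
      finally have 2: "\<gamma> * x - \<alpha> * y = y'" using D0 by simp
      show ?thesis using 1 2 by (auto simp: act2_def pt_def fun_eq_iff)
    qed
    ultimately show ?thesis using inv by (metis half_turn_invariant_def)
  qed
  obtain t :: 'k where t: "t \<noteq> 0" "t ^ e \<noteq> 1"
  proof -
    have "\<exists>t::'k. t * (t ^ e - 1) \<noteq> 0"
    proof (rule ccontr)
      assume "\<nexists>t::'k. t * (t ^ e - 1) \<noteq> 0"
      then have "monom 1 (Suc e) - monom (1::'k) 1 = 0"
        by (intro poly_eq_0_infinite[OF inf]) (simp add: poly_monom right_diff_distrib)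
      then have "coeff (monom 1 (Suc e) - monom (1::'k) 1) (Suc e) = 0" by simp
      then show False using e by (simp add: coeff_monom)
    qed
    then show ?thesis using that by auto
  qed
  have 0: "h (pt x y) = 0" for x y
  proof (cases "x = 0 \<and> y = 0")
    case True
    then show ?thesis using scale[of 0 x y] e by (simp add: zero_power)
  next
    case False
    then obtain x' y' where xy: "x * y' - y * x' \<noteq> 0"
      by (metis diff_0 diff_zero mult.right_neutral mult_zero_right neg_equal_0_iff_equal)
    have "t * x * y' - t * y * x' \<noteq> 0"
    proof -
      have "t * x * y' - t * y * x' = t * (x * y' - y * x')" by (simp add: algebra_simps)
      then show ?thesis using xy t(1) by simp
    qed
    \<comment> \<open>Both points move to the same \<open>(x', y')\<close>. Since homogeneity
      multiplies the value by \<open>t ^ e \<noteq> 1\<close>, it must be 0.\<close>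
    then have "h (pt (t * x) (t * y)) = h (pt x y)" using move xy by metis
    then show ?thesis using scale[of t x y] t(2) by simp
  qed
  have "h \<phi> = h (\<lambda>(l, b). if l \<in> {i} then \<phi> (l, b) else 0)"
    using polyfun_forget_vectors[OF h, of "{i}"] hom0 by auto
  also have "(\<lambda>(l, b). if l \<in> {i} then \<phi> (l, b) else 0) = pt (\<phi> (i, False)) (\<phi> (i, True))"
    by (auto simp: pt_def fun_eq_iff)
  finally show ?thesis using 0 by simp
qed

text \<open>The induction measure is the number of distinct vectors plus the total degree. Merging
  two vectors lowers the first summand and keeps the second; dividing by a bracket lowers the second
  and does not raise the first.\<close>

theorem first_fundamental_theorem_SL2:
  fixes h :: "('l \<times> bool \<Rightarrow> 'k::field) \<Rightarrow> 'k"
  assumes inf: "infinite (UNIV :: 'k set)"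
    and "h \<in> polyfun" "half_turn_invariant h" "\<And>l. vec_homog l (count \<delta> l) h"
  shows "h \<in> bracket_span \<delta>"
  using assms(2-4)
proof (induction "card (set_mset \<delta>) + size \<delta>" arbitrary: h \<delta> rule: less_induct)
  case less
  note h = less.prems(1) and inv = less.prems(2) and hom = less.prems(3)
  consider "\<delta> = {#}" | i where "set_mset \<delta> = {i}" | i j where "i \<in># \<delta>" "j \<in># \<delta>" "i \<noteq> j"
    by (metis (no_types, opaque_lifting) is_singletonI' is_singleton_def set_mset_eq_empty_iff)
  then show ?case
  proof cases
    case 1
    have "h \<phi> = h (\<lambda>_. 0)" for \<phi>
      using polyfun_forget_vectors[OF h, of "{}" \<phi>] hom 1 by (simp add: case_prod_unfold)
    then have eq: "h = (\<lambda>\<phi>. h (\<lambda>_. 0) * 1 + 0)" by auto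
    show ?thesis
      unfolding 1 by (subst eq) (rule bracket_span.step[OF bracket_span.zero bracket_monomial.one])
  next
    case 2
    have "h \<phi> = 0" for \<phi>
    proof (rule half_turn_invariant_single[OF inf h inv])
      show "vec_homog l 0 h" if "l \<noteq> i" for l
        using hom[of l] 2 that by (metis count_eq_zero_iff singletonD)
      show "vec_homog i (count \<delta> i) h" using hom .
      show "count \<delta> i > 0" using 2 by auto
    qed
    then have "h = (\<lambda>_. 0)" by auto
    then show ?thesis using bracket_span.zero by metis
  next
    case 3
    note ij = 3
    define m where "m = count \<delta> j"
    \<comment> \<open>The multidegree after setting \<open>v_j\<close> equal to
      \<open>v_i\<close>.\<close>
    define \<delta>' where "\<delta>' = \<delta> - replicate_mset m j + replicate_mset m i"
    have m: "m > 0" using ij by (auto simp: m_def)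
    have cnt: "count \<delta>' l = (if l = i then count \<delta> i + m else if l = j then 0 else count \<delta> l)" for l
      using ij by (auto simp: \<delta>'_def m_def)
    have set': "set_mset \<delta>' = set_mset \<delta> - {j}"
    proof (rule Set.set_eqI)
      fix l
      show "l \<in># \<delta>' \<longleftrightarrow> l \<in> set_mset \<delta> - {j}"
        using ij m unfolding count_greater_zero_iff[symmetric] cnt by auto
    qed
    have size': "size \<delta>' = size \<delta>"
    proof -
      have sub: "replicate_mset m j \<subseteq># \<delta>" by (simp add: m_def count_le_replicate_mset_subset_eq[symmetric])
      show ?thesis
        unfolding \<delta>'_def size_union size_Diff_submset[OF sub] using size_mset_mono[OF sub] by simp
    qed
    have less': "card (set_mset \<delta>') + size \<delta>' < card (set_mset \<delta>) + size \<delta>"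
    proof -
      have "card (set_mset \<delta>') < card (set_mset \<delta>)"
        unfolding set' using ij by (intro psubset_card_mono) auto
      then show ?thesis using size' by simp
    qed
    have "(\<lambda>\<phi>. h (merge_vec i j \<phi>)) \<in> bracket_span \<delta>'"
    proof (rule less.hyps[OF less'])
      show "(\<lambda>\<phi>. h (merge_vec i j \<phi>)) \<in> polyfun"
      proof (rule polyfun_subst[OF h])
        show "(\<lambda>\<phi>. merge_vec i j \<phi> v) \<in> polyfun" for v
          by (cases v; cases "fst v = j") (auto simp: merge_vec_def)
      qed
      have "merge_vec i j (act2 \<alpha> \<beta> \<gamma> \<phi>) = act2 \<alpha> \<beta> \<gamma> (merge_vec i j \<phi>)" for \<alpha> \<beta> \<gamma> and \<phi> :: "'l \<times> bool \<Rightarrow> 'k"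
        by (auto simp: merge_vec_def act2_def fun_eq_iff)
      then show "half_turn_invariant (\<lambda>\<phi>. h (merge_vec i j \<phi>))"
        using inv by (simp add: half_turn_invariant_def)
      show "vec_homog l (count \<delta>' l) (\<lambda>\<phi>. h (merge_vec i j \<phi>))" for l
        unfolding homog_on_def
      proof (intro allI)
        fix s and \<phi> :: "'l \<times> bool \<Rightarrow> 'k"
        consider "l = i" | "l = j" | "l \<noteq> i" "l \<noteq> j" by blast
        then show "h (merge_vec i j (scale_on ({l} \<times> UNIV) s \<phi>)) = s ^ count \<delta>' l * h (merge_vec i j \<phi>)"
        proof cases
          case 1
          then have "merge_vec i j (scale_on ({l} \<times> UNIV) s \<phi>)
            = scale_on ({i} \<times> UNIV) s (scale_on ({j} \<times> UNIV) s (merge_vec i j \<phi>))"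
            using ij by (auto simp: merge_vec_def scale_on_def fun_eq_iff)
          then show ?thesis
            using hom[of i] hom[of j] 1 by (simp add: homog_on_def cnt m_def power_add)
        next
          case 2
          then have "merge_vec i j (scale_on ({l} \<times> UNIV) s \<phi>) = merge_vec i j \<phi>"
            using ij by (auto simp: merge_vec_def scale_on_def fun_eq_iff)
          then show ?thesis using 2 ij by (simp add: cnt)
        next
          case 3
          then have "merge_vec i j (scale_on ({l} \<times> UNIV) s \<phi>) = scale_on ({l} \<times> UNIV) s (merge_vec i j \<phi>)"
            by (auto simp: merge_vec_def scale_on_def fun_eq_iff)
          then show ?thesis using 3 hom[of l] by (simp add: cnt homog_on_def)
        qed
      qed
    qed
    moreover have "j \<notin># \<delta>'" using set' by auto
    moreover have "m \<le> count \<delta>' i" by (simp add: cnt)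
    moreover have "\<delta>' - replicate_mset m i + replicate_mset m j = \<delta>"
      using ij by (intro multiset_eqI) (auto simp: cnt m_def)
    ultimately obtain h'' where h'': "h'' \<in> bracket_span \<delta>"
      "\<forall>\<phi>. h'' (merge_vec i j \<phi>) = h (merge_vec i j \<phi>)"
      using bracket_span_split[of _ \<delta>' j m i] ij(3) by metis
    note p'' = bracket_span_properties[OF h''(1)]
    \<comment> \<open>\<open>h''\<close> agrees with \<open>h\<close> where
      \<open>v_i = v_j\<close>, so the difference is divisible by the bracket; the quotient inherits
      invariance and degrees because the bracket can be cancelled.\<close>
    define f where "f = (\<lambda>\<phi>. h \<phi> - h'' \<phi>)"
    have f: "f \<in> polyfun" "half_turn_invariant f" "\<And>l. vec_homog l (count \<delta> l) f"
      using h inv hom p'' by (auto simp: f_def half_turn_invariant_def homog_on_def right_diff_distrib intro: falg_diff)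
    obtain g where g: "g \<in> polyfun" "\<forall>\<phi>. f \<phi> = bracket i j \<phi> * g \<phi>"
      using bracket_dvd[OF inf f(1) ij(3) f(3)] h''(2) by (auto simp: f_def)
    \<comment> \<open>The point with \<open>v_i = (1, 0)\<close> and all other vectors
      \<open>(0, 1)\<close>; the bracket is 1 there.\<close>
    have nz: "bracket i j (\<lambda>(l, b). if l = i \<longleftrightarrow> b then 0 else 1) \<noteq> (0::'k)"
      using ij(3) by (simp add: bracket_def)
    have "g \<in> bracket_span (\<delta> - {#i, j#})"
    proof (rule less.hyps)
      have sz: "size \<delta> = size (\<delta> - {#i, j#}) + 2"
      proof -
        have "{#i, j#} \<subseteq># \<delta>"
          using ij by (auto simp: insert_subset_eq_iff in_diff_count)
        then show ?thesis
          using size_mset_mono[of "{#i, j#}" \<delta>] by (simp add: size_Diff_submset)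
      qed
      have "set_mset (\<delta> - {#i, j#}) \<subseteq> set_mset \<delta>" by (meson in_diffD subsetI)
      then have "card (set_mset (\<delta> - {#i, j#})) \<le> card (set_mset \<delta>)" by (intro card_mono) auto
      then show "card (set_mset (\<delta> - {#i, j#})) + size (\<delta> - {#i, j#}) < card (set_mset \<delta>) + size \<delta>"
        using sz by simp
      show "g \<in> polyfun" by (rule g)
      show "half_turn_invariant g"
        unfolding half_turn_invariant_def
      proof (intro allI impI)
        fix \<alpha> \<beta> \<gamma> :: 'k and \<phi> :: "'l \<times> bool \<Rightarrow> 'k"
        assume d: "- (\<alpha> * \<alpha>) - \<beta> * \<gamma> = 1"
        show "g (act2 \<alpha> \<beta> \<gamma> \<phi>) = g \<phi>"
        proof (rule polyfun_cancel[where f = "bracket i j" and h = g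
              and g = "\<lambda>\<phi>. g (act2 \<alpha> \<beta> \<gamma> \<phi>)", OF inf bracket_polyfun _ g(1) nz])
          show "(\<lambda>\<phi>. g (act2 \<alpha> \<beta> \<gamma> \<phi>)) \<in> polyfun"
          proof (rule polyfun_subst[OF g(1)])
            show "(\<lambda>\<phi>. act2 \<alpha> \<beta> \<gamma> \<phi> v) \<in> polyfun" for v
              by (cases v; cases "snd v"; simp add: act2_def; intro polyfun_intros)
          qed
          show "bracket i j \<phi> * g (act2 \<alpha> \<beta> \<gamma> \<phi>) = bracket i j \<phi> * g \<phi>" for \<phi>
            using f(2)[unfolded half_turn_invariant_def, rule_format, OF d, of \<phi>]
            by (simp add: g(2) bracket_act2[OF d])
        qed
      qed
      show "vec_homog l (count (\<delta> - {#i, j#}) l) g" for l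
      proof (rule polyfun_homog_onI[OF inf g(1)])
        fix s :: 'k and \<phi> :: "'l \<times> bool \<Rightarrow> 'k"
        assume s: "s \<noteq> 0"
        let ?a = "count {#i, j#} l" and ?b = "count (\<delta> - {#i, j#}) l"
        have c: "count \<delta> l = ?a + ?b"
          using ij by (auto simp: Suc_le_eq)
        show "g (scale_on ({l} \<times> UNIV) s \<phi>) = s ^ ?b * g \<phi>"
        proof (rule polyfun_cancel[where f = "bracket i j" and h = "\<lambda>\<phi>. s ^ ?b * g \<phi>"
              and g = "\<lambda>\<phi>. g (scale_on ({l} \<times> UNIV) s \<phi>)", OF inf bracket_polyfun _ _ nz])
          show "(\<lambda>\<phi>. g (scale_on ({l} \<times> UNIV) s \<phi>)) \<in> polyfun"
          proof (rule polyfun_subst[OF g(1)])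
            show "(\<lambda>\<phi>. scale_on ({l} \<times> UNIV) s \<phi> v) \<in> polyfun" for v
              by (cases "v \<in> {l} \<times> UNIV") (auto simp: scale_on_def intro: polyfun_intros)
          qed
          show "(\<lambda>\<phi>. s ^ ?b * g \<phi>) \<in> polyfun" using g(1) by (intro polyfun_intros)
          fix \<phi>
          have "s ^ ?a * (bracket i j \<phi> * g (scale_on ({l} \<times> UNIV) s \<phi>))
            = f (scale_on ({l} \<times> UNIV) s \<phi>)"
            unfolding g(2)[rule_format] bracket_scale[OF ij(3)] by simp
          also have "\<dots> = s ^ ?a * s ^ ?b * f \<phi>"
            unfolding f(3)[of l, unfolded homog_on_def, rule_format] c power_add ..
          also have "\<dots> = s ^ ?a * (bracket i j \<phi> * (s ^ ?b * g \<phi>))"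
            unfolding g(2)[rule_format, of \<phi>] by (simp only: ac_simps)
          finally show "bracket i j \<phi> * g (scale_on ({l} \<times> UNIV) s \<phi>) = bracket i j \<phi> * (s ^ ?b * g \<phi>)"
            using s by simp
        qed
      qed
    qed
    from bracket_span_mult_bracket[OF this ij(3)]
    have "f \<in> bracket_span (\<delta> - {#i, j#} + {#i, j#})"
      unfolding g(2)[rule_format, symmetric] .
    also have "\<delta> - {#i, j#} + {#i, j#} = \<delta>"
      using ij by (intro multiset_eqI) (auto simp: Suc_le_eq)
    finally have "(\<lambda>\<phi>. f \<phi> + h'' \<phi>) \<in> bracket_span \<delta>"
      using h''(1) by (rule bracket_span_add)
    then show ?thesis by (simp add: f_def)
  qed
qed

section \<open>Vectors in space as products of linear forms\<close>

type_synonym 'k vec3 = "'k \<times> 'k \<times> 'k"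

fun dot3 :: "'k::field vec3 \<Rightarrow> 'k vec3 \<Rightarrow> 'k" where
  "dot3 (a, b, c) (a', b', c') = a * a' + b * b' + c * c'"

fun vprod :: "'k::field vec3 \<Rightarrow> 'k vec3 \<Rightarrow> 'k vec3" where
  "vprod (a, b, c) (a', b', c') = (b * c' - c * b', c * a' - a * c', a * b' - b * a')"

fun scale3 :: "'k::field \<Rightarrow> 'k vec3 \<Rightarrow> 'k vec3" where
  "scale3 s (a, b, c) = (s * a, s * b, s * c)"

lemma dot3_commute: "dot3 v w = dot3 w v"
  by (cases v; cases w) (simp add: mult.commute)

lemma dot3_add: "dot3 (v + v') w = dot3 v w + dot3 v' w"
  by (cases v; cases v'; cases w) (simp add: algebra_simps)

lemma dot3_scale: "dot3 (scale3 s v) w = s * dot3 v w"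
  by (cases v; cases w) (simp add: algebra_simps)

lemma vprod_add: "vprod (v + v') w = vprod v w + vprod v' w"
  by (cases v; cases v'; cases w) (simp add: algebra_simps)

lemma vprod_scale: "vprod (scale3 s v) w = scale3 s (vprod v w)"
  by (cases v; cases w) (simp add: algebra_simps)

lemma vprod_commute: "vprod v w = scale3 (- 1) (vprod w v)"
  by (cases v; cases w) (simp add: algebra_simps)

lemma vprod_vprod: "vprod (vprod u v) w = scale3 (dot3 u w) v + scale3 (- dot3 v w) u"
  by (cases u; cases v; cases w) (simp add: algebra_simps)

text \<open>The vector-valued counterpart of the invariants. Vectors and their pairwise products
  suffice as generators, since \<open>vprod_vprod\<close> brings longer vector products back to
  combinations of vectors.\<close>

inductive_set covariants ::
    "('p \<Rightarrow> 'k::field) set \<Rightarrow> 'i set \<Rightarrow> ('i \<Rightarrow> 'p \<Rightarrow> 'k vec3) \<Rightarrow> ('p \<Rightarrow> 'k vec3) set"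
  for A I \<xi> where
  zero: "(\<lambda>_. 0) \<in> covariants A I \<xi>"
| vec: "k \<in> I \<Longrightarrow> \<xi> k \<in> covariants A I \<xi>"
| vprod: "k \<in> I \<Longrightarrow> l \<in> I \<Longrightarrow> (\<lambda>\<phi>. vprod (\<xi> k \<phi>) (\<xi> l \<phi>)) \<in> covariants A I \<xi>"
| add: "w \<in> covariants A I \<xi> \<Longrightarrow> w' \<in> covariants A I \<xi> \<Longrightarrow> (\<lambda>\<phi>. w \<phi> + w' \<phi>) \<in> covariants A I \<xi>"
| scale: "c \<in> A \<Longrightarrow> w \<in> covariants A I \<xi> \<Longrightarrow> (\<lambda>\<phi>. scale3 (c \<phi>) (w \<phi>)) \<in> covariants A I \<xi>"

definition basic_invariants :: "'i set \<Rightarrow> ('i \<Rightarrow> 'p \<Rightarrow> 'k::field vec3) \<Rightarrow> ('p \<Rightarrow> 'k) set" where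
  "basic_invariants I \<xi> = {\<lambda>\<phi>. dot3 (\<xi> k \<phi>) (\<xi> l \<phi>) | k l. k \<in> I \<and> l \<in> I} \<union>
     {\<lambda>\<phi>. dot3 (\<xi> j \<phi>) (vprod (\<xi> k \<phi>) (\<xi> l \<phi>)) | j k l. j \<in> I \<and> k \<in> I \<and> l \<in> I}"

lemma basic_invariants_dot:
  "k \<in> I \<Longrightarrow> l \<in> I \<Longrightarrow> (\<lambda>\<phi>. dot3 (\<xi> k \<phi>) (\<xi> l \<phi>)) \<in> basic_invariants I \<xi>"
  unfolding basic_invariants_def by (rule UnI1, rule CollectI, intro exI conjI) (rule refl)

lemma basic_invariants_triple:
  "j \<in> I \<Longrightarrow> k \<in> I \<Longrightarrow> l \<in> I \<Longrightarrow>
    (\<lambda>\<phi>. dot3 (\<xi> j \<phi>) (vprod (\<xi> k \<phi>) (\<xi> l \<phi>))) \<in> basic_invariants I \<xi>"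
  unfolding basic_invariants_def by (rule UnI2, rule CollectI, intro exI conjI) (rule refl)

text \<open>By linearity in each argument only vectors and products of two vectors need to be
  multiplied; \<open>vprod_vprod\<close>, its mirror image and the cyclic rule for triple products
  treat these.\<close>

lemma covariants_dot_vprod:
  assumes A: "A = falg C" and C: "basic_invariants I \<xi> \<subseteq> C"
    and w: "w \<in> covariants A I \<xi>" and w': "w' \<in> covariants A I \<xi>"
  shows "(\<lambda>\<phi>. dot3 (w \<phi>) (w' \<phi>)) \<in> A" "(\<lambda>\<phi>. vprod (w \<phi>) (w' \<phi>)) \<in> covariants A I \<xi>"
proof -
  have D: "(\<lambda>\<phi>. dot3 (\<xi> k \<phi>) (\<xi> l \<phi>)) \<in> A" if "k \<in> I" "l \<in> I" for k l
    unfolding A by (rule falg.gen, rule subsetD[OF C], rule basic_invariants_dot[OF that])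
  have T: "(\<lambda>\<phi>. dot3 (\<xi> j \<phi>) (vprod (\<xi> k \<phi>) (\<xi> l \<phi>))) \<in> A" if "j \<in> I" "k \<in> I" "l \<in> I" for j k l
    unfolding A by (rule falg.gen, rule subsetD[OF C], rule basic_invariants_triple[OF that])
  have T': "(\<lambda>\<phi>. dot3 (vprod (\<xi> k \<phi>) (\<xi> l \<phi>)) (\<xi> j \<phi>)) \<in> A" if "j \<in> I" "k \<in> I" "l \<in> I" for j k l
    using T[OF that] by (simp add: dot3_commute)
  note Aintros = falg.add[of _ C, folded A] falg.mult[of _ C, folded A] falg.const[of _ C, folded A]
    falg_diff[of _ C, folded A] falg_uminus[of _ C, folded A]
  have 1: "(\<lambda>\<phi>. dot3 (w \<phi>) (\<xi> j \<phi>)) \<in> A \<and> (\<lambda>\<phi>. vprod (w \<phi>) (\<xi> j \<phi>)) \<in> covariants A I \<xi>"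
    if j: "j \<in> I" and w: "w \<in> covariants A I \<xi>" for j w
    using w
  proof induction
    case zero
    have "dot3 0 v = 0 \<and> vprod 0 v = 0" for v :: "'b vec3"
      by (cases v) (simp add: zero_prod_def)
    then show ?case using covariants.zero by (auto intro: Aintros)
  next
    case (vec k)
    show ?case using D[OF vec j] covariants.vprod[OF vec j] by blast
  next
    case (vprod k l)
    have "(\<lambda>\<phi>. scale3 (dot3 (\<xi> k \<phi>) (\<xi> j \<phi>)) (\<xi> l \<phi>) + scale3 (- dot3 (\<xi> l \<phi>) (\<xi> j \<phi>)) (\<xi> k \<phi>))
        \<in> covariants A I \<xi>"
      using vprod j by (intro covariants.add covariants.scale covariants.vec Aintros(5) D) auto
    then show ?case using T'[OF j vprod] by (simp add: vprod_vprod)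
  next
    case (add w w')
    then show ?case unfolding dot3_add vprod_add by (auto intro: Aintros(1) covariants.add)
  next
    case (scale c w)
    then show ?case unfolding dot3_scale vprod_scale by (auto intro: Aintros(2) covariants.scale)
  qed
  have 2: "(\<lambda>\<phi>. dot3 (w \<phi>) (vprod (\<xi> j \<phi>) (\<xi> k \<phi>))) \<in> A \<and>
      (\<lambda>\<phi>. vprod (w \<phi>) (vprod (\<xi> j \<phi>) (\<xi> k \<phi>))) \<in> covariants A I \<xi>"
    if j: "j \<in> I" and k: "k \<in> I" and w: "w \<in> covariants A I \<xi>" for j k w
  proof
    have eq: "vprod u (vprod x y) = scale3 (dot3 u y) x + scale3 (- dot3 u x) y" for u x y :: "'b vec3"
      by (cases u; cases x; cases y) (simp add: algebra_simps)
    show "(\<lambda>\<phi>. vprod (w \<phi>) (vprod (\<xi> j \<phi>) (\<xi> k \<phi>))) \<in> covariants A I \<xi>"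
      unfolding eq using 1[OF j w] 1[OF k w] j k
      by (intro covariants.add covariants.scale covariants.vec Aintros(5)) auto
    have "dot3 u (vprod x y) = dot3 (vprod u x) y" for u x y :: "'b vec3"
      by (cases u; cases x; cases y) (simp add: algebra_simps)
    then show "(\<lambda>\<phi>. dot3 (w \<phi>) (vprod (\<xi> j \<phi>) (\<xi> k \<phi>))) \<in> A"
      using 1[OF k conjunct2[OF 1[OF j w]]] by simp
  qed
  have "(\<lambda>\<phi>. dot3 (w' \<phi>) (w \<phi>)) \<in> A \<and> (\<lambda>\<phi>. vprod (w' \<phi>) (w \<phi>)) \<in> covariants A I \<xi>"
    using w'
  proof induction
    case zero
    have "dot3 0 v = 0 \<and> vprod 0 v = 0" for v :: "'b vec3"
      by (cases v) (simp add: zero_prod_def)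
    then show ?case using covariants.zero by (auto intro: Aintros)
  next
    case (vec k)
    have "(\<lambda>\<phi>. scale3 (- 1) (vprod (w \<phi>) (\<xi> k \<phi>))) \<in> covariants A I \<xi>"
      using 1[OF vec w] by (intro covariants.scale Aintros(3)) auto
    then show ?case using 1[OF vec w] by (simp add: dot3_commute vprod_commute[of "\<xi> k _"])
  next
    case (vprod k l)
    have "(\<lambda>\<phi>. scale3 (- 1) (vprod (w \<phi>) (vprod (\<xi> k \<phi>) (\<xi> l \<phi>)))) \<in> covariants A I \<xi>"
      using 2[OF vprod w] by (intro covariants.scale Aintros(3)) auto
    then show ?case using 2[OF vprod w]
      by (simp add: dot3_commute[of _ "w _"] vprod_commute[of _ "w _"])
  next
    case (add w w')
    then show ?case unfolding dot3_add vprod_add by (auto intro: Aintros(1) covariants.add)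
  next
    case (scale c w)
    then show ?case unfolding dot3_scale vprod_scale by (auto intro: Aintros(2) covariants.scale)
  qed
  moreover have "(\<lambda>\<phi>. scale3 (- 1) (vprod (w' \<phi>) (w \<phi>))) \<in> covariants A I \<xi>"
    using calculation by (intro covariants.scale Aintros(3)) auto
  ultimately show "(\<lambda>\<phi>. dot3 (w \<phi>) (w' \<phi>)) \<in> A" "(\<lambda>\<phi>. vprod (w \<phi>) (w' \<phi>)) \<in> covariants A I \<xi>"
    by (simp_all add: dot3_commute[of "w _"] vprod_commute[of "w _"])
qed

section \<open>Binary forms, Pauli matrices and brackets with coefficients\<close>

fun det2 :: "'k::field \<times> 'k \<Rightarrow> 'k \<times> 'k \<Rightarrow> 'k" where
  "det2 (x, y) (x', y') = x * y' - y * x'"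

text \<open>A field with a square root \<open>\<iota>\<close> of \<open>- 1\<close>. There the quadric \<open>x\<^sup>2 + y\<^sup>2 + z\<^sup>2\<close> is the
  discriminant of binary quadratic forms, and \<open>conic p q\<close> is the product of two linear forms.\<close>

locale field_with_i =
  fixes \<iota> :: "'k::field"
  assumes i_squared: "\<iota> * \<iota> = - 1"
    and two_neq_0: "(2::'k) \<noteq> 0"
    and infinite_field: "infinite (UNIV :: 'k set)"
begin

text \<open>If \<open>P\<close>, \<open>M\<close>, \<open>Q\<close> are the coefficients of
  \<open>X^2\<close>, \<open>X Y\<close>, \<open>Y^2\<close> in
  \<open>(a X + b Y) (a' X + b' Y)\<close>, this is \<open>(P - Q, \<iota> (P + Q), - M)\<close>,
  whose sum of squares is \<open>M^2 - 4 P Q\<close>.\<close>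

fun conic :: "'k \<times> 'k \<Rightarrow> 'k \<times> 'k \<Rightarrow> 'k vec3" where
  "conic (a, b) (a', b') = (a * a' - b * b', \<iota> * (a * a' + b * b'), - (a * b' + b * a'))"

text \<open>The action of \<open>s + w \<bullet> \<sigma>\<close>, where \<open>\<sigma>\<close> are the Pauli matrices.\<close>

fun pauli :: "'k \<Rightarrow> 'k vec3 \<Rightarrow> 'k \<times> 'k \<Rightarrow> 'k \<times> 'k" where
  "pauli s (w\<^sub>1, w\<^sub>2, w\<^sub>3) (x, y) =
     (s * x + w\<^sub>3 * x + (w\<^sub>1 - \<iota> * w\<^sub>2) * y, s * y + (w\<^sub>1 + \<iota> * w\<^sub>2) * x - w\<^sub>3 * y)"

lemma i_squared': "\<iota> * (\<iota> * x) = - x"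
  using i_squared by (metis minus_mult_commute mult.assoc mult_1)

text \<open>When \<open>p\<close> and \<open>q\<close> are the two factors of one vector, this
  evaluates a factor linking them in terms of the vector and its root.\<close>

lemma det2_pauli: "det2 p (pauli s w q) = s * det2 p q + dot3 w (conic p q)"
  by (cases p; cases q; cases w) (simp add: algebra_simps)

text \<open>Quaternion multiplication in Pauli coordinates. The new vector part uses only linear
  combinations and vector products, hence stays a covariant.\<close>

lemma pauli_pauli:
  "pauli s w (pauli s' w' q) =
     pauli (s * s' + dot3 w w') (scale3 s w' + scale3 s' w + scale3 \<iota> (vprod w w')) q"
  by (cases q; cases w; cases w') (simp add: algebra_simps i_squared i_squared')

text \<open>For each Pauli matrix \<open>\<sigma>\<close> the form
  \<open>det2 p (\<sigma> q)\<close> is symmetric in \<open>p\<close> and \<open>q\<close>, while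
  \<open>det2 p q\<close> is alternating. So a factor can be read from either end.\<close>

lemma det2_pauli_flip: "det2 p (pauli s w q) = det2 q (pauli (- s) w p)"
  by (cases p; cases q; cases w) (simp add: algebra_simps)

text \<open>Expands the rank-one map that takes \<open>q\<close> to \<open>det2 b q\<close> times
  \<open>a\<close> in the identity and the Pauli matrices; its factor 2 is why the contraction
  divides by 2.\<close>

lemma pauli_rank_one:
  "pauli (- det2 a b) (conic a b) q = (2 * det2 b q * fst a, 2 * det2 b q * snd a)"
  by (cases a; cases b; cases q) (simp add: algebra_simps i_squared i_squared')

text \<open>Eliminating two partners \<open>a\<close> and \<open>b\<close> from a product of two factors: \<open>a b\<^sup>T\<close> is, up to
  the symplectic form, a combination of the identity and of \<open>conic a b\<close>.\<close>

lemma det2_pauli_contract: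
  defines "s'' \<equiv> \<lambda>s w s' w' a b. (s * det2 a b + dot3 w (conic a b)) * s'
      + dot3 (scale3 (- s) (conic a b) + scale3 (- det2 a b) w + scale3 \<iota> (vprod w (conic a b))) w'"
    and "w'' \<equiv> \<lambda>s w s' w' a b. scale3 (s * det2 a b + dot3 w (conic a b)) w'
      + scale3 s' (scale3 (- s) (conic a b) + scale3 (- det2 a b) w + scale3 \<iota> (vprod w (conic a b)))
      + scale3 \<iota> (vprod (scale3 (- s) (conic a b) + scale3 (- det2 a b) w + scale3 \<iota> (vprod w (conic a b))) w')"
  shows "det2 a (pauli s w q) * det2 b (pauli s' w' q') =
    det2 q (pauli (1 / 2 * s'' s w s' w' a b) (scale3 (1 / 2) (w'' s w s' w' a b)) q')"
proof -
  let ?y = "pauli s' w' q'"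
  let ?w = "scale3 (- s) (conic a b) + scale3 (- det2 a b) w + scale3 \<iota> (vprod w (conic a b))"
  have lin: "det2 q (pauli (c * s) (scale3 c w) x) = c * det2 q (pauli s w x)" for c s w q x
    by (cases q; cases w; cases x) (simp add: algebra_simps)
  have lin': "det2 q (pauli s w (c * fst a, c * snd a)) = c * det2 q (pauli s w a)" for c s w q a
    by (cases q; cases w; cases a) (simp add: algebra_simps)
  have "2 * (det2 a (pauli s w q) * det2 b ?y) = 2 * det2 b ?y * det2 q (pauli (- s) w a)"
    by (subst det2_pauli_flip) simp
  also have "\<dots> = det2 q (pauli (- s) w (pauli (- det2 a b) (conic a b) ?y))"
    unfolding pauli_rank_one lin' ..
  also have "\<dots> = det2 q (pauli (s * det2 a b + dot3 w (conic a b)) ?w ?y)"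
    unfolding pauli_pauli[of "- s" w "- det2 a b"] by simp
  also have "\<dots> = det2 q (pauli (s'' s w s' w' a b) (w'' s w s' w' a b) q')"
    unfolding pauli_pauli s''_def w''_def ..
  finally have "2 * (det2 a (pauli s w q) * det2 b ?y) =
    det2 q (pauli (s'' s w s' w' a b) (w'' s w s' w' a b) q')" .
  then show ?thesis unfolding lin using two_neq_0 by (simp add: mult.commute[of _ 2])
qed

text \<open>The discriminant of a product of two linear forms is the square of their
  resultant.\<close>

lemma conic_norm: "dot3 (conic a b) (conic a b) = det2 a b * det2 a b"
  by (cases a; cases b) (simp add: algebra_simps i_squared i_squared')

definition vec2 :: "'l \<Rightarrow> ('l \<times> bool \<Rightarrow> 'k) \<Rightarrow> 'k \<times> 'k" where
  "vec2 l \<psi> = (\<psi> (l, False), \<psi> (l, True))"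

text \<open>The vectors with indices \<open>(k, False)\<close> and \<open>(k, True)\<close> parametrize the \<open>k\<close>-th vector.\<close>

definition conic_vec :: "'i \<Rightarrow> (('i \<times> bool) \<times> bool \<Rightarrow> 'k) \<Rightarrow> 'k vec3" where
  "conic_vec k \<psi> = conic (vec2 (k, False) \<psi>) (vec2 (k, True) \<psi>)"

definition conic_root :: "'i \<Rightarrow> (('i \<times> bool) \<times> bool \<Rightarrow> 'k) \<Rightarrow> 'k" where
  "conic_root k \<psi> = det2 (vec2 (k, False) \<psi>) (vec2 (k, True) \<psi>)"

definition conic_ring :: "'i set \<Rightarrow> ((('i \<times> bool) \<times> bool \<Rightarrow> 'k) \<Rightarrow> 'k) set" where
  "conic_ring I = falg (basic_invariants I conic_vec \<union> conic_root ` I)"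

abbreviation conic_covariants :: "'i set \<Rightarrow> ((('i \<times> bool) \<times> bool \<Rightarrow> 'k) \<Rightarrow> 'k vec3) set" where
  "conic_covariants I \<equiv> covariants (conic_ring I) I conic_vec"

text \<open>Brackets \<open>[p, q]\<close> generalized to
  \<open>[p, (s + w \<bullet> \<sigma>) q]\<close>, with coefficients that are built from the
  vectors and roots. This class is closed under contracting two partners; \<open>L\<close> lists the
  letters still visible.\<close>

inductive factor_product :: "'i set \<Rightarrow> ((('i \<times> bool) \<times> bool \<Rightarrow> 'k) \<Rightarrow> 'k) \<Rightarrow> ('i \<times> bool) multiset \<Rightarrow> bool"
  for I where
  base: "c \<in> conic_ring I \<Longrightarrow> factor_product I c {#}"
| step: "factor_product I F L \<Longrightarrow> s \<in> conic_ring I \<Longrightarrow> w \<in> conic_covariants I \<Longrightarrow>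
    factor_product I (\<lambda>\<psi>. det2 (vec2 p \<psi>) (pauli (s \<psi>) (w \<psi>) (vec2 q \<psi>)) * F \<psi>) (L + {#p, q#})"

lemma factor_product_extract:
  assumes "factor_product I F L" "p \<in># L"
  shows "\<exists>q s w F' L'. L = L' + {#p, q#} \<and> factor_product I F' L' \<and> s \<in> conic_ring I \<and>
    w \<in> conic_covariants I \<and> (\<forall>\<psi>. F \<psi> = det2 (vec2 p \<psi>) (pauli (s \<psi>) (w \<psi>) (vec2 q \<psi>)) * F' \<psi>)"
  using assms
proof induction
  case (base c)
  then show ?case by simp
next
  case (step F L s w p\<^sub>0 q\<^sub>0)
  consider "p = p\<^sub>0" | "p = q\<^sub>0" | "p \<in># L" using step.prems by auto
  then show ?case
  proof cases
    case 1
    show ?thesis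
      by (intro exI[of _ q\<^sub>0] exI[of _ s] exI[of _ w] exI[of _ F] exI[of _ L]) (use step 1 in auto)
  next
    case 2
    \<comment> \<open>Here \<open>p\<close> stands at the second place; flipping the factor negates
      its scalar part.\<close>
    have "(\<lambda>\<psi>. - s \<psi>) \<in> conic_ring I" using step.hyps(2) unfolding conic_ring_def by (rule falg_uminus)
    then show ?thesis
      by (intro exI[of _ p\<^sub>0] exI[of _ "\<lambda>\<psi>. - s \<psi>"] exI[of _ w] exI[of _ F] exI[of _ L])
        (use step.hyps 2 in \<open>auto simp: add_mset_commute det2_pauli_flip[of "vec2 p\<^sub>0 _"]\<close>)
  next
    case 3
    then obtain q s' w' F' L' where *: "L = L' + {#p, q#}" "factor_product I F' L'" "s' \<in> conic_ring I"
      "w' \<in> conic_covariants I" "\<forall>\<psi>. F \<psi> = det2 (vec2 p \<psi>) (pauli (s' \<psi>) (w' \<psi>) (vec2 q \<psi>)) * F' \<psi>"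
      using step.IH by blast
    have eq: "L + {#p\<^sub>0, q\<^sub>0#} = (L' + {#p\<^sub>0, q\<^sub>0#}) + {#p, q#}" using *(1) by simp
    show ?thesis
      unfolding eq
      by (intro exI[of _ q] exI[of _ s'] exI[of _ w'] exI[of _ "L' + {#p\<^sub>0, q\<^sub>0#}"]
          exI[of _ "\<lambda>\<psi>. det2 (vec2 p\<^sub>0 \<psi>) (pauli (s \<psi>) (w \<psi>) (vec2 q\<^sub>0 \<psi>)) * F' \<psi>"] conjI refl allI
          factor_product.step * step.hyps)
        (simp add: *(5)[rule_format] mult.left_commute)
  qed
qed

text \<open>Induction on the number of visible letters. The partner \<open>(k, True)\<close> of
  \<open>(k, False)\<close> lies either in the same factor, which \<open>det2_pauli\<close>
  evaluates, or in another one, and then \<open>det2_pauli_contract\<close> fuses the two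
  factors.\<close>

lemma factor_product_balanced:
  assumes "factor_product I F L" "fst ` set_mset L \<subseteq> I"
    and "\<And>k. count L (k, False) = count L (k, True)"
  shows "F \<in> conic_ring I"
  using assms
proof (induction "size L" arbitrary: F L rule: less_induct)
  case less
  note Aintros = falg.add[of _ "basic_invariants I conic_vec \<union> conic_root ` I", folded conic_ring_def]
    falg.mult[of _ "basic_invariants I conic_vec \<union> conic_root ` I", folded conic_ring_def]
    falg.const[of _ "basic_invariants I conic_vec \<union> conic_root ` I", folded conic_ring_def]
    falg_uminus[of _ "basic_invariants I conic_vec \<union> conic_root ` I", folded conic_ring_def]
  note dv = covariants_dot_vprod[OF conic_ring_def Un_upper1]
  show ?case
  proof (cases "L = {#}")
    case True
    with less.prems(1) show ?thesis by cases auto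
  next
    case False
    then obtain k b where kb: "(k, b) \<in># L" by (metis multiset_nonemptyE surj_pair)
    then have k: "k \<in> I" using less.prems(2) by force
    have "count L (k, b) = count L (k, False)" using less.prems(3) by (cases b) auto
    then have "(k, False) \<in># L" using kb by (metis count_greater_zero_iff)
    then obtain q s w F' L' where *: "L = L' + {#(k, False), q#}" "factor_product I F' L'" "s \<in> conic_ring I"
      "w \<in> conic_covariants I" "\<forall>\<psi>. F \<psi> = det2 (vec2 (k, False) \<psi>) (pauli (s \<psi>) (w \<psi>) (vec2 q \<psi>)) * F' \<psi>"
      using factor_product_extract[OF less.prems(1)] by blast
    have root: "conic_root k \<in> conic_ring I" unfolding conic_ring_def using k by (intro falg.gen) auto
    have vec: "conic_vec k \<in> conic_covariants I" using k by (rule covariants.vec)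
    show ?thesis
    proof (cases "q = (k, True)")
      case True
      have F': "F' \<in> conic_ring I"
      proof (rule less.hyps[OF _ *(2)])
        show "size L' < size L" using *(1) by simp
        show "fst ` set_mset L' \<subseteq> I" using less.prems(2) *(1) by auto
        show "count L' (l, False) = count L' (l, True)" for l
          using less.prems(3)[of l] *(1) True by (auto split: if_splits)
      qed
      have F: "F = (\<lambda>\<psi>. (s \<psi> * conic_root k \<psi> + dot3 (w \<psi>) (conic_vec k \<psi>)) * F' \<psi>)"
        using *(5) True by (auto simp: det2_pauli conic_root_def conic_vec_def)
      show ?thesis
        unfolding F by (intro Aintros(1,2) F' root *(3) dv(1)[OF *(4) vec])
    next
      case False
      have "count L (k, True) = count L (k, False)" using less.prems(3)[of k] by simp
      then have "(k, True) \<in># L'" using *(1) False by (auto simp: count_greater_zero_iff[symmetric] split: if_splits)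
      then obtain q' s' w' F'' L'' where **: "L' = L'' + {#(k, True), q'#}" "factor_product I F'' L''"
        "s' \<in> conic_ring I" "w' \<in> conic_covariants I"
        "\<forall>\<psi>. F' \<psi> = det2 (vec2 (k, True) \<psi>) (pauli (s' \<psi>) (w' \<psi>) (vec2 q' \<psi>)) * F'' \<psi>"
        using factor_product_extract[OF *(2)] by blast
      \<comment> \<open>The coefficients from \<open>det2_pauli_contract\<close>, with
        \<open>a\<close> and \<open>b\<close> the two factors of the \<open>k\<close>-th vector and
        the scalar 1/2 included in \<open>s\<^sub>2\<close> and \<open>w\<^sub>2\<close>.\<close>
      define s\<^sub>1 where "s\<^sub>1 = (\<lambda>\<psi>. s \<psi> * conic_root k \<psi> + dot3 (w \<psi>) (conic_vec k \<psi>))"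
      define w\<^sub>1 where "w\<^sub>1 = (\<lambda>\<psi>. scale3 (- s \<psi>) (conic_vec k \<psi>) + scale3 (- conic_root k \<psi>) (w \<psi>)
        + scale3 \<iota> (vprod (w \<psi>) (conic_vec k \<psi>)))"
      define s\<^sub>2 where "s\<^sub>2 = (\<lambda>\<psi>. 1 / 2 * (s\<^sub>1 \<psi> * s' \<psi> + dot3 (w\<^sub>1 \<psi>) (w' \<psi>)))"
      define w\<^sub>2 where "w\<^sub>2 = (\<lambda>\<psi>. scale3 (1 / 2) (scale3 (s\<^sub>1 \<psi>) (w' \<psi>) + scale3 (s' \<psi>) (w\<^sub>1 \<psi>)
        + scale3 \<iota> (vprod (w\<^sub>1 \<psi>) (w' \<psi>))))"
      have s\<^sub>1: "s\<^sub>1 \<in> conic_ring I"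
        unfolding s\<^sub>1_def by (intro Aintros(1,2) *(3) root dv(1)[OF *(4) vec])
      have w\<^sub>1: "w\<^sub>1 \<in> conic_covariants I"
        unfolding w\<^sub>1_def
        by (intro covariants.add covariants.scale Aintros(3,4) *(3,4) root vec dv(2)[OF *(4) vec])
      have s\<^sub>2: "s\<^sub>2 \<in> conic_ring I"
        unfolding s\<^sub>2_def by (intro Aintros(1-3) s\<^sub>1 **(3) dv(1)[OF w\<^sub>1 **(4)])
      have w\<^sub>2: "w\<^sub>2 \<in> conic_covariants I"
        unfolding w\<^sub>2_def
        by (intro covariants.add covariants.scale Aintros(3) s\<^sub>1 w\<^sub>1 **(3,4) dv(2)[OF w\<^sub>1 **(4)])
      have F: "F = (\<lambda>\<psi>. det2 (vec2 q \<psi>) (pauli (s\<^sub>2 \<psi>) (w\<^sub>2 \<psi>) (vec2 q' \<psi>)) * F'' \<psi>)"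
        unfolding *(5)[rule_format, abs_def] **(5)[rule_format]
        by (rule ext) (simp only: mult.assoc[symmetric] det2_pauli_contract s\<^sub>2_def w\<^sub>2_def s\<^sub>1_def w\<^sub>1_def
            conic_root_def conic_vec_def *(5) **(5))
      show ?thesis
      proof (rule less.hyps)
        show "factor_product I F (L'' + {#q, q'#})"
          unfolding F by (rule factor_product.step[OF **(2) s\<^sub>2 w\<^sub>2])
        show "size (L'' + {#q, q'#}) < size L" using *(1) **(1) by simp
        show "fst ` set_mset (L'' + {#q, q'#}) \<subseteq> I" using less.prems(2) *(1) **(1) by auto
        show "count (L'' + {#q, q'#}) (l, False) = count (L'' + {#q, q'#}) (l, True)" for l
          using less.prems(3)[of l] *(1) **(1) by (auto split: if_splits)
      qed
    qed
  qed
qed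

lemma bracket_span_balanced:
  assumes h: "h \<in> bracket_span L" and L: "fst ` set_mset L \<subseteq> I"
    and bal: "\<And>k. count L (k, False) = count L (k, True)"
  shows "h \<in> conic_ring I"
proof -
  have mon: "factor_product I B L" if "bracket_monomial B L" for B L
    using that
  proof induction
    case one
    show ?case by (rule factor_product.base) (simp add: conic_ring_def falg.const)
  next
    case (mult B L p q)
    \<comment> \<open>A plain bracket is the factor with scalar part 1 and vector part 0.\<close>
    have "(\<lambda>_. 1) \<in> conic_ring I" by (simp add: conic_ring_def falg.const)
    from factor_product.step[OF mult.IH this covariants.zero, of p q]
    show ?case by (simp add: zero_prod_def vec2_def bracket_def)
  qed
  show ?thesis
    using h
  proof induction
    case zero
    show ?case by (simp add: conic_ring_def falg.const)
  next
    case (step h B c)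
    have "B \<in> conic_ring I" by (rule factor_product_balanced[OF mon[OF step.hyps(2)] L bal])
    then show ?case using step.IH unfolding conic_ring_def by (intro falg.add falg.mult falg.const)
  qed
qed

definition swap_pair :: "'i \<Rightarrow> (('i \<times> bool) \<times> bool \<Rightarrow> 'k) \<Rightarrow> (('i \<times> bool) \<times> bool \<Rightarrow> 'k)" where
  "swap_pair k \<psi> = (\<lambda>((l, b), c). \<psi> ((l, if l = k then \<not> b else b), c))"

lemma conic_vec_swap [simp]: "conic_vec l (swap_pair k \<psi>) = conic_vec l \<psi>"
  by (auto simp: conic_vec_def swap_pair_def vec2_def algebra_simps)

lemma conic_root_swap: "conic_root l (swap_pair k \<psi>) = (if l = k then - 1 else 1) * conic_root l \<psi>"
  by (auto simp: conic_root_def swap_pair_def vec2_def algebra_simps)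

text \<open>The square of \<open>conic_root k\<close> is an invariant and \<open>swap_pair k\<close> changes its sign, so
  invariance under the swaps removes the roots one at a time.\<close>

lemma conic_ring_swap_invariant:
  assumes "finite J" "J \<subseteq> I"
    and "h \<in> falg (basic_invariants I conic_vec \<union> conic_root ` J)"
    and "\<And>k \<psi>. k \<in> J \<Longrightarrow> h (swap_pair k \<psi>) = h \<psi>"
  shows "h \<in> falg (basic_invariants I conic_vec)"
  using assms
proof (induction J)
  case empty
  then show ?case by simp
next
  case (insert k J)
  define C where "C = basic_invariants I conic_vec \<union> conic_root ` J"
  have sq: "(\<lambda>\<psi>. conic_root k \<psi> * conic_root k \<psi>) \<in> falg C"
  proof -
    have "(\<lambda>\<psi>. dot3 (conic_vec k \<psi>) (conic_vec k \<psi>)) \<in> falg C"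
      using insert.prems(1) by (intro falg.gen) (simp add: C_def basic_invariants_dot)
    then show ?thesis by (simp add: conic_vec_def conic_root_def conic_norm)
  qed
  \<comment> \<open>Modulo the relation \<open>sq\<close> everything is linear in the root of
    \<open>k\<close>, with coefficients free of it.\<close>
  have "\<exists>P \<in> falg C. \<exists>Q \<in> falg C. \<forall>\<psi>. h \<psi> = P \<psi> + conic_root k \<psi> * Q \<psi>"
    using insert.prems(2)
  proof induction
    case (const c)
    show ?case by (intro bexI[OF _ falg.const[of c]] bexI[OF _ falg.const[of 0]]) simp
  next
    case (gen f)
    then consider "f = conic_root k" | "f \<in> C" by (auto simp: C_def)
    then show ?case
    proof cases
      case 1
      then show ?thesis by (intro bexI[OF _ falg.const[of 0]] bexI[OF _ falg.const[of 1]]) simp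
    next
      case 2
      then show ?thesis by (intro bexI[OF _ falg.gen[OF 2]] bexI[OF _ falg.const[of 0]]) simp
    qed
  next
    case (add f g)
    then obtain P Q P' Q' where *: "P \<in> falg C" "Q \<in> falg C" "\<forall>\<psi>. f \<psi> = P \<psi> + conic_root k \<psi> * Q \<psi>"
      "P' \<in> falg C" "Q' \<in> falg C" "\<forall>\<psi>. g \<psi> = P' \<psi> + conic_root k \<psi> * Q' \<psi>" by blast
    show ?case
      by (intro bexI[OF _ falg.add[OF *(1,4)]] bexI[OF _ falg.add[OF *(2,5)]] allI)
        (simp add: *(3,6) algebra_simps)
  next
    case (mult f g)
    then obtain P Q P' Q' where *: "P \<in> falg C" "Q \<in> falg C" "\<forall>\<psi>. f \<psi> = P \<psi> + conic_root k \<psi> * Q \<psi>"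
      "P' \<in> falg C" "Q' \<in> falg C" "\<forall>\<psi>. g \<psi> = P' \<psi> + conic_root k \<psi> * Q' \<psi>" by blast
    show ?case
      by (intro bexI[OF _ falg.add[OF falg.mult[OF *(1,4)] falg.mult[OF sq falg.mult[OF *(2,5)]]]]
          bexI[OF _ falg.add[OF falg.mult[OF *(1,5)] falg.mult[OF *(2,4)]]] allI)
        (simp add: *(3,6) algebra_simps)
  qed
  then obtain P Q where PQ: "P \<in> falg C" "Q \<in> falg C" "\<forall>\<psi>. h \<psi> = P \<psi> + conic_root k \<psi> * Q \<psi>"
    by blast
  have inv: "f (swap_pair k \<psi>) = f \<psi>" if "f \<in> falg C" for f \<psi>
    using that
  proof induction
    case (gen f)
    then show ?case using insert.hyps by (auto simp: C_def basic_invariants_def conic_root_swap)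
  qed auto
  have "h \<psi> = P \<psi>" for \<psi>
  proof -
    \<comment> \<open>The swap fixes \<open>h\<close>, \<open>P\<close> and \<open>Q\<close> and
      negates the root.\<close>
    have "h \<psi> = P \<psi> - conic_root k \<psi> * Q \<psi>"
      using insert.prems(3)[of k \<psi>] PQ(3)[rule_format, of "swap_pair k \<psi>"]
      by (simp add: inv PQ(1,2) conic_root_swap)
    then have "2 * h \<psi> = 2 * P \<psi>" using PQ(3)[rule_format, of \<psi>] by (simp add: algebra_simps)
    then show ?thesis using two_neq_0 by simp
  qed
  then have "h = P" by auto
  then show ?case using insert PQ(1) by (simp add: C_def)
qed

end

section \<open>Half turns of tuples of skew-symmetric matrices\<close>

lemma three_less: "(0::3) < 1" "(0::3) < 2" "(1::3) < 2"
  by (simp_all add: less_bit1_def bit1.Rep_0 bit1.Rep_1 bit1.Rep_numeral)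

lemma three_cases: fixes x :: 3 obtains "x = 0" | "x = 1" | "x = 2"
  using exhaust_3[of x] by auto

lemma three_neq: "(0::3) \<noteq> 1" "(0::3) \<noteq> 2" "(1::3) \<noteq> 2" "(1::3) \<noteq> 0" "(2::3) \<noteq> 0" "(2::3) \<noteq> 1"
  using three_less by (metis less_irrefl)+

lemma three_less_iff: "(i::3) < j \<longleftrightarrow> (i, j) \<in> {(0, 1), (0, 2), (1, 2)}"
  using three_less by (cases i rule: three_cases; cases j rule: three_cases) (auto simp: three_neq)

definition entries :: "nat \<Rightarrow> (3 var \<Rightarrow> 'k) \<Rightarrow> 'k vec3" where
  "entries k \<phi> = (\<phi> (0, 1, k), \<phi> (0, 2, k), \<phi> (1, 2, k))"

text \<open>Positions other than the three above the diagonal are filled with 0; functions fixed by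
  \<open>restrict_vars d\<close> do not depend on them.\<close>

definition of_entries :: "(nat \<Rightarrow> 'k::zero vec3) \<Rightarrow> (3 var \<Rightarrow> 'k)" where
  "of_entries v = (\<lambda>(i, j, k). if (i, j) = (0, 1) then fst (v k)
     else if (i, j) = (0, 2) then fst (snd (v k))
     else if (i, j) = (1, 2) then snd (snd (v k)) else 0)"

lemma entries_of_entries [simp]: "entries k (of_entries v) = v k"
  by (simp add: entries_def of_entries_def three_neq)

definition restrict_vars :: "nat \<Rightarrow> (3 var \<Rightarrow> 'k::zero) \<Rightarrow> (3 var \<Rightarrow> 'k)" where
  "restrict_vars d \<phi> = (\<lambda>v. if v \<in> variables d then \<phi> v else 0)"

lemma restrict_vars_of_entries:
  "restrict_vars d (of_entries (\<lambda>k. entries k \<phi>)) = restrict_vars d \<phi>"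
  by (auto simp: fun_eq_iff restrict_vars_def variables_def of_entries_def entries_def three_less_iff three_neq)

text \<open>Only meaningful for \<open>dot3 u u \<noteq> 0\<close>: otherwise all entries are divided by 0.\<close>

definition half_turn :: "'k::field vec3 \<Rightarrow> (3 var \<Rightarrow> 'k) \<Rightarrow> (3 var \<Rightarrow> 'k)" where
  "half_turn u \<phi> = (\<lambda>v. of_entries (\<lambda>k. scale3 (2 * dot3 u (entries k \<phi>)) u
     + scale3 (- dot3 u u) (entries k \<phi>)) v / dot3 u u)"

definition layer :: "nat \<Rightarrow> 3 var set" where
  "layer k = {(i, j, l). l = k}"

text \<open>Half turns are rational in the axis and the point; multiplying by a power of the common
  denominator makes the composition polynomial again.\<close>

lemma polyfun_clear_denominators:
  assumes "f \<in> polyfun" "n \<in> falg D" "\<And>v. a v \<in> falg D"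
  shows "\<exists>m. \<exists>p \<in> falg D. \<forall>x. n x \<noteq> 0 \<longrightarrow> p x = n x ^ m * f (\<lambda>v. a v x / n x)"
  using assms(1)
proof induction
  case (const c)
  show ?case by (intro exI[of _ 0] bexI[OF _ falg.const[of c]]) simp
next
  case (gen f)
  then obtain v where "f = (\<lambda>\<phi>. \<phi> v)" by blast
  then show ?case by (intro exI[of _ 1] bexI[OF _ assms(3)[of v]]) simp
next
  case (add f g)
  then obtain m p m' p' where *: "p \<in> falg D" "\<forall>x. n x \<noteq> 0 \<longrightarrow> p x = n x ^ m * f (\<lambda>v. a v x / n x)"
    "p' \<in> falg D" "\<forall>x. n x \<noteq> 0 \<longrightarrow> p' x = n x ^ m' * g (\<lambda>v. a v x / n x)" by blast
  have "(\<lambda>x. n x ^ m' * p x + n x ^ m * p' x) \<in> falg D"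
    using * assms(2) by (intro falg.add falg.mult falg_power)
  then show ?case
    by (intro exI[of _ "m + m'"] bexI[of _ "\<lambda>x. n x ^ m' * p x + n x ^ m * p' x"])
      (simp_all add: * power_add algebra_simps)
next
  case (mult f g)
  then obtain m p m' p' where *: "p \<in> falg D" "\<forall>x. n x \<noteq> 0 \<longrightarrow> p x = n x ^ m * f (\<lambda>v. a v x / n x)"
    "p' \<in> falg D" "\<forall>x. n x \<noteq> 0 \<longrightarrow> p' x = n x ^ m' * g (\<lambda>v. a v x / n x)" by blast
  show ?case
    by (intro exI[of _ "m + m'"] bexI[OF _ falg.mult[OF *(1,3)]])
      (simp add: * power_add algebra_simps)
qed

text \<open>With the axis and the point both variable, invariance is one polynomial identity after
  clearing denominators; it holds on the infinite grid \<open>E\<close>, hence everywhere.\<close>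

lemma half_turn_invariance_extends:
  fixes f :: "(3 var \<Rightarrow> 'k::field) \<Rightarrow> 'k"
  assumes f: "f \<in> polyfun" and E: "infinite E"
    and inv: "\<And>u\<^sub>1 u\<^sub>2 u\<^sub>3 \<phi>. u\<^sub>1 \<in> E \<Longrightarrow> u\<^sub>2 \<in> E \<Longrightarrow> u\<^sub>3 \<in> E \<Longrightarrow> (\<And>v. \<phi> v \<in> E) \<Longrightarrow>
      dot3 (u\<^sub>1, u\<^sub>2, u\<^sub>3) (u\<^sub>1, u\<^sub>2, u\<^sub>3) \<noteq> 0 \<Longrightarrow> f (half_turn (u\<^sub>1, u\<^sub>2, u\<^sub>3) \<phi>) = f \<phi>"
    and u: "dot3 u u \<noteq> 0"
  shows "f (half_turn u \<phi>) = f \<phi>"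
proof -
  define U :: "(3 + 3 var \<Rightarrow> 'k) \<Rightarrow> 'k vec3" where "U = (\<lambda>\<theta>. (\<theta> (Inl 0), \<theta> (Inl 1), \<theta> (Inl 2)))"
  define Y :: "(3 + 3 var \<Rightarrow> 'k) \<Rightarrow> (3 var \<Rightarrow> 'k)" where "Y = (\<lambda>\<theta> v. \<theta> (Inr v))"
  define n where "n = (\<lambda>\<theta>. dot3 (U \<theta>) (U \<theta>))"
  define a where "a = (\<lambda>v \<theta>. of_entries (\<lambda>k. scale3 (2 * dot3 (U \<theta>) (entries k (Y \<theta>))) (U \<theta>)
     + scale3 (- dot3 (U \<theta>) (U \<theta>)) (entries k (Y \<theta>))) v)"
  have n: "n \<in> polyfun"
    unfolding n_def U_def dot3.simps by (intro polyfun_intros)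
  have a: "a v \<in> polyfun" for v
  proof (cases v)
    case (fields i j k)
    show ?thesis
      unfolding a_def U_def Y_def entries_def dot3.simps scale3.simps add_Pair of_entries_def fields
        case_prod_conv fst_conv snd_conv
      by (cases "(i, j) = (0, 1)"; cases "(i, j) = (0, 2)"; cases "(i, j) = (1, 2)";
          simp only: if_True if_False simp_thms; intro polyfun_intros)
  qed
  have half: "half_turn (U \<theta>) (Y \<theta>) = (\<lambda>v. a v \<theta> / n \<theta>)" for \<theta>
    by (simp add: half_turn_def a_def n_def)
  obtain m p where p: "p \<in> polyfun" "\<forall>\<theta>. n \<theta> \<noteq> 0 \<longrightarrow> p \<theta> = n \<theta> ^ m * f (half_turn (U \<theta>) (Y \<theta>))"
    using polyfun_clear_denominators[where a = a, OF f n a] unfolding half by blast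
  have fY: "(\<lambda>\<theta>. f (Y \<theta>)) \<in> polyfun"
    by (rule polyfun_subst[OF f]) (simp add: Y_def)
  \<comment> \<open>The additional factor \<open>n \<theta>\<close> makes \<open>r\<close> vanish
    also at isotropic axes, where the invariance says nothing.\<close>
  define r where "r = (\<lambda>\<theta>. n \<theta> * (p \<theta> - n \<theta> ^ m * f (Y \<theta>)))"
  have r: "r \<in> polyfun"
    unfolding r_def by (intro falg.mult falg_diff falg_power n p fY)
  have r0: "r \<theta> = 0" for \<theta>
  proof (rule polyfun_vanish_grid[OF r E])
    fix \<theta> :: "3 + 3 var \<Rightarrow> 'k" assume \<theta>: "\<And>v. \<theta> v \<in> E"
    show "r \<theta> = 0"
    proof (cases "n \<theta> = 0")
      case False
      then have "f (half_turn (U \<theta>) (Y \<theta>)) = f (Y \<theta>)"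
        using inv[OF \<theta> \<theta> \<theta>, of "Y \<theta>" "Inl 0" "Inl 1" "Inl 2"] \<theta>
        by (simp add: U_def n_def Y_def del: dot3.simps)
      then show ?thesis using p(2) False by (simp add: r_def)
    qed (simp add: r_def)
  qed
  obtain u\<^sub>1 u\<^sub>2 u\<^sub>3 where u': "u = (u\<^sub>1, u\<^sub>2, u\<^sub>3)" by (cases u)
  define \<theta> :: "3 + 3 var \<Rightarrow> 'k" where "\<theta> = (\<lambda>v. case v of Inl i \<Rightarrow> if i = 0 then u\<^sub>1 else if i = 1 then u\<^sub>2 else u\<^sub>3 | Inr v \<Rightarrow> \<phi> v)"
  have "U \<theta> = u" "Y \<theta> = \<phi>" by (auto simp: \<theta>_def U_def Y_def u' three_neq)
  then show ?thesis
    using r0[of \<theta>] p(2)[rule_format, of \<theta>] u by (simp add: r_def n_def)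
qed

section \<open>Pulling invariants back to pairs of plane vectors\<close>

context field_with_i
begin

definition conic_point :: "((nat \<times> bool) \<times> bool \<Rightarrow> 'k) \<Rightarrow> (3 var \<Rightarrow> 'k)" where
  "conic_point \<psi> = of_entries (\<lambda>k. conic_vec k \<psi>)"

lemma conic_point_polyfun: "(\<lambda>\<psi>. conic_point \<psi> v) \<in> polyfun"
proof (cases v)
  case (fields i j k)
  show ?thesis
    unfolding conic_point_def of_entries_def conic_vec_def vec2_def conic.simps fields
        case_prod_conv fst_conv snd_conv
    by (cases "(i, j) = (0, 1)"; cases "(i, j) = (0, 2)"; cases "(i, j) = (1, 2)";
        simp only: if_True if_False simp_thms; intro polyfun_intros)
qed

text \<open>The axis \<open>u\<close> is chosen so that \<open>pauli 0 u\<close> is twice the matrix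
  with rows \<open>(\<alpha>, \<beta>)\<close> and \<open>(\<gamma>, - \<alpha>)\<close>; this
  matrix then induces the half turn about \<open>u\<close>.\<close>

lemma conic_half_turn:
  fixes \<alpha> \<beta> \<gamma> :: 'k
  defines "u \<equiv> (\<beta> + \<gamma>, \<iota> * (\<beta> - \<gamma>), 2 * \<alpha>)"
  assumes d: "- (\<alpha> * \<alpha>) - \<beta> * \<gamma> = 1"
  shows "dot3 u u = - 4"
    and "scale3 (- 4) (conic (\<alpha> * p\<^sub>1 + \<beta> * p\<^sub>2, \<gamma> * p\<^sub>1 - \<alpha> * p\<^sub>2) (\<alpha> * q\<^sub>1 + \<beta> * q\<^sub>2, \<gamma> * q\<^sub>1 - \<alpha> * q\<^sub>2)) =
      scale3 (2 * dot3 u (conic (p\<^sub>1, p\<^sub>2) (q\<^sub>1, q\<^sub>2))) u + scale3 4 (conic (p\<^sub>1, p\<^sub>2) (q\<^sub>1, q\<^sub>2))"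
proof -
  have "dot3 u u = 4 * (\<alpha> * \<alpha> + \<beta> * \<gamma>)"
    by (simp add: u_def algebra_simps i_squared i_squared')
  also have "\<alpha> * \<alpha> + \<beta> * \<gamma> = - (- (\<alpha> * \<alpha>) - \<beta> * \<gamma>)" by simp
  also note d
  finally show "dot3 u u = - 4" by simp
  have "scale3 (- 4) (conic (\<alpha> * p\<^sub>1 + \<beta> * p\<^sub>2, \<gamma> * p\<^sub>1 - \<alpha> * p\<^sub>2) (\<alpha> * q\<^sub>1 + \<beta> * q\<^sub>2, \<gamma> * q\<^sub>1 - \<alpha> * q\<^sub>2)) =
      scale3 (2 * dot3 u (conic (p\<^sub>1, p\<^sub>2) (q\<^sub>1, q\<^sub>2))) u
      + scale3 (4 * (- (\<alpha> * \<alpha>) - \<beta> * \<gamma>)) (conic (p\<^sub>1, p\<^sub>2) (q\<^sub>1, q\<^sub>2))"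
    by (simp add: u_def algebra_simps i_squared i_squared')
  then show "scale3 (- 4) (conic (\<alpha> * p\<^sub>1 + \<beta> * p\<^sub>2, \<gamma> * p\<^sub>1 - \<alpha> * p\<^sub>2) (\<alpha> * q\<^sub>1 + \<beta> * q\<^sub>2, \<gamma> * q\<^sub>1 - \<alpha> * q\<^sub>2)) =
      scale3 (2 * dot3 u (conic (p\<^sub>1, p\<^sub>2) (q\<^sub>1, q\<^sub>2))) u + scale3 4 (conic (p\<^sub>1, p\<^sub>2) (q\<^sub>1, q\<^sub>2))"
    unfolding d by simp
qed

lemma four_neq_0: "(4::'k) \<noteq> 0"
proof -
  have "(4::'k) = 2 * 2" by simp
  then show ?thesis using two_neq_0 by (metis mult_eq_0_iff)
qed

lemma of_entries_divide: "(\<lambda>v. of_entries w v / c) = of_entries (\<lambda>k. scale3 (1 / c) (w k))"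
  for c :: 'k
proof (rule ext)
  fix v :: "3 var"
  obtain i j k where v: "v = (i, j, k)" by (cases v)
  obtain x y z where "w k = (x, y, z)" by (cases "w k")
  then show "of_entries w v / c = of_entries (\<lambda>k. scale3 (1 / c) (w k)) v"
    by (simp add: v of_entries_def)
qed

lemma conic_point_act2:
  assumes d: "- (\<alpha> * \<alpha>) - \<beta> * \<gamma> = 1"
  shows "conic_point (act2 \<alpha> \<beta> \<gamma> \<psi>) = half_turn (\<beta> + \<gamma>, \<iota> * (\<beta> - \<gamma>), 2 * \<alpha>) (conic_point \<psi>)"
proof -
  let ?u = "(\<beta> + \<gamma>, \<iota> * (\<beta> - \<gamma>), 2 * \<alpha>)"
  have "conic_vec k (act2 \<alpha> \<beta> \<gamma> \<psi>) = scale3 (1 / dot3 ?u ?u)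
      (scale3 (2 * dot3 ?u (conic_vec k \<psi>)) ?u + scale3 (- dot3 ?u ?u) (conic_vec k \<psi>))" for k
  proof -
    have inv4: "scale3 (1 / - 4) (scale3 (- 4) w) = w" for w :: "'k vec3"
      using four_neq_0 by (cases w) simp
    show ?thesis
      unfolding conic_half_turn(1)[OF d] minus_minus conic_vec_def vec2_def
        conic_half_turn(2)[OF d, symmetric] inv4
      by (simp add: act2_def del: conic.simps)
  qed
  then show ?thesis
    unfolding half_turn_def of_entries_divide conic_point_def entries_of_entries by simp
qed

text \<open>Binary quadratic forms split into linear factors once quadratic equations are
  solvable.\<close>

lemma conic_surj:
  assumes roots: "\<And>b c::'k. \<exists>x. x * x + b * x + c = 0"
  shows "\<exists>a b. conic a b = v"
proof -
  obtain x y z where v: "v = (x, y, z)" by (cases v)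
  \<comment> \<open>The form with conic coordinates \<open>v\<close> is
    \<open>p X^2 - z X Y + q Y^2\<close>.\<close>
  define p q where "p = (x - \<iota> * y) / 2" and "q = (- x - \<iota> * y) / 2"
  have "p - q = (2 * x) / 2" unfolding p_def q_def by (simp add: diff_divide_distrib[symmetric])
  then have pq: "p - q = x" using two_neq_0 by simp
  have "\<iota> * (p + q) = (2 * y) / 2" unfolding p_def q_def
    by (simp add: add_divide_distrib[symmetric] i_squared' algebra_simps)
  then have pq': "\<iota> * (p + q) = y" using two_neq_0 by simp
  have "\<exists>a\<^sub>1 a\<^sub>2 b\<^sub>1 b\<^sub>2. a\<^sub>1 * b\<^sub>1 = p \<and> a\<^sub>2 * b\<^sub>2 = q \<and> a\<^sub>1 * b\<^sub>2 + a\<^sub>2 * b\<^sub>1 = - z"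
  proof (cases "p = 0")
    case True
    then show ?thesis
      by (intro exI[of _ 0] exI[of _ 1] exI[of _ "- z"] exI[of _ q]) simp
  next
    case False
    \<comment> \<open>For a root \<open>x\<close> of the dehomogenized form, \<open>X - x Y\<close>
      is a linear factor; in the case \<open>p = 0\<close> the factor is \<open>Y\<close>.\<close>
    obtain x where x: "x * x + (- z / p) * x + q / p = 0" using roots by blast
    have "p * (x * x + (- z / p) * x + q / p) = p * x * x - z * x + q"
      using False by (simp add: algebra_simps)
    then have "p * x * x - z * x + q = 0" unfolding x by simp
    moreover have "- x * (- z + p * x) = q - (p * x * x - z * x + q)" by (simp add: algebra_simps)
    ultimately have "- x * (- z + p * x) = q" by simp
    then show ?thesis
      by (intro exI[of _ 1] exI[of _ "- x"] exI[of _ p] exI[of _ "- z + p * x"]) (simp add: algebra_simps)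
  qed
  then obtain a\<^sub>1 a\<^sub>2 b\<^sub>1 b\<^sub>2 where *: "a\<^sub>1 * b\<^sub>1 = p" "a\<^sub>2 * b\<^sub>2 = q" "a\<^sub>1 * b\<^sub>2 + a\<^sub>2 * b\<^sub>1 = - z" by blast
  have "conic (a\<^sub>1, a\<^sub>2) (b\<^sub>1, b\<^sub>2) = v"
    using pq pq' by (simp add: * v)
  then show ?thesis by blast
qed

lemma conic_point_surj:
  assumes roots: "\<And>b c::'k. \<exists>x. x * x + b * x + c = 0"
  shows "\<exists>\<psi>. conic_point \<psi> = of_entries v"
proof -
  have "\<forall>k. \<exists>a b. conic a b = v k" using conic_surj[OF roots] by blast
  then obtain a b where ab: "\<And>k. conic (a k) (b k) = v k" by metis
  define \<psi> where "\<psi> = (\<lambda>((k, c), e). let p = (if c then b k else a k) in if e then snd p else fst p)"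
  have "conic_vec k \<psi> = v k" for k
    using ab[of k] by (simp add: conic_vec_def vec2_def \<psi>_def Let_def)
  then have "conic_point \<psi> = of_entries v" by (simp add: conic_point_def)
  then show ?thesis by blast
qed

lemma falg_conic_point:
  assumes "h \<in> falg (basic_invariants I conic_vec)"
  shows "\<exists>p \<in> falg (basic_invariants I entries). \<forall>\<psi>. h \<psi> = p (conic_point \<psi>)"
  using assms
proof induction
  case (const c)
  show ?case by (intro bexI[OF _ falg.const[of c]]) simp
next
  case (gen f)
  have e: "entries k (conic_point \<psi>) = conic_vec k \<psi>" for k \<psi> by (simp add: conic_point_def)
  from gen consider k l where "k \<in> I" "l \<in> I" "f = (\<lambda>\<phi>. dot3 (conic_vec k \<phi>) (conic_vec l \<phi>))"
    | j k l where "j \<in> I" "k \<in> I" "l \<in> I"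
      "f = (\<lambda>\<phi>. dot3 (conic_vec j \<phi>) (vprod (conic_vec k \<phi>) (conic_vec l \<phi>)))"
    unfolding basic_invariants_def by blast
  then show ?case
  proof cases
    case 1
    then show ?thesis
      by (intro bexI[OF _ falg.gen[OF basic_invariants_dot[OF 1(1,2)]]]) (simp add: e)
  next
    case 2
    then show ?thesis
      by (intro bexI[OF _ falg.gen[OF basic_invariants_triple[OF 2(1-3)]]]) (simp add: e)
  qed
next
  case (add f g)
  then obtain p q where *: "p \<in> falg (basic_invariants I entries)" "\<forall>\<psi>. f \<psi> = p (conic_point \<psi>)"
    "q \<in> falg (basic_invariants I entries)" "\<forall>\<psi>. g \<psi> = q (conic_point \<psi>)" by blast
  show ?case by (intro bexI[OF _ falg.add[OF *(1,3)]]) (simp add: *)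
next
  case (mult f g)
  then obtain p q where *: "p \<in> falg (basic_invariants I entries)" "\<forall>\<psi>. f \<psi> = p (conic_point \<psi>)"
    "q \<in> falg (basic_invariants I entries)" "\<forall>\<psi>. g \<psi> = q (conic_point \<psi>)" by blast
  show ?case by (intro bexI[OF _ falg.mult[OF *(1,3)]]) (simp add: *)
qed

lemma falg_entries_cong:
  assumes "p \<in> falg (basic_invariants I entries)" "\<And>k. entries k \<phi> = entries k \<phi>'"
  shows "p \<phi> = p \<phi>'"
  using assms(1) by induction (auto simp: basic_invariants_def assms(2))

text \<open>Scaling either factor scales the vector itself, so a pulled back homogeneous function
  has the same degree in both factors. This is the balance that the contraction requires.\<close>

lemma conic_point_scale:
  "conic_point (scale_on ({(k, b)} \<times> UNIV) s \<psi>) = scale_on (layer k) s (conic_point \<psi>)"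
proof -
  have vec: "conic_vec l (scale_on ({(k, b)} \<times> UNIV) s \<psi>)
      = (if l = k then scale3 s (conic_vec l \<psi>) else conic_vec l \<psi>)" for l
    by (cases b) (auto simp: conic_vec_def vec2_def scale_on_def algebra_simps)
  have "conic_point (scale_on ({(k, b)} \<times> UNIV) s \<psi>) (i, j, l) = scale_on (layer k) s (conic_point \<psi>) (i, j, l)" for i j l
    unfolding conic_point_def vec of_entries_def unfolding scale_on_def layer_def
    by (cases "conic_vec l \<psi>") (auto simp: three_neq)
  then show ?thesis by auto
qed

lemma multihomogeneous_invariant_in_falg:
  fixes f :: "(3 var \<Rightarrow> 'k) \<Rightarrow> 'k"
  assumes roots: "\<And>b c::'k. \<exists>x. x * x + b * x + c = 0"
    and f: "f \<in> polyfun" and supp: "\<And>\<phi>. f (restrict_vars d \<phi>) = f \<phi>"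
    and inv: "\<And>u \<phi>. dot3 u u \<noteq> 0 \<Longrightarrow> f (half_turn u \<phi>) = f \<phi>"
    and hom: "\<And>k. k \<in> {1..d} \<Longrightarrow> homog_on (layer k) (m k) f"
  shows "f \<in> falg (basic_invariants {1..d} entries)"
proof -
  define h where "h = (\<lambda>\<psi>. f (conic_point \<psi>))"
  \<comment> \<open>Both factors of the \<open>k\<close>-th vector occur with the degree
    \<open>m k\<close> of \<open>f\<close> in that vector.\<close>
  define \<delta> where "\<delta> = (\<Sum>k\<in>{1..d}. replicate_mset (m k) (k, False) + replicate_mset (m k) (k, True))"
  have cnt: "count \<delta> (k, b) = (if k \<in> {1..d} then m k else 0)" for k b
  proof -
    have "count \<delta> (k, b) = (\<Sum>l\<in>{1..d}. if l = k then m k else 0)"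
      unfolding \<delta>_def count_sum by (intro sum.cong) (cases b; auto)+
    then show ?thesis by (simp add: sum.delta)
  qed
  have "h \<in> bracket_span \<delta>"
  proof (rule first_fundamental_theorem_SL2[OF infinite_field])
    show "h \<in> polyfun"
      unfolding h_def by (rule polyfun_subst[OF f conic_point_polyfun])
    show "half_turn_invariant h"
      unfolding half_turn_invariant_def
    proof (intro allI impI)
      fix \<alpha> \<beta> \<gamma> :: 'k and \<psi> :: "(nat \<times> bool) \<times> bool \<Rightarrow> 'k"
      assume d: "- (\<alpha> * \<alpha>) - \<beta> * \<gamma> = 1"
      show "h (act2 \<alpha> \<beta> \<gamma> \<psi>) = h \<psi>"
        unfolding h_def conic_point_act2[OF d]
        by (rule inv) (use conic_half_turn(1)[OF d] four_neq_0 in simp)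
    qed
    show "vec_homog l (count \<delta> l) h" for l
    proof (cases l)
      case (Pair k b)
      show ?thesis
      proof (cases "k \<in> {1..d}")
        case True
        then show ?thesis
          using hom[OF True] cnt[of k b] by (simp add: Pair homog_on_def h_def conic_point_scale)
      next
        case False
        have "f (scale_on (layer k) s \<phi>) = f \<phi>" for s \<phi>
        proof -
          have "restrict_vars d (scale_on (layer k) s \<phi>) = restrict_vars d \<phi>"
            using False by (auto simp: restrict_vars_def scale_on_def layer_def variables_def)
          then show ?thesis by (metis supp)
        qed
        moreover have "count \<delta> (k, b) = 0" using False by (simp only: cnt if_False)
        ultimately show ?thesis by (simp add: Pair homog_on_def h_def conic_point_scale)
      qed
    qed
  qed
  then have "h \<in> conic_ring {1..d}"
  proof (rule bracket_span_balanced)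
    show "fst ` set_mset \<delta> \<subseteq> {1..d}"
      using cnt by (force simp: count_greater_zero_iff[symmetric] split: if_splits)
  qed (simp add: cnt)
  then have "h \<in> falg (basic_invariants {1..d} conic_vec)"
    unfolding conic_ring_def
    by (rule conic_ring_swap_invariant[OF finite_atLeastAtMost order_refl]) (simp add: h_def conic_point_def)
  then obtain p where p: "p \<in> falg (basic_invariants {1..d} entries)" "\<forall>\<psi>. h \<psi> = p (conic_point \<psi>)"
    using falg_conic_point by blast
  \<comment> \<open>The equality after pulling back descends because every tuple of vectors comes
    from a \<open>conic_point\<close>.\<close>
  have "f \<phi> = p \<phi>" for \<phi>
  proof -
    obtain \<psi> where \<psi>: "conic_point \<psi> = of_entries (\<lambda>k. entries k \<phi>)"
      using conic_point_surj[OF roots] by blast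
    have "f \<phi> = f (of_entries (\<lambda>k. entries k \<phi>))"
      by (metis supp restrict_vars_of_entries)
    also have "\<dots> = p (of_entries (\<lambda>k. entries k \<phi>))"
      using p(2)[rule_format, of \<psi>] by (simp add: h_def \<psi>)
    also have "\<dots> = p \<phi>" by (rule falg_entries_cong[OF p(1)]) simp
    finally show ?thesis .
  qed
  then have "f = p" by auto
  then show ?thesis using p(1) by simp
qed

lemma half_turn_scale_layer: "half_turn u (scale_on (layer k) s \<phi>) = scale_on (layer k) s (half_turn u \<phi>)"
proof -
  have e: "entries l (scale_on (layer k) s \<phi>) = (if l = k then scale3 s (entries l \<phi>) else entries l \<phi>)" for l
    by (simp add: entries_def scale_on_def layer_def)
  have "half_turn u (scale_on (layer k) s \<phi>) (i, j, l) = scale_on (layer k) s (half_turn u \<phi>) (i, j, l)" for i j l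
    unfolding half_turn_def e of_entries_def unfolding scale_on_def layer_def
    by (cases "entries l \<phi>"; cases u) (auto simp: three_neq algebra_simps)
  then show ?thesis by auto
qed

theorem invariant_in_falg:
  fixes f :: "(3 var \<Rightarrow> 'k) \<Rightarrow> 'k"
  assumes roots: "\<And>b c::'k. \<exists>x. x * x + b * x + c = 0"
    and "f \<in> polyfun" and "\<And>\<phi>. f (restrict_vars d \<phi>) = f \<phi>"
    and "\<And>u \<phi>. dot3 u u \<noteq> 0 \<Longrightarrow> f (half_turn u \<phi>) = f \<phi>"
  shows "f \<in> falg (basic_invariants {1..d} entries)"
proof -
  \<comment> \<open>\<open>J\<close> holds the layers in which \<open>f\<close> need not be
    homogeneous. Splitting along one of them preserves the other assumptions: they are identities
    \<open>f (T \<phi>) = r * f \<phi>\<close> where \<open>T\<close> commutes with scaling that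
    layer.\<close>
  have "f \<in> falg (basic_invariants {1..d} entries)"
    if "finite J" "f \<in> polyfun" "\<And>\<phi>. f (restrict_vars d \<phi>) = f \<phi>"
      "\<And>u \<phi>. dot3 u u \<noteq> 0 \<Longrightarrow> f (half_turn u \<phi>) = f \<phi>"
      "\<And>k. k \<in> {1..d} - J \<Longrightarrow> homog_on (layer k) (m k) f" for J m and f :: "(3 var \<Rightarrow> 'k) \<Rightarrow> 'k"
    using that
  proof (induction J arbitrary: f m)
    case empty
    then show ?case using multihomogeneous_invariant_in_falg[OF roots, of f d m] by simp
  next
    case (insert k J)
    obtain c N where c: "\<forall>e. c e \<in> polyfun" "\<forall>\<phi>. f \<phi> = (\<Sum>e\<le>N. c e \<phi>)"
      "\<forall>e. homog_on (layer k) e (c e)"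
      "\<forall>T r. (\<forall>\<phi> s. T (scale_on (layer k) s \<phi>) = scale_on (layer k) s (T \<phi>)) \<longrightarrow>
        (\<forall>\<phi>. f (T \<phi>) = r * f \<phi>) \<longrightarrow> (\<forall>e \<phi>. c e (T \<phi>) = r * c e \<phi>)"
      using polyfun_homog_decomposition[OF infinite_field insert.prems(1), of "layer k"] by blast
    have "c e \<in> falg (basic_invariants {1..d} entries)" for e
    proof (rule insert.IH[of "c e" "m(k := e)"])
      show "c e \<in> polyfun" using c(1) by blast
      show "c e (restrict_vars d \<phi>) = c e \<phi>" for \<phi>
      proof -
        have "\<forall>\<phi> s. restrict_vars d (scale_on (layer k) s \<phi>) = scale_on (layer k) s (restrict_vars d \<phi> :: 3 var \<Rightarrow> 'k)"
          by (auto simp: restrict_vars_def scale_on_def)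
        from c(4)[rule_format, of "restrict_vars d" 1 e \<phi>] this show ?thesis
          using insert.prems(2) by simp
      qed
      show "c e (half_turn u \<phi>) = c e \<phi>" if "dot3 u u \<noteq> 0" for u \<phi>
      proof -
        have "c e (half_turn u \<phi>) = 1 * c e \<phi>"
          by (rule c(4)[rule_format, of "half_turn u" 1])
            (simp_all add: half_turn_scale_layer insert.prems(3)[OF that])
        then show ?thesis by simp
      qed
      show "homog_on (layer l) ((m(k := e)) l) (c e)" if "l \<in> {1..d} - J" for l
      proof (cases "l = k")
        case True
        then show ?thesis using c(3) by simp
      next
        case False
        then have "homog_on (layer l) (m l) f" using insert.prems(4) that by simp
        then have "c e (scale_on (layer l) s \<phi>) = s ^ m l * c e \<phi>" for s \<phi>
          by (intro c(4)[rule_format]) (simp_all add: homog_on_def scale_on_commute)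
        then show ?thesis using False by (simp add: homog_on_def)
      qed
    qed
    then have "(\<lambda>\<phi>. \<Sum>e\<le>N. c e \<phi>) \<in> falg (basic_invariants {1..d} entries)"
      by (intro falg_sum)
    moreover have "f = (\<lambda>\<phi>. \<Sum>e\<le>N. c e \<phi>)" using c(2) by auto
    ultimately show ?case by simp
  qed
  from this[of "{1..d}" f "\<lambda>_. 0"] assms(2-4) show ?thesis by simp
qed

end

section \<open>Values of formal polynomials\<close>

definition monomial_value :: "('v \<Rightarrow> 'k::comm_ring_1) \<Rightarrow> ('v \<Rightarrow>\<^sub>0 nat) \<Rightarrow> 'k" where
  "monomial_value \<phi> m = (\<Prod>v\<in>Poly_Mapping.keys m. \<phi> v ^ Poly_Mapping.lookup m v)"

lemma monomial_value_superset:
  assumes "finite S" "Poly_Mapping.keys m \<subseteq> S"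
  shows "monomial_value \<phi> m = (\<Prod>v\<in>S. \<phi> v ^ Poly_Mapping.lookup m v)"
  unfolding monomial_value_def using assms
  by (intro prod.mono_neutral_left) (auto simp: in_keys_iff)

lemma monomial_value_add: "monomial_value \<phi> (m + m') = monomial_value \<phi> m * monomial_value \<phi> m'"
proof -
  let ?S = "Poly_Mapping.keys m \<union> Poly_Mapping.keys m'"
  have "monomial_value \<phi> (m + m') = (\<Prod>v\<in>?S. \<phi> v ^ Poly_Mapping.lookup (m + m') v)"
    using Poly_Mapping.keys_add[of m m'] by (intro monomial_value_superset) auto
  also have "\<dots> = (\<Prod>v\<in>?S. \<phi> v ^ Poly_Mapping.lookup m v) * (\<Prod>v\<in>?S. \<phi> v ^ Poly_Mapping.lookup m' v)"
    by (simp add: lookup_add power_add prod.distrib)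
  also have "\<dots> = monomial_value \<phi> m * monomial_value \<phi> m'"
    by (simp add: monomial_value_superset[of ?S])
  finally show ?thesis .
qed

lemma monomial_value_0 [simp]: "monomial_value \<phi> 0 = 1"
  by (simp add: monomial_value_def)

lemma monomial_value_single: "monomial_value \<phi> (Poly_Mapping.single v n) = \<phi> v ^ n"
  using monomial_value_superset[of "{v}" "Poly_Mapping.single v n" \<phi>] by simp

lemma monomial_value_mult: "monomial_value (\<lambda>v. \<phi> v * \<psi> v) m = monomial_value \<phi> m * monomial_value \<psi> m"
  by (simp add: monomial_value_def power_mult_distrib prod.distrib)

text \<open>Dedekind's argument: monomials are distinct multiplicative characters.\<close>

lemma monomials_independent:
  fixes c :: "('v \<Rightarrow>\<^sub>0 nat) \<Rightarrow> 'k::field"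
  assumes inf: "infinite (UNIV :: 'k set)" and "finite S"
    and "\<And>\<phi>. (\<Sum>m\<in>S. c m * monomial_value \<phi> m) = 0" and "m \<in> S"
  shows "c m = 0"
  using assms(2-4)
proof (induction S arbitrary: c m)
  case empty
  then show ?case by simp
next
  case (insert m\<^sub>0 S)
  have 1: "c m\<^sub>1 = 0" if m\<^sub>1: "m\<^sub>1 \<in> S" for m\<^sub>1
  proof -
    have "m\<^sub>1 \<noteq> m\<^sub>0" using m\<^sub>1 insert.hyps by blast
    then obtain v where v: "Poly_Mapping.lookup m\<^sub>1 v \<noteq> Poly_Mapping.lookup m\<^sub>0 v"
      by (meson poly_mapping_eqI)
    have "\<exists>t::'k. t ^ Poly_Mapping.lookup m\<^sub>1 v \<noteq> t ^ Poly_Mapping.lookup m\<^sub>0 v"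
    proof (rule ccontr)
      assume "\<nexists>t::'k. t ^ Poly_Mapping.lookup m\<^sub>1 v \<noteq> t ^ Poly_Mapping.lookup m\<^sub>0 v"
      then have "monom (1::'k) (Poly_Mapping.lookup m\<^sub>1 v) = monom 1 (Poly_Mapping.lookup m\<^sub>0 v)"
        by (intro poly_eq_infinite[OF inf]) (simp add: poly_monom)
      then show False using v by (simp add: monom_eq_iff')
    qed
    then obtain t :: 'k where t: "t ^ Poly_Mapping.lookup m\<^sub>1 v \<noteq> t ^ Poly_Mapping.lookup m\<^sub>0 v" by blast
    define y where "y = (\<lambda>w. if w = v then t else 1)"
    have y: "monomial_value y m = t ^ Poly_Mapping.lookup m v" for m
    proof -
      have "monomial_value y m = (\<Prod>w\<in>insert v (Poly_Mapping.keys m). y w ^ Poly_Mapping.lookup m w)"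
        by (intro monomial_value_superset) auto
      also have "\<dots> = (\<Prod>w\<in>insert v (Poly_Mapping.keys m). if w = v then t ^ Poly_Mapping.lookup m v else 1)"
        by (intro prod.cong) (auto simp: y_def)
      finally show ?thesis by (simp add: prod.delta)
    qed
    \<comment> \<open>The relation at \<open>y * \<phi>\<close> minus
      \<open>monomial_value y m\<^sub>0\<close> times the relation at \<open>\<phi>\<close>
      eliminates \<open>m\<^sub>0\<close> and keeps \<open>m\<^sub>1\<close>, because
      \<open>y\<close> separates the two.\<close>
    have "(\<Sum>m\<in>S. (c m * (monomial_value y m - monomial_value y m\<^sub>0)) * monomial_value \<phi> m) = 0" for \<phi>
    proof -
      have "c m\<^sub>0 * monomial_value \<phi> m\<^sub>0 + (\<Sum>m\<in>S. c m * monomial_value \<phi> m) = 0"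
        using insert.prems(1)[of \<phi>] insert.hyps by simp
      moreover have "c m\<^sub>0 * (monomial_value y m\<^sub>0 * monomial_value \<phi> m\<^sub>0)
          + (\<Sum>m\<in>S. c m * (monomial_value y m * monomial_value \<phi> m)) = 0"
        using insert.prems(1)[of "\<lambda>v. y v * \<phi> v"] insert.hyps by (simp add: monomial_value_mult)
      moreover have "(\<Sum>m\<in>S. (c m * (monomial_value y m - monomial_value y m\<^sub>0)) * monomial_value \<phi> m)
        = (c m\<^sub>0 * (monomial_value y m\<^sub>0 * monomial_value \<phi> m\<^sub>0)
            + (\<Sum>m\<in>S. c m * (monomial_value y m * monomial_value \<phi> m)))
          - monomial_value y m\<^sub>0 * (c m\<^sub>0 * monomial_value \<phi> m\<^sub>0 + (\<Sum>m\<in>S. c m * monomial_value \<phi> m))"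
        by (simp add: distrib_left sum_distrib_left algebra_simps sum_subtractf)
      ultimately show ?thesis by simp
    qed
    from insert.IH[OF this m\<^sub>1] have "c m\<^sub>1 * (monomial_value y m\<^sub>1 - monomial_value y m\<^sub>0) = 0" .
    then show ?thesis using t by (simp add: y)
  qed
  have "c m\<^sub>0 = 0"
    using insert.prems(1)[of "\<lambda>_. 1"] insert.hyps 1 by (simp add: monomial_value_def)
  then show ?case using 1 insert.prems(2) by blast
qed

text \<open>Polynomials over one field are evaluated at points of another; the instances are the
  identity and the embedding into the algebraic closure.\<close>

locale field_hom =
  fixes \<sigma> :: "'a::field \<Rightarrow> 'k::field"
  assumes hom_0: "\<sigma> 0 = 0" and hom_1: "\<sigma> 1 = 1"
    and hom_add: "\<sigma> (x + y) = \<sigma> x + \<sigma> y" and hom_mult: "\<sigma> (x * y) = \<sigma> x * \<sigma> y"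
begin

definition ev :: "('v \<Rightarrow> 'k) \<Rightarrow> (('v \<Rightarrow>\<^sub>0 nat) \<Rightarrow>\<^sub>0 'a) \<Rightarrow> 'k" where
  "ev \<phi> f = (\<Sum>m\<in>Poly_Mapping.keys f. \<sigma> (Poly_Mapping.lookup f m) * monomial_value \<phi> m)"

lemma ev_superset:
  assumes "finite S" "Poly_Mapping.keys f \<subseteq> S"
  shows "ev \<phi> f = (\<Sum>m\<in>S. \<sigma> (Poly_Mapping.lookup f m) * monomial_value \<phi> m)"
  unfolding ev_def using assms by (intro sum.mono_neutral_left) (auto simp: in_keys_iff hom_0)

lemma ev_add [simp]: "ev \<phi> (f + g) = ev \<phi> f + ev \<phi> g"
proof -
  let ?S = "Poly_Mapping.keys f \<union> Poly_Mapping.keys g"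
  have "ev \<phi> (f + g) = (\<Sum>m\<in>?S. \<sigma> (Poly_Mapping.lookup (f + g) m) * monomial_value \<phi> m)"
    using Poly_Mapping.keys_add[of f g] by (intro ev_superset) auto
  then show ?thesis
    by (simp add: lookup_add hom_add distrib_right sum.distrib ev_superset[of ?S])
qed

lemma ev_0 [simp]: "ev \<phi> 0 = 0"
  by (simp add: ev_def)

lemma ev_sum: "ev \<phi> (\<Sum>i\<in>I. f i) = (\<Sum>i\<in>I. ev \<phi> (f i))"
  by (induction I rule: infinite_finite_induct) auto

lemma ev_uminus [simp]: "ev \<phi> (- f) = - ev \<phi> f"
  using ev_add[of \<phi> f "- f"] by (simp add: eq_neg_iff_add_eq_0 add.commute)

lemma ev_diff [simp]: "ev \<phi> (f - g) = ev \<phi> f - ev \<phi> g"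
  using ev_add[of \<phi> f "- g"] by simp

lemma ev_single: "ev \<phi> (Poly_Mapping.single m c) = \<sigma> c * monomial_value \<phi> m"
  using ev_superset[of "{m}" "Poly_Mapping.single m c" \<phi>] by simp

lemma poly_mapping_sum_single:
  "f = (\<Sum>m\<in>Poly_Mapping.keys f. Poly_Mapping.single m (Poly_Mapping.lookup f m))"
proof (rule poly_mapping_eqI)
  fix k
  have "Poly_Mapping.lookup (\<Sum>m\<in>Poly_Mapping.keys f. Poly_Mapping.single m (Poly_Mapping.lookup f m)) k
    = (\<Sum>m\<in>Poly_Mapping.keys f. if m = k then Poly_Mapping.lookup f k else 0)"
    unfolding lookup_sum by (intro sum.cong) (auto simp: lookup_single when_def)
  then show "Poly_Mapping.lookup f k
    = Poly_Mapping.lookup (\<Sum>m\<in>Poly_Mapping.keys f. Poly_Mapping.single m (Poly_Mapping.lookup f m)) k"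
    by (auto simp: sum.delta in_keys_iff)
qed

lemma ev_mult [simp]: "ev \<phi> (f * g) = ev \<phi> f * ev \<phi> g"
proof -
  let ?l = Poly_Mapping.lookup
  have "f * g = (\<Sum>m\<in>Poly_Mapping.keys f. \<Sum>m'\<in>Poly_Mapping.keys g. Poly_Mapping.single (m + m') (?l f m * ?l g m'))"
    by (subst poly_mapping_sum_single[of f], subst poly_mapping_sum_single[of g])
      (simp add: sum_product mult_single)
  then have "ev \<phi> (f * g) = (\<Sum>m\<in>Poly_Mapping.keys f. \<Sum>m'\<in>Poly_Mapping.keys g.
      (\<sigma> (?l f m) * monomial_value \<phi> m) * (\<sigma> (?l g m') * monomial_value \<phi> m'))"
    by (simp add: ev_sum ev_single monomial_value_add hom_mult mult_ac)
  then show ?thesis by (simp add: ev_def sum_product)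
qed

lemma ev_Const [simp]: "ev \<phi> (Const c) = \<sigma> c"
  by (simp add: Const_def ev_single)

lemma ev_Var [simp]: "ev \<phi> (Var v) = \<phi> v"
  by (simp add: Var_def ev_single hom_1 monomial_value_single)

lemma ev_polyfun: "(\<lambda>\<phi>. ev \<phi> f) \<in> polyfun"
  unfolding ev_def monomial_value_def
  by (intro falg_sum falg_prod falg.mult falg.const falg_power polyfun_coord)

lemma ev_cong:
  assumes "f \<in> R_minus d" "\<And>v. v \<in> variables d \<Longrightarrow> \<phi> v = \<psi> v"
  shows "ev \<phi> f = ev \<psi> f"
  using assms unfolding ev_def monomial_value_def R_minus_def
  by (intro sum.cong refl arg_cong2[of _ _ _ _ "(*)"] prod.cong) (auto dest!: bspec)

end

interpretation id_hom: field_hom "\<lambda>x::'a::field. x"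
  by unfold_locales auto

interpretation ac_hom: field_hom "to_ac :: 'a::field \<Rightarrow> 'a alg_closure"
  by unfold_locales auto

lemma eval_at_eq_ev: "eval_at f h = id_hom.ev (\<lambda>(i, j, k). h k $ i $ j) f"
  unfolding eval_at_def id_hom.ev_def monomial_value_def
  by (intro sum.cong refl arg_cong2[of _ _ _ _ "(*)"] prod.cong) auto

lemma monomial_value_to_ac: "monomial_value (\<lambda>v. to_ac (\<phi> v)) m = to_ac (monomial_value \<phi> m)"
  by (simp add: monomial_value_def to_ac_prod)

lemma ac_hom_ev: "ac_hom.ev (\<lambda>v. to_ac (\<phi> v)) f = to_ac (id_hom.ev \<phi> f)"
  by (simp add: ac_hom.ev_def id_hom.ev_def to_ac_sum monomial_value_to_ac)

lemma ev_eq_0_imp_eq_0: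
  fixes f :: "('v \<Rightarrow>\<^sub>0 nat) \<Rightarrow>\<^sub>0 'a::field"
  assumes "infinite (UNIV :: 'a set)" "\<And>\<phi>. id_hom.ev \<phi> f = 0"
  shows "f = 0"
proof (rule poly_mapping_eqI)
  fix m
  show "Poly_Mapping.lookup f m = Poly_Mapping.lookup 0 m"
  proof (cases "m \<in> Poly_Mapping.keys f")
    case True
    have "Poly_Mapping.lookup f m = 0"
      by (rule monomials_independent[OF assms(1) finite_keys _ True])
        (use assms(2) in \<open>simp add: id_hom.ev_def\<close>)
    then show ?thesis by simp
  qed (simp add: in_keys_iff)
qed

lemma ev_inject:
  fixes f g :: "('v \<Rightarrow>\<^sub>0 nat) \<Rightarrow>\<^sub>0 'a::field"
  assumes "infinite (UNIV :: 'a set)" "\<And>\<phi>. id_hom.ev \<phi> f = id_hom.ev \<phi> g"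
  shows "f = g"
  using ev_eq_0_imp_eq_0[of "f - g"] assms by simp

lemma to_ac_inject: "to_ac x = to_ac y \<longleftrightarrow> x = y"
proof
  assume *: "to_ac x = to_ac y"
  show "x = y"
  proof (rule ccontr)
    assume "x \<noteq> y"
    then have "to_ac ((x - y) * inverse (x - y)) = 1" by simp
    moreover have "to_ac ((x - y) * inverse (x - y)) = (to_ac x - to_ac y) * to_ac (inverse (x - y))"
      by (simp only: to_ac_mult to_ac_diff)
    ultimately show False using * by simp
  qed
qed simp

text \<open>Regard the closure as a vector space over \<open>'a\<close>. The vector 1 is
  independent, so some linear functional takes it to 1.\<close>

lemma linear_retraction_to_ac:
  "\<exists>\<pi> :: 'a::field alg_closure \<Rightarrow> 'a. (\<forall>x y. \<pi> (x + y) = \<pi> x + \<pi> y) \<and>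
     (\<forall>c x. \<pi> (to_ac c * x) = c * \<pi> x) \<and> \<pi> 1 = 1"
proof -
  interpret vs: vector_space_pair "\<lambda>(c::'a) x. to_ac c * x" "(*) :: 'a \<Rightarrow> 'a \<Rightarrow> 'a"
    by unfold_locales (simp_all add: algebra_simps)
  have "vs.vs1.independent {1}"
    using vs.vs1.independent_insert[of 1 "{}"] by simp
  from vs.linear_independent_extend[OF this, of "\<lambda>_. 1"]
  obtain \<pi> where \<pi>: "Vector_Spaces.linear (\<lambda>(c::'a) x. to_ac c * x) (*) \<pi>" "\<pi> 1 = 1" by auto
  interpret l: Vector_Spaces.linear "\<lambda>(c::'a) x. to_ac c * x" "(*)" \<pi> by fact
  show ?thesis using \<pi>(2) l.add l.scale by blast
qed

section \<open>The generators in coordinates\<close>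

lemma three_eq_0: "(3::3) = 0"
  by simp

lemma generic_skew_entries:
  "generic_skew k $ 0 $ 0 = 0" "generic_skew k $ 1 $ 1 = 0" "generic_skew k $ (2::3) $ 2 = 0"
  "generic_skew k $ 0 $ (1::3) = Var (0, 1, k)" "generic_skew k $ 1 $ (0::3) = - Var (0, 1, k)"
  "generic_skew k $ 0 $ (2::3) = Var (0, 2, k)" "generic_skew k $ 2 $ (0::3) = - Var (0, 2, k)"
  "generic_skew k $ 1 $ (2::3) = Var (1, 2, k)" "generic_skew k $ 2 $ (1::3) = - Var (1, 2, k)"
  by (simp_all add: generic_skew_def three_less_iff three_neq)

text \<open>The coefficient of \<open>\<lambda>\<close> in the determinant is the sum of the
  principal minors of size 2. In \<open>det_3\<close> the index 3 is the element 0 of the type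
  \<open>3\<close>.\<close>

lemma sigma_2_three:
  fixes A :: "'r::comm_ring_1 ^ 3 ^ 3"
  defines "e \<equiv> \<lambda>i j. A $ i $ j"
  shows "sigma 2 A = e 0 0 * e 1 1 + e 0 0 * e 2 2 + e 1 1 * e 2 2
    - e 0 1 * e 1 0 - e 0 2 * e 2 0 - e 1 2 * e 2 1"
  unfolding sigma_def det_3 e_def by (simp add: mat_def three_neq three_eq_0 algebra_simps)

lemma trace_three: "trace (A :: 'r::comm_ring_1 ^ 3 ^ 3) = A $ 0 $ 0 + A $ 1 $ 1 + A $ 2 $ 2"
  by (simp add: trace_def sum_3 three_eq_0)

lemma sigma_generic_skew:
  "sigma 2 (generic_skew k :: ((3, 'a::field) polynomial ^ 3 ^ 3)) =
    Var (0, 1, k) * Var (0, 1, k) + Var (0, 2, k) * Var (0, 2, k) + Var (1, 2, k) * Var (1, 2, k)"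
  by (simp add: sigma_2_three generic_skew_entries)

text \<open>This is minus twice the dot product of the vectors of entries; likewise
  \<open>sigma 2\<close> is the dot square, and the trace of three factors is the triple
  product.\<close>

lemma trace_generic_skew_2:
  "trace (generic_skew k ** generic_skew l :: ((3, 'a::field) polynomial ^ 3 ^ 3)) =
    - (Var (0, 1, k) * Var (0, 1, l) + Var (0, 2, k) * Var (0, 2, l) + Var (1, 2, k) * Var (1, 2, l))
    - (Var (0, 1, k) * Var (0, 1, l) + Var (0, 2, k) * Var (0, 2, l) + Var (1, 2, k) * Var (1, 2, l))"
  by (simp add: trace_three matrix_matrix_mult_def sum_3 three_eq_0 generic_skew_entries algebra_simps)

lemma trace_generic_skew_3:
  "trace (generic_skew j ** generic_skew k ** generic_skew l :: ((3, 'a::field) polynomial ^ 3 ^ 3)) =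
    Var (0, 1, j) * (Var (0, 2, k) * Var (1, 2, l) - Var (1, 2, k) * Var (0, 2, l))
    + Var (0, 2, j) * (Var (1, 2, k) * Var (0, 1, l) - Var (0, 1, k) * Var (1, 2, l))
    + Var (1, 2, j) * (Var (0, 1, k) * Var (0, 2, l) - Var (0, 2, k) * Var (0, 1, l))"
  by (simp add: trace_three matrix_matrix_mult_def sum_3 three_eq_0 generic_skew_entries algebra_simps)

section \<open>Generators of the algebra of invariants\<close>

lemma R_minus_Const: "Const c \<in> R_minus d"
  by (simp add: R_minus_def Const_def)

lemma R_minus_Var: "v \<in> variables d \<Longrightarrow> Var v \<in> R_minus d"
  by (simp add: R_minus_def Var_def)

lemma R_minus_add: "f \<in> R_minus d \<Longrightarrow> g \<in> R_minus d \<Longrightarrow> f + g \<in> R_minus d"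
  using Poly_Mapping.keys_add[of f g] by (auto simp: R_minus_def)

lemma R_minus_mult: "f \<in> R_minus d \<Longrightarrow> g \<in> R_minus d \<Longrightarrow> f * g \<in> R_minus d"
  for f g :: "('n::linorder, 'a::comm_ring_1) polynomial"
proof -
  assume fg: "f \<in> R_minus d" "g \<in> R_minus d"
  have "Poly_Mapping.keys m \<subseteq> variables d" if m: "m \<in> Poly_Mapping.keys (f * g)" for m
  proof -
    obtain a b where ab: "m = a + b" "a \<in> Poly_Mapping.keys f" "b \<in> Poly_Mapping.keys g"
      using m Poly_Mapping.keys_mult[of f g] by blast
    then have "Poly_Mapping.keys a \<subseteq> variables d" "Poly_Mapping.keys b \<subseteq> variables d"
      using fg by (auto simp: R_minus_def)
    then show ?thesis using Poly_Mapping.keys_add[of a b] ab(1) by blast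
  qed
  then show ?thesis by (simp add: R_minus_def)
qed

lemma R_minus_uminus: "f \<in> R_minus d \<Longrightarrow> - f \<in> R_minus d"
  for f :: "('n::linorder, 'a::comm_ring_1) polynomial"
  by (simp add: R_minus_def)

lemma R_minus_diff: "f \<in> R_minus d \<Longrightarrow> g \<in> R_minus d \<Longrightarrow> f - g \<in> R_minus d"
  for f g :: "('n::linorder, 'a::comm_ring_1) polynomial"
  using R_minus_add[of f d "- g"] R_minus_uminus[of g d] by simp

lemma orthogonal_group_inverse:
  fixes g :: "'a::field ^ 'n ^ 'n"
  assumes "g \<in> orthogonal_group"
  shows "matrix_inv g = transpose g" "g ** transpose g = mat 1" "transpose g ** g = mat 1"
    "transpose g \<in> orthogonal_group"
proof -
  show 1: "g ** transpose g = mat 1" using assms by (simp add: orthogonal_group_def)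
  then show 2: "transpose g ** g = mat 1" by (simp add: matrix_left_right_inverse)
  then show "transpose g \<in> orthogonal_group" by (simp add: orthogonal_group_def)
  have "g ** matrix_inv g = mat 1 \<and> matrix_inv g ** g = mat 1"
    unfolding matrix_inv_def by (rule someI[of _ "transpose g"]) (use 1 2 in blast)
  then show "matrix_inv g = transpose g"
    by (metis 2 matrix_mul_assoc matrix_mul_lid matrix_mul_rid)
qed

lemma S_minus_conjugate:
  assumes "A \<in> S_minus"
  shows "transpose g ** A ** g \<in> S_minus"
proof -
  have neg: "transpose g ** (- A) ** g = - (transpose g ** A ** g)"
    by (simp add: vec_eq_iff matrix_matrix_mult_def sum_negf sum_distrib_right)
  show ?thesis
    using assms neg by (simp add: S_minus_def matrix_transpose_mul matrix_mul_assoc)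
qed

definition ev_matrix :: "('v \<Rightarrow> 'a::field) \<Rightarrow> (('v \<Rightarrow>\<^sub>0 nat) \<Rightarrow>\<^sub>0 'a) ^ 'n ^ 'n \<Rightarrow> 'a ^ 'n ^ 'n" where
  "ev_matrix \<phi> A = (\<chi> i j. id_hom.ev \<phi> (A $ i $ j))"

lemma ev_matrix_mult: "ev_matrix \<phi> (A ** B) = ev_matrix \<phi> A ** ev_matrix \<phi> B"
  by (simp add: ev_matrix_def matrix_matrix_mult_def vec_eq_iff id_hom.ev_sum)

lemma ev_trace: "id_hom.ev \<phi> (trace A) = trace (ev_matrix \<phi> A)"
  by (simp add: ev_matrix_def trace_def id_hom.ev_sum)

text \<open>As 2 is invertible, a skew-symmetric matrix has zero diagonal and is recovered from its
  entries above it.\<close>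

lemma ev_generic_skew:
  fixes h :: "nat \<Rightarrow> 'a::field ^ 3 ^ 3"
  assumes two: "(2::'a) \<noteq> 0" and h: "h \<in> V_minus d" and k: "k \<in> {1..d}"
  shows "ev_matrix (\<lambda>(i, j, k). h k $ i $ j) (generic_skew k) = h k"
proof -
  have "transpose (h k) = - h k"
    using h k by (auto simp: V_minus_def S_minus_def)
  then have skew: "h k $ j $ i = - (h k $ i $ j)" for i j
  proof -
    have "transpose (h k) $ i $ j = (- h k) $ i $ j" using \<open>transpose (h k) = - h k\<close> by simp
    then show ?thesis by (simp add: transpose_def)
  qed
  have "h k $ i $ i = 0" for i
  proof -
    have "h k $ i $ i + h k $ i $ i = 0" using skew[of i i] by (simp add: eq_neg_iff_add_eq_0)
    then have "2 * (h k $ i $ i) = 0" by (simp only: mult_2)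
    then show ?thesis using two by simp
  qed
  then have "id_hom.ev (\<lambda>(i, j, k). h k $ i $ j) (generic_skew k $ i $ j) = h k $ i $ j" for i j
    by (cases i j rule: linorder_cases) (simp_all add: generic_skew_def skew[of i j])
  then show ?thesis by (simp add: vec_eq_iff ev_matrix_def)
qed

lemma conjugate_mult:
  fixes g :: "'a::field ^ 'n ^ 'n"
  assumes "g ** transpose g = mat 1"
  shows "(transpose g ** A ** g) ** (transpose g ** B ** g) = transpose g ** (A ** B) ** g"
proof -
  have "(transpose g ** A ** g) ** (transpose g ** B ** g) = transpose g ** A ** (g ** transpose g) ** B ** g"
    by (simp only: matrix_mul_assoc)
  then show ?thesis using assms by (simp add: matrix_mul_assoc)
qed

lemma trace_conjugate:
  fixes g :: "'a::field ^ 'n ^ 'n"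
  assumes "g ** transpose g = mat 1"
  shows "trace (transpose g ** A ** g) = trace A"
proof -
  have "trace (transpose g ** A ** g) = trace (g ** (transpose g ** A))"
    by (rule trace_mul_sym)
  then show ?thesis using assms by (simp add: matrix_mul_assoc)
qed

abbreviation (input) skew_generators :: "nat \<Rightarrow> (3, 'a::field) polynomial set" where
  "skew_generators d \<equiv> {sigma 2 (generic_skew i) | i. 1 \<le> i \<and> i \<le> d} \<union>
     {trace (generic_skew i ** generic_skew j) | i j. 1 \<le> i \<and> i < j \<and> j \<le> d} \<union>
     {trace (generic_skew i ** generic_skew j ** generic_skew k) | i j k.
        1 \<le> i \<and> i < j \<and> j < k \<and> k \<le> d}"

lemma invariants_eqI:
  fixes f :: "(3, 'a::field) polynomial"
  assumes "f \<in> R_minus d"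
    and "\<And>g h. g ** transpose g = mat 1 \<Longrightarrow> h \<in> V_minus d \<Longrightarrow>
      (\<lambda>k\<in>{1..d}. transpose g ** h k ** g) \<in> V_minus d \<Longrightarrow>
      eval_at f (\<lambda>k\<in>{1..d}. transpose g ** h k ** g) = eval_at f h"
  shows "f \<in> invariants d"
proof -
  have "act_fun d g (eval_at f) h = eval_at f h" if g: "g \<in> orthogonal_group" and h: "h \<in> V_minus d" for g h
  proof -
    note o = orthogonal_group_inverse[OF g] and o' = orthogonal_group_inverse[OF orthogonal_group_inverse(4)[OF g]]
    have "act_V d (matrix_inv g) h = (\<lambda>k\<in>{1..d}. transpose g ** h k ** g)"
      unfolding act_V_def o(1) o'(1) by simp
    moreover have "(\<lambda>k\<in>{1..d}. transpose g ** h k ** g) \<in> V_minus d"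
      using h by (auto simp: V_minus_def intro!: S_minus_conjugate)
    ultimately show ?thesis
      using assms(2)[OF o(2) h] by (simp add: act_fun_def)
  qed
  then show ?thesis using assms(1) by (simp add: invariants_def)
qed

lemma skew_generators_R_minus: "skew_generators d \<subseteq> (R_minus d :: (3, 'a::field) polynomial set)"
proof -
  have V: "Var (0, 1, k) \<in> (R_minus d :: (3, 'a) polynomial set)"
    "Var (0, 2, k) \<in> (R_minus d :: (3, 'a) polynomial set)"
    "Var (1, 2, k) \<in> (R_minus d :: (3, 'a) polynomial set)" if "1 \<le> k" "k \<le> d" for k
    using that three_less by (auto intro!: R_minus_Var simp: variables_def)
  show ?thesis
  proof (intro Un_least subsetI; elim CollectE exE conjE)
    show "f \<in> R_minus d" if "f = sigma 2 (generic_skew i)" "1 \<le> i" "i \<le> d" for i and f :: "(3, 'a) polynomial"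
      unfolding that(1) sigma_generic_skew using that by (intro R_minus_add R_minus_mult V)
    show "f \<in> R_minus d" if "f = trace (generic_skew i ** generic_skew j)" "1 \<le> i" "i < j" "j \<le> d"
      for i j and f :: "(3, 'a) polynomial"
      unfolding that(1) trace_generic_skew_2
      using that by (intro R_minus_add R_minus_diff R_minus_uminus R_minus_mult V) auto
    show "f \<in> R_minus d" if "f = trace (generic_skew i ** generic_skew j ** generic_skew k)"
      "1 \<le> i" "i < j" "j < k" "k \<le> d" for i j k and f :: "(3, 'a) polynomial"
      unfolding that(1) trace_generic_skew_3
      using that by (intro R_minus_add R_minus_diff R_minus_mult V) auto
  qed
qed

lemma skew_generators_invariant:
  assumes two: "(2::'a::field) \<noteq> 0"
  shows "skew_generators d \<subseteq> (invariants d :: (3, 'a) polynomial set)"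
proof
  fix f :: "(3, 'a) polynomial"
  assume f: "f \<in> skew_generators d"
  show "f \<in> invariants d"
  proof (rule invariants_eqI)
    show "f \<in> R_minus d" using f skew_generators_R_minus by blast
    fix g :: "'a ^ 3 ^ 3" and h
    assume g: "g ** transpose g = mat 1" and h: "h \<in> V_minus d"
      and h': "(\<lambda>k\<in>{1..d}. transpose g ** h k ** g) \<in> V_minus d"
    let ?h = "\<lambda>k\<in>{1..d}. transpose g ** h k ** g"
    have tr2: "eval_at (trace (generic_skew i ** generic_skew j)) h = trace (h i ** h j)"
      if "h \<in> V_minus d" "i \<in> {1..d}" "j \<in> {1..d}" for h :: "nat \<Rightarrow> 'a ^ 3 ^ 3" and i j
      using that by (simp only: eval_at_eq_ev ev_trace ev_matrix_mult ev_generic_skew[OF two])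
    have tr3: "eval_at (trace (generic_skew i ** generic_skew j ** generic_skew k)) h = trace (h i ** h j ** h k)"
      if "h \<in> V_minus d" "i \<in> {1..d}" "j \<in> {1..d}" "k \<in> {1..d}" for h :: "nat \<Rightarrow> 'a ^ 3 ^ 3" and i j k
      using that by (simp only: eval_at_eq_ev ev_trace ev_matrix_mult ev_generic_skew[OF two])
    have inv2: "eval_at (trace (generic_skew i ** generic_skew j)) ?h
        = eval_at (trace (generic_skew i ** generic_skew j)) h"
      if "i \<in> {1..d}" "j \<in> {1..d}" for i j
      unfolding tr2[OF h' that] tr2[OF h that] using that
      by (simp add: conjugate_mult[OF g] trace_conjugate[OF g])
    show "eval_at f ?h = eval_at f h"
      using f
    proof (elim UnE CollectE exE conjE)
      fix i assume i: "f = sigma 2 (generic_skew i)" "1 \<le> i" "i \<le> d"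
      \<comment> \<open>\<open>- 2 * sigma 2\<close> is the trace of a square, so its invariance
        reduces to that of traces by cancelling 2.\<close>
      have eq: "trace (generic_skew i ** generic_skew i) = - f - f"
        unfolding i(1) trace_generic_skew_2 sigma_generic_skew ..
      have "eval_at (- f - f) x = - 2 * eval_at f x" for x
        unfolding eval_at_eq_ev id_hom.ev_diff id_hom.ev_uminus by simp
      then have "- 2 * eval_at f ?h = - 2 * eval_at f h"
        using inv2[of i i] i(2,3) unfolding eq by simp
      then show ?thesis using two by simp
    next
      fix i j assume "f = trace (generic_skew i ** generic_skew j)" "1 \<le> i" "i < j" "j \<le> d"
      then show ?thesis using inv2[of i j] by simp
    next
      fix i j k
      assume f: "f = trace (generic_skew i ** generic_skew j ** generic_skew k)"
        and "1 \<le> i" "i < j" "j < k" "k \<le> d"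
      then have ijk: "i \<in> {1..d}" "j \<in> {1..d}" "k \<in> {1..d}" by auto
      show ?thesis
        unfolding f tr3[OF h' ijk] tr3[OF h ijk] using ijk
        by (simp add: conjugate_mult[OF g] trace_conjugate[OF g])
    qed
  qed
qed

lemma generated_algebra_invariant:
  assumes "S \<subseteq> (invariants d :: ('n::{finite, linorder}, 'a::field) polynomial set)"
  shows "generated_algebra S \<subseteq> invariants d"
proof
  fix f assume "f \<in> generated_algebra S"
  then show "f \<in> invariants d"
  proof induction
    case (const c)
    show ?case by (simp add: invariants_def R_minus_Const act_fun_def eval_at_eq_ev)
  next
    case (gen f)
    then show ?case using assms by blast
  next
    case (add f g)
    then show ?case by (simp add: invariants_def R_minus_add act_fun_def eval_at_eq_ev)
  next
    case (mult f g)
    then show ?case by (simp add: invariants_def R_minus_mult act_fun_def eval_at_eq_ev)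
  qed
qed

text \<open>The reflection in the plane orthogonal to \<open>a = (- u\<^sub>3, u\<^sub>2, - u\<^sub>1)\<close> acts on the entries of a
  skew-symmetric matrix as the half turn about \<open>u\<close>.\<close>

lemma invariants_half_turn:
  fixes f :: "(3, 'a::field) polynomial"
  assumes f: "f \<in> invariants d" and u: "dot3 u u \<noteq> 0"
  shows "id_hom.ev (half_turn u \<phi>) f = id_hom.ev \<phi> f"
proof -
  obtain p q r where pqr: "u = (p, q, r)" by (cases u)
  define n where "n = p * p + q * q + r * r"
  have n: "n \<noteq> 0" using u by (simp add: pqr n_def add.assoc)
  define c where "c = 2 / n"
  have cn: "c * n = 2" using n by (simp add: c_def)
  define a where "a = (\<lambda>i::3. if i = 0 then - r else if i = 1 then q else - p)"
  have a: "a 0 = - r" "a 1 = q" "a 2 = - p" by (auto simp: a_def three_neq)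
  define g :: "'a ^ 3 ^ 3" where "g = (\<chi> i j. (if i = j then 1 else 0) - c * a i * a j)"
  have sym: "transpose g = g" by (auto simp: g_def transpose_def vec_eq_iff mult_ac)
  have gg: "g ** transpose g = mat 1"
  proof -
    have "(g ** g) $ i $ j = mat 1 $ i $ j" for i j
    proof -
      \<comment> \<open>\<open>g\<close> is the identity minus \<open>c\<close> times
        \<open>a a^T\<close>, and \<open>a\<close> has square length \<open>n\<close>, which
        produces the factor \<open>c * n - 2\<close>.\<close>
      have "(g ** g) $ i $ j = (if i = j then 1 else 0) + (c * n - 2) * c * a i * a j"
        by (cases i rule: three_cases; cases j rule: three_cases)
          (simp_all add: g_def matrix_matrix_mult_def sum_3 three_eq_0 three_neq a n_def algebra_simps)
      then show ?thesis by (simp add: cn mat_def)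
    qed
    then show ?thesis unfolding sym by (simp add: vec_eq_iff)
  qed
  define A where "A = (\<lambda>k. \<chi> i j. if i < j then \<phi> (i, j, k) else if j < i then - \<phi> (j, i, k) else 0 :: 'a ^ 3 ^ 3)"
  define h where "h = (\<lambda>k\<in>{1..d}. A k)"
  have "A k \<in> S_minus" for k
    by (auto simp: S_minus_def A_def transpose_def vec_eq_iff)
  then have h: "h \<in> V_minus d" by (auto simp: h_def V_minus_def)
  have O: "g \<in> orthogonal_group" using gg by (simp add: orthogonal_group_def)
  have inv: "matrix_inv g = g" using orthogonal_group_inverse(1)[OF O] sym by simp
  have R: "f \<in> R_minus d" using f by (simp add: invariants_def)
  have "eval_at f (act_V d g h) = eval_at f h"
    using f O h inv by (auto simp: invariants_def act_fun_def)
  moreover have "eval_at f h = id_hom.ev \<phi> f"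
    unfolding eval_at_eq_ev
    by (rule id_hom.ev_cong[OF R]) (auto simp: variables_def h_def A_def)
  moreover have "eval_at f (act_V d g h) = id_hom.ev (half_turn u \<phi>) f"
    unfolding eval_at_eq_ev
  proof (rule id_hom.ev_cong[OF R])
    fix v :: "3 var" assume "v \<in> variables d"
    then obtain i j k where v: "v = (i, j, k)" "k \<in> {1..d}" and ij: "(i, j) \<in> {(0, 1), (0, 2), (1, 2)}"
      by (auto simp: variables_def three_less_iff)
    define s where "s = p * \<phi> (0, 1, k) + q * \<phi> (0, 2, k) + r * \<phi> (1, 2, k)"
    \<comment> \<open>\<open>s\<close> is the dot product of \<open>u\<close> with the
      \<open>k\<close>-th vector and \<open>w\<close> the coordinate of \<open>u\<close> at the
      position \<open>(i, j)\<close>.\<close>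
    define w where "w = (if (i, j) = (0, 1) then p else if (i, j) = (0, 2) then q else r)"
    have nn: "dot3 u u = n" by (simp add: pqr n_def add.assoc)
    have "(g ** A k ** g) $ i $ j = \<phi> (i, j, k) - c * n * \<phi> (i, j, k) + c * s * w"
      using ij
      by (auto simp: g_def A_def matrix_matrix_mult_def sum_3 three_eq_0 three_neq three_less_iff
          a n_def s_def w_def algebra_simps)
    also have "\<dots> = (2 * s * w - n * \<phi> (i, j, k)) / n"
      unfolding cn using n by (simp add: c_def diff_divide_distrib)
    also have "\<dots> = half_turn u \<phi> (i, j, k)"
      unfolding half_turn_def nn using ij
      by (auto simp: of_entries_def entries_def pqr three_neq w_def s_def algebra_simps)
    finally show "(case v of (i, j, k) \<Rightarrow> act_V d g h k $ i $ j) = half_turn u \<phi> v"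
      using v by (simp add: act_V_def inv h_def)
  qed
  ultimately show ?thesis by simp
qed

section \<open>Descent from the algebraic closure to the ground field\<close>

inductive_set ac_span :: "(('v \<Rightarrow>\<^sub>0 nat) \<Rightarrow>\<^sub>0 'a::field) set \<Rightarrow> (('v \<Rightarrow> 'a alg_closure) \<Rightarrow> 'a alg_closure) set"
  for B where
  zero: "(\<lambda>_. 0) \<in> ac_span B"
| step: "h \<in> ac_span B \<Longrightarrow> b \<in> B \<Longrightarrow> (\<lambda>\<phi>. c * ac_hom.ev \<phi> b + h \<phi>) \<in> ac_span B"

lemma ac_span_add: "f \<in> ac_span B \<Longrightarrow> g \<in> ac_span B \<Longrightarrow> (\<lambda>\<phi>. f \<phi> + g \<phi>) \<in> ac_span B"
  by (induction rule: ac_span.induct) (auto simp: add.assoc intro: ac_span.intros)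

lemma ac_span_ev: "b \<in> B \<Longrightarrow> (\<lambda>\<phi>. ac_hom.ev \<phi> b) \<in> ac_span B"
  using ac_span.step[OF ac_span.zero, of b B 1] by simp

lemma ac_span_mult_ev:
  assumes B: "\<And>a b. a \<in> B \<Longrightarrow> b \<in> B \<Longrightarrow> a * b \<in> B"
    and f: "f \<in> ac_span B" and b: "b \<in> B"
  shows "(\<lambda>\<phi>. (c * ac_hom.ev \<phi> b) * f \<phi>) \<in> ac_span B"
  using f
proof induction
  case zero
  then show ?case using ac_span.zero by simp
next
  case (step h b' c')
  from ac_span.step[OF step.IH B[OF b step.hyps(2)], of "c * c'"]
  show ?case by (simp add: algebra_simps)
qed

lemma ac_span_mult:
  assumes B: "\<And>a b. a \<in> B \<Longrightarrow> b \<in> B \<Longrightarrow> a * b \<in> B"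
    and f: "f \<in> ac_span B" and g: "g \<in> ac_span B"
  shows "(\<lambda>\<phi>. g \<phi> * f \<phi>) \<in> ac_span B"
  using g
proof induction
  case zero
  then show ?case using ac_span.zero by simp
next
  case (step h b c)
  from ac_span_add[OF ac_span_mult_ev[OF B f step.hyps(2)] step.IH, of c]
  show ?case by (simp add: distrib_right)
qed

text \<open>A linear retraction of the closure onto \<open>'a\<close> takes the coefficients back to the ground field.\<close>

lemma ac_span_descent:
  fixes f :: "('v \<Rightarrow>\<^sub>0 nat) \<Rightarrow>\<^sub>0 'a::field"
  assumes inf: "infinite (UNIV :: 'a set)"
    and f: "(\<lambda>\<phi>. ac_hom.ev \<phi> f) \<in> ac_span B"
    and B: "\<And>c. Poly_Mapping.single 0 c \<in> B" "\<And>a b. a \<in> B \<Longrightarrow> b \<in> B \<Longrightarrow> a + b \<in> B"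
      "\<And>a b. a \<in> B \<Longrightarrow> b \<in> B \<Longrightarrow> a * b \<in> B"
  shows "f \<in> B"
proof -
  obtain \<pi> :: "'a alg_closure \<Rightarrow> 'a" where \<pi>: "\<And>x y. \<pi> (x + y) = \<pi> x + \<pi> y"
    "\<And>c x. \<pi> (to_ac c * x) = c * \<pi> x" "\<pi> 1 = 1"
    using linear_retraction_to_ac by blast
  have \<pi>0: "\<pi> 0 = 0" using \<pi>(2)[of 0 0] by simp
  \<comment> \<open>At points over \<open>'a\<close> the polynomials in \<open>B\<close> take values
    in \<open>'a\<close>, so \<open>\<pi>\<close> only replaces each coefficient \<open>c\<close> by
    \<open>\<pi> c\<close>; the result is again an element of \<open>B\<close>.\<close>
  have "\<exists>b\<in>B. \<forall>\<phi>. \<pi> (h (\<lambda>v. to_ac (\<phi> v))) = id_hom.ev \<phi> b" if "h \<in> ac_span B" for h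
    using that
  proof induction
    case zero
    show ?case using B(1)[of 0] \<pi>0 by (intro bexI[of _ 0]) simp_all
  next
    case (step h b c)
    then obtain b' where b': "b' \<in> B" "\<forall>\<phi>. \<pi> (h (\<lambda>v. to_ac (\<phi> v))) = id_hom.ev \<phi> b'" by blast
    have "\<pi> (c * ac_hom.ev (\<lambda>v. to_ac (\<phi> v)) b + h (\<lambda>v. to_ac (\<phi> v)))
        = id_hom.ev \<phi> (Poly_Mapping.single 0 (\<pi> c) * b + b')" for \<phi>
      using b'(2) \<pi>(2)[of "id_hom.ev \<phi> b" c]
      by (simp add: \<pi>(1) ac_hom_ev mult.commute[of c] id_hom.ev_single mult.commute[of "\<pi> c"])
    then show ?case using B b'(1) step.hyps(2) by blast
  qed
  from this[OF f] obtain b where b: "b \<in> B" "\<And>\<phi>. \<pi> (to_ac (id_hom.ev \<phi> f)) = id_hom.ev \<phi> b"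
    unfolding ac_hom_ev by blast
  have "id_hom.ev \<phi> f = id_hom.ev \<phi> b" for \<phi>
    using b(2)[of \<phi>] \<pi>(2)[of "id_hom.ev \<phi> f" 1] \<pi>(3) by simp
  then have "f = b" by (rule ev_inject[OF inf])
  then show ?thesis using b(1) by simp
qed

lemma generated_algebra_uminus: "f \<in> generated_algebra S \<Longrightarrow> - f \<in> generated_algebra S"
proof -
  assume "f \<in> generated_algebra S"
  then have "Const (- 1) * f \<in> generated_algebra S"
    by (intro generated_algebra.mult generated_algebra.const)
  moreover have "Const (- 1) = (- 1 :: ('a, 'b) polynomial)"
    by (simp add: Const_def single_uminus)
  ultimately show ?thesis by simp
qed

text \<open>Increasing indices suffice: dot products are symmetric, triple products are alternating,
  and the factor \<open>- 2\<close> in the traces is invertible.\<close>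

lemma basic_invariants_generated:
  fixes d :: nat
  assumes two: "(2::'a::field) \<noteq> 0"
  defines "B \<equiv> generated_algebra (skew_generators d) :: (3, 'a) polynomial set"
  shows "basic_invariants {1..d} entries \<subseteq> (\<lambda>b \<phi>. ac_hom.ev \<phi> b) ` B"
proof -
  define D :: "nat \<Rightarrow> nat \<Rightarrow> (3, 'a) polynomial" where "D = (\<lambda>k l.
    Var (0, 1, k) * Var (0, 1, l) + Var (0, 2, k) * Var (0, 2, l) + Var (1, 2, k) * Var (1, 2, l))"
  define T :: "nat \<Rightarrow> nat \<Rightarrow> nat \<Rightarrow> (3, 'a) polynomial" where
    "T = (\<lambda>j k l. Var (0, 1, j) * (Var (0, 2, k) * Var (1, 2, l) - Var (1, 2, k) * Var (0, 2, l))
    + Var (0, 2, j) * (Var (1, 2, k) * Var (0, 1, l) - Var (0, 1, k) * Var (1, 2, l))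
    + Var (1, 2, j) * (Var (0, 1, k) * Var (0, 2, l) - Var (0, 2, k) * Var (0, 1, l)))"
  have D_less: "D k l \<in> B" if "1 \<le> k" "k < l" "l \<le> d" for k l
  proof -
    have tr: "trace (generic_skew k ** generic_skew l) = - D k l - D k l"
      unfolding trace_generic_skew_2 D_def ..
    have "trace (generic_skew k ** generic_skew l) \<in> skew_generators d" using that by blast
    then have "Const (- 1 / 2) * (- D k l - D k l) \<in> B"
      unfolding B_def tr[symmetric] by (intro generated_algebra.mult generated_algebra.const generated_algebra.gen)
    moreover have "Const (- 1 / 2) * (- D k l - D k l) = (Const (1 / 2) + Const (1 / 2)) * D k l"
      by (simp add: Const_def single_uminus distrib_right right_diff_distrib)
    moreover have "Const (1 / 2) + Const (1 / 2) = (1 :: (3, 'a) polynomial)"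
      unfolding Const_def single_add[symmetric] using two
      by (simp add: add_divide_distrib[symmetric])
    ultimately show ?thesis by simp
  qed
  have D: "D k l \<in> B" if k: "k \<in> {1..d}" and l: "l \<in> {1..d}" for k l
  proof (cases k l rule: linorder_cases)
    case less
    then show ?thesis using D_less k l by simp
  next
    case equal
    have "sigma 2 (generic_skew k) \<in> skew_generators d" using k by auto
    then have "sigma 2 (generic_skew k) \<in> B" unfolding B_def by (rule generated_algebra.gen)
    moreover have "sigma 2 (generic_skew k) = D k k" unfolding sigma_generic_skew D_def ..
    ultimately show ?thesis using equal by simp
  next
    case greater
    have "D k l = D l k" by (simp add: D_def mult.commute)
    then show ?thesis using D_less[of l k] k l greater by simp
  qed
  have T_less: "T j k l \<in> B" if "1 \<le> j" "j < k" "k < l" "l \<le> d" for j k l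
  proof -
    have "trace (generic_skew j ** generic_skew k ** generic_skew l) = T j k l"
      unfolding trace_generic_skew_3 T_def ..
    moreover have "trace (generic_skew j ** generic_skew k ** generic_skew l) \<in> skew_generators d"
      using that by blast
    then have "trace (generic_skew j ** generic_skew k ** generic_skew l) \<in> B"
      unfolding B_def by (rule generated_algebra.gen)
    ultimately show ?thesis by simp
  qed
  have T_swap: "T j k l = - T k j l" "T j k l = - T j l k" for j k l
    by (simp_all add: T_def algebra_simps)
  have T_eq: "T j j l = 0" "T j k k = 0" for j k l
    by (simp_all add: T_def algebra_simps)
  have neg: "- f \<in> B \<longleftrightarrow> f \<in> B" for f
    using generated_algebra_uminus[of f "skew_generators d"]
      generated_algebra_uminus[of "- f" "skew_generators d"] by (auto simp: B_def)
  have zero: "0 \<in> B"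
    using generated_algebra.const[of 0 "skew_generators d :: (3, 'a) polynomial set"]
    by (simp add: B_def Const_def)
  have T1: "T j k l \<in> B" if "j \<in> {1..d}" "k \<in> {1..d}" "l \<in> {1..d}" "k < l" for j k l
  proof -
    consider "j < k" | "j = k" | "k < j" "j < l" | "j = l" | "l < j" using that(4) by linarith
    then show ?thesis
    proof cases
      case 1
      then show ?thesis using T_less that by simp
    next
      case 2
      then show ?thesis using T_eq(1) zero by simp
    next
      case 3
      then show ?thesis using T_less[of k j l] T_swap(1)[of j k l] neg that by simp
    next
      case 4
      then show ?thesis using T_swap(1)[of l k l] T_eq(2)[of k l] zero by simp
    next
      case 5
      then show ?thesis
        using T_less[of k l j] T_swap(1)[of j k l] T_swap(2)[of k j l] that by simp
    qed
  qed
  have T: "T j k l \<in> B" if "j \<in> {1..d}" "k \<in> {1..d}" "l \<in> {1..d}" for j k l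
  proof (cases k l rule: linorder_cases)
    case less
    then show ?thesis using T1 that by simp
  next
    case equal
    then show ?thesis using T_eq(2) zero by simp
  next
    case greater
    then show ?thesis using T1[of j l k] T_swap(2)[of j k l] neg that by simp
  qed
  have evD: "(\<lambda>\<phi>. dot3 (entries k \<phi>) (entries l \<phi>)) = (\<lambda>\<phi>. ac_hom.ev \<phi> (D k l))" for k l
    by (simp add: D_def entries_def)
  have evT: "(\<lambda>\<phi>. dot3 (entries j \<phi>) (vprod (entries k \<phi>) (entries l \<phi>))) = (\<lambda>\<phi>. ac_hom.ev \<phi> (T j k l))" for j k l
    by (simp add: T_def entries_def)
  show ?thesis
    unfolding basic_invariants_def
  proof (intro Un_least subsetI; elim CollectE exE conjE)
    show "f \<in> (\<lambda>b \<phi>. ac_hom.ev \<phi> b) ` B"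
      if "f = (\<lambda>\<phi>. dot3 (entries k \<phi>) (entries l \<phi>))" "k \<in> {1..d}" "l \<in> {1..d}" for f k l
      unfolding that(1) evD using D[OF that(2,3)] by blast
    show "f \<in> (\<lambda>b \<phi>. ac_hom.ev \<phi> b) ` B"
      if "f = (\<lambda>\<phi>. dot3 (entries j \<phi>) (vprod (entries k \<phi>) (entries l \<phi>)))"
        "j \<in> {1..d}" "k \<in> {1..d}" "l \<in> {1..d}" for f j k l
      unfolding that(1) evT using T[OF that(2-4)] by blast
  qed
qed

lemma alg_closed_quadratic: "\<exists>x. x * x + b * x + c = (0 :: 'k::alg_closed_field)"
proof -
  have "\<exists>x. poly [:c, b, 1:] x = 0" by (rule alg_closed_imp_poly_has_root) simp
  then show ?thesis by (auto simp: algebra_simps)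
qed

theorem invariants_subset_generated_algebra:
  fixes d :: nat
  assumes inf: "infinite (UNIV :: 'a::field set)" and two: "(2::'a) \<noteq> 0"
  shows "(invariants d :: (3, 'a) polynomial set) \<subseteq> generated_algebra (skew_generators d)"
proof
  fix f :: "(3, 'a) polynomial"
  assume f: "f \<in> invariants d"
  let ?B = "generated_algebra (skew_generators d) :: (3, 'a) polynomial set"
  have inj: "inj (to_ac :: 'a \<Rightarrow> 'a alg_closure)" by (simp add: inj_def to_ac_inject)
  then have E: "infinite (range (to_ac :: 'a \<Rightarrow> 'a alg_closure))"
    using inf finite_imageD by blast
  obtain \<iota> :: "'a alg_closure" where \<iota>: "\<iota> * \<iota> + 0 * \<iota> + 1 = 0" using alg_closed_quadratic by blast
  interpret K: field_with_i \<iota>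
  proof
    show "\<iota> * \<iota> = - 1" using \<iota> by (simp add: eq_neg_iff_add_eq_0)
    have "to_ac (2::'a) \<noteq> to_ac 0" unfolding to_ac_inject by (rule two)
    then show "(2 :: 'a alg_closure) \<noteq> 0" by simp
    show "infinite (UNIV :: 'a alg_closure set)" by (rule infinite_super[OF subset_UNIV E])
  qed
  have R: "f \<in> R_minus d" using f by (simp add: invariants_def)
  have F: "(\<lambda>\<phi>. ac_hom.ev \<phi> f) \<in> falg (basic_invariants {1..d} entries)"
  proof (rule K.invariant_in_falg[OF alg_closed_quadratic ac_hom.ev_polyfun])
    show "ac_hom.ev (restrict_vars d \<phi>) f = ac_hom.ev \<phi> f" for \<phi>
      by (rule ac_hom.ev_cong[OF R]) (simp add: restrict_vars_def)
    show "ac_hom.ev (half_turn u \<phi>) f = ac_hom.ev \<phi> f" if "dot3 u u \<noteq> 0" for u \<phi>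
    \<comment> \<open>The grid is the copy of \<open>'a\<close> in its closure; there the claim is
      the invariance of \<open>f\<close> over \<open>'a\<close>.\<close>
    proof (rule half_turn_invariance_extends[OF ac_hom.ev_polyfun E _ that])
      fix u\<^sub>1 u\<^sub>2 u\<^sub>3 :: "'a alg_closure" and \<phi> :: "3 var \<Rightarrow> 'a alg_closure"
      assume "u\<^sub>1 \<in> range to_ac" "u\<^sub>2 \<in> range to_ac" "u\<^sub>3 \<in> range to_ac"
        and \<phi>: "\<And>v. \<phi> v \<in> range to_ac" and n: "dot3 (u\<^sub>1, u\<^sub>2, u\<^sub>3) (u\<^sub>1, u\<^sub>2, u\<^sub>3) \<noteq> 0"
      then obtain a\<^sub>1 a\<^sub>2 a\<^sub>3 where a: "u\<^sub>1 = to_ac a\<^sub>1" "u\<^sub>2 = to_ac a\<^sub>2" "u\<^sub>3 = to_ac a\<^sub>3" by blast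
      have "\<forall>v. \<exists>x. \<phi> v = to_ac x" using \<phi> by blast
      from choice[OF this] obtain \<psi> where \<psi>: "\<phi> = (\<lambda>v. to_ac (\<psi> v))" by blast
      have dots: "dot3 (to_ac x, to_ac y, to_ac z) (to_ac x', to_ac y', to_ac z') = to_ac (dot3 (x, y, z) (x', y', z'))"
        for x y z x' y' z' :: 'a by simp
      have nz: "dot3 (a\<^sub>1, a\<^sub>2, a\<^sub>3) (a\<^sub>1, a\<^sub>2, a\<^sub>3) \<noteq> 0"
        using n unfolding a dots by (metis to_ac_0)
      have "half_turn (u\<^sub>1, u\<^sub>2, u\<^sub>3) \<phi> v = to_ac (half_turn (a\<^sub>1, a\<^sub>2, a\<^sub>3) \<psi> v)" for v
        by (cases v) (simp add: half_turn_def of_entries_def entries_def a \<psi>)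
      then have "half_turn (u\<^sub>1, u\<^sub>2, u\<^sub>3) \<phi> = (\<lambda>v. to_ac (half_turn (a\<^sub>1, a\<^sub>2, a\<^sub>3) \<psi> v))" by blast
      then show "ac_hom.ev (half_turn (u\<^sub>1, u\<^sub>2, u\<^sub>3) \<phi>) f = ac_hom.ev \<phi> f"
        using invariants_half_turn[OF f nz, of \<psi>] by (simp add: ac_hom_ev \<psi>)
    qed
  qed
  have mult: "a * b \<in> ?B" if "a \<in> ?B" "b \<in> ?B" for a b
    using that by (rule generated_algebra.mult)
  \<comment> \<open>Since \<open>?B\<close> is closed under products, polynomials in the basic
    invariants over the closure are linear combinations of elements of \<open>?B\<close>.\<close>
  have "h \<in> ac_span ?B" if "h \<in> falg (basic_invariants {1..d} entries)" for h
    using that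
  proof induction
    case (const c)
    show ?case using ac_span.step[OF ac_span.zero generated_algebra.const[of 1], of c] by simp
  next
    case (gen h)
    then obtain b where "b \<in> ?B" "h = (\<lambda>\<phi>. ac_hom.ev \<phi> b)"
      using basic_invariants_generated[OF two, of d] by blast
    then show ?case using ac_span_ev by simp
  next
    case (add g h)
    then show ?case by (intro ac_span_add)
  next
    case (mult g h)
    then show ?case by (intro ac_span_mult[OF \<open>\<And>a b. a \<in> ?B \<Longrightarrow> b \<in> ?B \<Longrightarrow> a * b \<in> ?B\<close>])
  qed
  from this[OF F] show "f \<in> ?B"
  proof (rule ac_span_descent[OF inf])
    show "Poly_Mapping.single 0 c \<in> ?B" for c
      using generated_algebra.const[of c] by (simp add: Const_def)
  qed (auto intro: generated_algebra.intros)
qed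

section \<open>Minimality\<close>

definition total_degree :: "('v \<Rightarrow>\<^sub>0 nat) \<Rightarrow> nat" where
  "total_degree m = (\<Sum>v\<in>Poly_Mapping.keys m. Poly_Mapping.lookup m v)"

lemma total_degree_superset:
  assumes "finite S" "Poly_Mapping.keys m \<subseteq> S"
  shows "total_degree m = (\<Sum>v\<in>S. Poly_Mapping.lookup m v)"
  unfolding total_degree_def using assms by (intro sum.mono_neutral_left) (auto simp: in_keys_iff)

lemma total_degree_add: "total_degree (m + m') = total_degree m + total_degree m'"
proof -
  let ?S = "Poly_Mapping.keys m \<union> Poly_Mapping.keys m'"
  have "total_degree (m + m') = (\<Sum>v\<in>?S. Poly_Mapping.lookup (m + m') v)"
    using Poly_Mapping.keys_add[of m m'] by (intro total_degree_superset) auto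
  then show ?thesis
    by (simp add: lookup_add sum.distrib total_degree_superset[of ?S])
qed

lemma total_degree_eq_0: "total_degree m = 0 \<Longrightarrow> m = 0"
  by (rule poly_mapping_eqI) (auto simp: total_degree_def in_keys_iff)

lemma total_degree_0 [simp]: "total_degree 0 = 0"
  by (simp add: total_degree_def)

text \<open>The multidegree distinguishes the generators from each other, and the total degree
  separates them from products of generators.\<close>

definition homogeneous_of :: "nat \<Rightarrow> (nat \<Rightarrow> nat) \<Rightarrow> ('n::{finite, linorder}, 'a::field) polynomial \<Rightarrow> bool" where
  "homogeneous_of n t f \<longleftrightarrow> (\<forall>m\<in>Poly_Mapping.keys f. total_degree m = n \<and> multidegree m = t)"

lemma multidegree_add: "multidegree (m + m') = (\<lambda>k. multidegree m k + multidegree m' k)"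
  by (rule ext) (simp add: multidegree_def lookup_add sum.distrib case_prod_unfold)

lemma homogeneous_of_add: "homogeneous_of n t f \<Longrightarrow> homogeneous_of n t g \<Longrightarrow> homogeneous_of n t (f + g)"
  using Poly_Mapping.keys_add[of f g] unfolding homogeneous_of_def by blast

lemma homogeneous_of_uminus: "homogeneous_of n t f \<Longrightarrow> homogeneous_of n t (- f)"
  by (simp add: homogeneous_of_def)

lemma homogeneous_of_diff: "homogeneous_of n t f \<Longrightarrow> homogeneous_of n t g \<Longrightarrow> homogeneous_of n t (f - g)"
  using homogeneous_of_add[of n t f "- g"] homogeneous_of_uminus[of n t g] by simp

lemma homogeneous_of_mult:
  assumes "homogeneous_of n t f" "homogeneous_of n' t' g"
  shows "homogeneous_of (n + n') (\<lambda>k. t k + t' k) (f * g)"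
  unfolding homogeneous_of_def
proof
  fix m assume "m \<in> Poly_Mapping.keys (f * g)"
  then obtain a b where "m = a + b" "a \<in> Poly_Mapping.keys f" "b \<in> Poly_Mapping.keys g"
    using Poly_Mapping.keys_mult[of f g] by blast
  then show "total_degree m = n + n' \<and> multidegree m = (\<lambda>k. t k + t' k)"
    using assms by (auto simp: homogeneous_of_def total_degree_add multidegree_add)
qed

lemma homogeneous_of_Var:
  assumes "i < j"
  shows "homogeneous_of 1 (count {#k#}) (Var (i, j, k) :: ('n::{finite, linorder}, 'a::field) polynomial)"
proof -
  have "multidegree (Poly_Mapping.single (i, j, k) (1::nat)) l = count {#k#} l" for l
  proof -
    have "multidegree (Poly_Mapping.single (i, j, k) (1::nat)) l
      = (\<Sum>p\<in>{(i, j). i < j}. if p = (i, j) then count {#k#} l else 0)"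
      unfolding multidegree_def by (intro sum.cong) (auto simp: lookup_single when_def split: if_splits)
    then show ?thesis using assms by (simp add: sum.delta)
  qed
  moreover have "total_degree (Poly_Mapping.single (i, j, k) (1::nat)) = 1"
    using total_degree_superset[of "{(i, j, k)}" "Poly_Mapping.single (i, j, k) 1"] by simp
  ultimately show ?thesis by (auto simp: homogeneous_of_def Var_def)
qed

lemma homogeneous_of_Vars:
  fixes k l j :: nat
  defines "V \<equiv> Var :: 3 var \<Rightarrow> (3, 'a::field) polynomial"
  assumes "(a, b) \<in> {(0, 1), (0, 2), (1, 2)}" "(a', b') \<in> {(0, 1), (0, 2), (1, 2)}"
    "(a'', b'') \<in> {(0, 1), (0, 2), (1, 2)}"
  shows "homogeneous_of 2 (count {#k, l#}) (V (a, b, k) * V (a', b', l))"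
    and "homogeneous_of 3 (count {#j, k, l#}) (V (a, b, j) * (V (a', b', k) * V (a'', b'', l)))"
proof -
  have ab: "a < b" "a' < b'" "a'' < b''" using assms(2-4) by (simp_all only: three_less_iff)
  note h = homogeneous_of_Var[OF ab(1), where ?'a = 'a, folded V_def]
    homogeneous_of_Var[OF ab(2), where ?'a = 'a, folded V_def]
    homogeneous_of_Var[OF ab(3), where ?'a = 'a, folded V_def]
  have "(\<lambda>i. count {#k#} i + count {#l#} i) = count {#k, l#}"
    "(\<lambda>i. count {#j#} i + (count {#k#} i + count {#l#} i)) = count {#j, k, l#}" by auto
  then show "homogeneous_of 2 (count {#k, l#}) (V (a, b, k) * V (a', b', l))"
    "homogeneous_of 3 (count {#j, k, l#}) (V (a, b, j) * (V (a', b', k) * V (a'', b'', l)))"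
    using homogeneous_of_mult[OF h(1)[of k] h(2)[of l]]
      homogeneous_of_mult[OF h(1)[of j] homogeneous_of_mult[OF h(2)[of k] h(3)[of l]]]
    by (simp_all only: one_add_one) (simp_all add: numeral_3_eq_3)
qed

text \<open>Each generator is labelled by the multiset of its indices, whose \<open>count\<close> is
  its multidegree; distinct generators have distinct labels.\<close>

inductive skew_generator :: "nat \<Rightarrow> nat multiset \<Rightarrow> (3, 'a::field) polynomial \<Rightarrow> bool" for d where
  sigma: "1 \<le> i \<Longrightarrow> i \<le> d \<Longrightarrow> skew_generator d {#i, i#} (sigma 2 (generic_skew i))"
| trace2: "1 \<le> i \<Longrightarrow> i < j \<Longrightarrow> j \<le> d \<Longrightarrow> skew_generator d {#i, j#} (trace (generic_skew i ** generic_skew j))"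
| trace3: "1 \<le> i \<Longrightarrow> i < j \<Longrightarrow> j < k \<Longrightarrow> k \<le> d \<Longrightarrow>
    skew_generator d {#i, j, k#} (trace (generic_skew i ** generic_skew j ** generic_skew k))"

lemma skew_generators_eq: "skew_generators d = {f :: (3, 'a::field) polynomial. \<exists>I. skew_generator d I f}"
proof (rule Set.equalityI; rule subsetI)
  show "f \<in> {f. \<exists>I. skew_generator d I f}" if "f \<in> skew_generators d" for f :: "(3, 'a) polynomial"
    using that
  proof (elim UnE CollectE exE conjE)
    fix i assume "f = sigma 2 (generic_skew i)" "1 \<le> i" "i \<le> d"
    then show ?thesis using skew_generator.sigma[of i d] by blast
  next
    fix i j assume "f = trace (generic_skew i ** generic_skew j)" "1 \<le> i" "i < j" "j \<le> d"
    then show ?thesis using skew_generator.trace2[of i j d] by blast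
  next
    fix i j k assume "f = trace (generic_skew i ** generic_skew j ** generic_skew k)"
      "1 \<le> i" "i < j" "j < k" "k \<le> d"
    then show ?thesis using skew_generator.trace3[of i j k d] by blast
  qed
  show "f \<in> skew_generators d" if "f \<in> {f. \<exists>I. skew_generator d I f}" for f :: "(3, 'a) polynomial"
    using that by (auto elim!: skew_generator.cases)
qed

lemma skew_generator_homogeneous:
  assumes "skew_generator d I f"
  shows "homogeneous_of (size I) (count I) f"
  using assms
proof cases
  case (sigma i)
  have "homogeneous_of 2 (count {#i, i#}) f"
    unfolding sigma(2) sigma_generic_skew by (intro homogeneous_of_add homogeneous_of_Vars) auto
  then show ?thesis using sigma(1) by (simp add: numeral_2_eq_2)
next
  case (trace2 i j)
  have "homogeneous_of 2 (count {#i, j#}) f"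
    unfolding trace2(2) trace_generic_skew_2
    by (intro homogeneous_of_diff homogeneous_of_uminus homogeneous_of_add homogeneous_of_Vars) auto
  then show ?thesis using trace2(1) by (simp add: numeral_2_eq_2)
next
  case (trace3 i j k)
  have "homogeneous_of 3 (count {#i, j, k#}) f"
    unfolding trace3(2) trace_generic_skew_3 right_diff_distrib
    by (intro homogeneous_of_diff homogeneous_of_add homogeneous_of_Vars(2)) auto
  then show ?thesis using trace3(1) by (simp add: numeral_3_eq_3)
qed

lemma skew_generator_unique:
  assumes "skew_generator d I f" "skew_generator d I g"
  shows "f = g"
  using assms(2,1)
proof cases
  case (sigma i)
  from assms(1)[unfolded sigma(1)] show ?thesis
    by cases (auto simp: sigma(2) add_mset_eq_single add_eq_conv_ex split: if_splits)
next
  case (trace2 i j)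
  from assms(1)[unfolded trace2(1)] show ?thesis
    by cases (use trace2 in \<open>auto simp: add_eq_conv_ex\<close>)
next
  case (trace3 i j k)
  from assms(1)[unfolded trace3(1)] show ?thesis
    by cases (use trace3 in \<open>auto simp: add_eq_conv_ex\<close>)
qed

lemma skew_generator_nonzero:
  assumes two: "(2::'a::field) \<noteq> 0" and "skew_generator d I (f :: (3, 'a) polynomial)"
  shows "f \<noteq> 0"
  using assms(2)
proof cases
  case (sigma i)
  \<comment> \<open>All vectors are \<open>(1, 0, 0)\<close>, so every dot product is 1.\<close>
  define \<phi> :: "3 var \<Rightarrow> 'a" where "\<phi> = (\<lambda>(a, b, c). if b = 1 then 1 else 0)"
  have "id_hom.ev \<phi> f = 1" unfolding sigma(2) sigma_generic_skew by (simp add: \<phi>_def three_neq)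
  then show ?thesis by auto
next
  case (trace2 i j)
  define \<phi> :: "3 var \<Rightarrow> 'a" where "\<phi> = (\<lambda>(a, b, c). if b = 1 then 1 else 0)"
  have "id_hom.ev \<phi> f = - 2" unfolding trace2(2) trace_generic_skew_2
      id_hom.ev_diff id_hom.ev_uminus id_hom.ev_add id_hom.ev_mult id_hom.ev_Var
    by (simp add: \<phi>_def three_neq)
  then show ?thesis using two by auto
next
  case (trace3 i j k)
  \<comment> \<open>The vectors \<open>i\<close>, \<open>j\<close>, \<open>k\<close> form the
    standard basis, whose triple product is 1.\<close>
  define \<phi> :: "3 var \<Rightarrow> 'a" where
    "\<phi> = (\<lambda>(a, b, c). if (a, b, c) \<in> {(0, 1, i), (0, 2, j), (1, 2, k)} then 1 else 0)"
  have "id_hom.ev \<phi> f = 1" unfolding trace3(2) trace_generic_skew_3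
    using trace3 by (simp add: \<phi>_def three_neq)
  then show ?thesis by auto
qed

text \<open>Products of two elements without constant and linear terms have degree at least 4, so
  polynomials without linear terms and without a given monomial of degree at most 3 form an
  algebra.\<close>

lemma generated_algebra_avoids:
  fixes S :: "('n, 'a::field) polynomial set"
  assumes m0: "total_degree m\<^sub>0 \<in> {2, 3}"
    and S: "\<And>f m. f \<in> S \<Longrightarrow> m \<in> Poly_Mapping.keys f \<Longrightarrow> m \<noteq> m\<^sub>0 \<and> total_degree m \<noteq> 1"
    and f: "f \<in> generated_algebra S"
  shows "\<forall>m\<in>Poly_Mapping.keys f. m \<noteq> m\<^sub>0 \<and> total_degree m \<noteq> 1"
  using f
proof induction
  case (const c)
  then show ?case using m0 by (auto simp: Const_def split: if_splits)
next
  case (gen f)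
  then show ?case using S by blast
next
  case (add f g)
  then show ?case using Poly_Mapping.keys_add[of f g] by blast
next
  case (mult f g)
  show ?case
  proof
    fix m assume "m \<in> Poly_Mapping.keys (f * g)"
    then obtain a b where ab: "m = a + b" "a \<in> Poly_Mapping.keys f" "b \<in> Poly_Mapping.keys g"
      using Poly_Mapping.keys_mult[of f g] by blast
    have a: "a \<noteq> m\<^sub>0" "total_degree a \<noteq> 1" and b: "b \<noteq> m\<^sub>0" "total_degree b \<noteq> 1"
      using mult.IH ab by auto
    consider "a = 0" | "b = 0" | "total_degree a \<ge> 2" "total_degree b \<ge> 2"
      using a(2) b(2) total_degree_eq_0[of a] total_degree_eq_0[of b] by linarith
    then show "m \<noteq> m\<^sub>0 \<and> total_degree m \<noteq> 1"
    proof cases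
      case 3
      then have "total_degree m \<ge> 4" by (simp add: ab(1) total_degree_add)
      then show ?thesis using m0 by auto
    qed (use a b ab(1) in auto)
  qed
qed

theorem theorem1p6:
  fixes d :: nat
  assumes "infinite (UNIV :: 'a::field set)"
    and "CHAR('a) \<noteq> 2"
    and "d > 0"
  shows "minimal_homogeneous_generators d (invariants d :: (3, 'a) polynomial set)
    ({sigma 2 (generic_skew i) | i. 1 \<le> i \<and> i \<le> d} \<union>
     {trace (generic_skew i ** generic_skew j) | i j. 1 \<le> i \<and> i < j \<and> j \<le> d} \<union>
     {trace (generic_skew i ** generic_skew j ** generic_skew k) | i j k.
        1 \<le> i \<and> i < j \<and> j < k \<and> k \<le> d})"
proof -
  have two: "(2::'a) \<noteq> 0"
  proof
    assume "(2::'a) = 0"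
    then have "of_nat 2 = (0::'a)" by simp
    then have "CHAR('a) dvd 2" by (simp only: of_nat_eq_0_iff_char_dvd)
    then have "CHAR('a) \<le> 2" "CHAR('a) \<noteq> 0" by (auto simp: dvd_imp_le intro: Nat.gr0I)
    moreover have "CHAR('a) \<noteq> 1" by simp
    ultimately show False using assms(2) by linarith
  qed
  let ?S = "skew_generators d :: (3, 'a) polynomial set"
  have inv: "?S \<subseteq> invariants d" by (rule skew_generators_invariant[OF two])
  have hom: "homogeneous d f" if f: "f \<in> ?S" for f
  proof -
    obtain I where "skew_generator d I f" using f unfolding skew_generators_eq by blast
    from skew_generator_homogeneous[OF this] show ?thesis
      unfolding homogeneous_of_def homogeneous_def by (intro exI[of _ "count I"]) simp
  qed
  have gens: "homogeneous_generators d (invariants d) ?S"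
    unfolding homogeneous_generators_def
    using inv hom generated_algebra_invariant[OF inv] invariants_subset_generated_algebra[OF assms(1) two, of d]
    by blast
  have "\<not> homogeneous_generators d (invariants d) T" if T: "T \<subset> ?S" for T
  proof
    assume "homogeneous_generators d (invariants d) T"
    then have gen: "generated_algebra T = invariants d" by (simp add: homogeneous_generators_def)
    obtain s where s: "s \<in> ?S" "s \<notin> T" using T by blast
    obtain I where I: "skew_generator d I s" using s(1) unfolding skew_generators_eq by blast
    \<comment> \<open>A monomial of the omitted generator. By multidegree it occurs in no element of
      \<open>T\<close>, and these have no linear terms, so it occurs nowhere in the algebra
      generated by \<open>T\<close>, although \<open>s\<close> lies there.\<close>
    obtain m\<^sub>0 where m0: "m\<^sub>0 \<in> Poly_Mapping.keys s"
      using skew_generator_nonzero[OF two I] by (metis keys_eq_empty ex_in_conv)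
    have size: "size J \<in> {2, 3}" if "skew_generator d J f" for J and f :: "(3, 'a) polynomial"
      using that by cases auto
    have deg: "total_degree m = size J \<and> multidegree m = count J"
      if "skew_generator d J f" "m \<in> Poly_Mapping.keys f" for J m and f :: "(3, 'a) polynomial"
      using skew_generator_homogeneous[OF that(1)] that(2) by (simp add: homogeneous_of_def)
    have "m \<noteq> m\<^sub>0 \<and> total_degree m \<noteq> 1" if f: "f \<in> T" and m: "m \<in> Poly_Mapping.keys f" for f m
    proof -
      obtain J where J: "skew_generator d J f" using f T unfolding skew_generators_eq by blast
      have "I \<noteq> J" using skew_generator_unique[OF I] J f s(2) by blast
      then have "count I \<noteq> count J" by (simp add: count_inject)
      then show ?thesis using deg[OF I m0] deg[OF J m] size[OF J] by auto
    qed
    moreover have "total_degree m\<^sub>0 \<in> {2, 3}" using deg[OF I m0] size[OF I] by simp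
    moreover have "s \<in> generated_algebra T" unfolding gen using s(1) inv by blast
    ultimately show False using generated_algebra_avoids[of m\<^sub>0 T s] m0 by blast
  qed
  then show ?thesis
    using gens unfolding minimal_homogeneous_generators_def by blast
qed

end
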